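(* Let $(S,T^{1,0}S,\eta)$ be a Sasakian $\eta$-Einstein manifold of dimension $2n+1$ with Einstein constant $(n+1)\lambda$. Then the $Q$-prime curvature $Q'_\eta$ is $$Q'_\eta=2(n!)^2\lambda^{n+1}.$$
   Context: **CR and Sasakian manifolds.** $S$ is a smooth $(2n+1)$-manifold without boundary, $n\ge1$. A CR structure is a complex rank-$n$ subbundle $T^{1,0}S\subset TS\otimes\mathbb{C}$ with $T^{1,0}S\cap T^{0,1}S=0$ ($T^{0,1}S=\overline{T^{1,0}S}$) and $[\Gamma(T^{1,0}S),\Gamma(T^{1,0}S)]\subset\Gamma(T^{1,0}S)$. Put $HS=\operatorname{Re}T^{1,0}S$, with complex structure $J$ whose $\sqrt{-1}$-eigenbundle is $T^{1,0}S$. A contact form $\eta$ is a nowhere vanishing real 1-form annihilating $HS$ such that the Levi form $-\sqrt{-1}\,d\eta(Z,\overline W)$ on $T^{1,0}S$ is positive definite. The Reeb field $\xi$ satisfies $\eta(\xi)=1$, $\iota_\xi d\eta=0$. For a local frame $(Z_\alpha)$ of $T^{1,0}S$ let $(\eta,\theta^\alpha,\theta^{\bar\beta})$ be dual to $(\xi,Z_\alpha,Z_{\bar\beta}=\overline{Z_\beta})$; then $d\eta=\sqrt{-1}\,l_{\alpha\bar\beta}\theta^\alpha\wedge\theta^{\bar\beta}$, and $l$ raises and lowers indices. The Tanaka-Webster connection is $\nabla Z_\alpha=\omega_\alpha{}^\beta Z_\beta$, $\nabla\xi=0$ (extended by conjugation), with $dl_{\alpha\bar\beta}=\omega_{\alpha\bar\beta}+\omega_{\bar\beta\alpha}$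 and $d\theta^\alpha=\theta^\beta\wedge\omega_\beta{}^\alpha+A^\alpha{}_{\bar\beta}\,\eta\wedge\theta^{\bar\beta}$; $A$ is the torsion. Let $R_\alpha{}^\beta{}_{\gamma\bar\delta}$ be the coefficient of $\theta^\gamma\wedge\theta^{\bar\delta}$ in the curvature form $d\omega_\alpha{}^\beta-\omega_\alpha{}^\gamma\wedge\omega_\gamma{}^\beta$ and $\mathrm{Ric}_{\alpha\bar\beta}=R_\gamma{}^\gamma{}_{\alpha\bar\beta}$. $(S,T^{1,0}S,\eta)$ is Sasakian if $A=0$; it is Sasakian $\eta$-Einstein with Einstein constant $(n+1)\lambda$ ($\lambda\in\mathbb{R}$) if moreover $\mathrm{Ric}_{\alpha\bar\beta}=(n+1)\lambda\,l_{\alpha\bar\beta}$. **Cone.** $X=C(S)=\mathbb{R}_+\times S$, with coordinate $r$ on $\mathbb{R}_+$, is a complex manifold with complex structure $I(V+a\xi+b\,r\partial_r)=JV+b\xi-a\,r\partial_r$ ($V\in HS$, $a,b\in\mathbb{R}$). $S$ is identified with the real hypersurface $\{r=1\}$. Put $d^c=\frac{\sqrt{-1}}2(\bar\partial-\partial)$. Let $\psi_\lambda(x)=\lambda^{-1}(e^{\lambda x}-1)$ if $\lambda\ne0$, $\psi_0(x)=x$, and $\rho_S=\psi_\lambda(\log r^2)$. A local holomorphic coordinate $z=(z^1,\dots,z^{n+1})$ of $X$ is flat if $\mathcal{J}_z[\rho_S]=1$, where $$\mathcal{J}_z[\phi]=-\det\begin{pmatrix}\phi&\partial\phi/\partial z^a\\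 \partial\phi/\partial\bar z^b&\partial^2\phi/\partial z^a\partial\bar z^b\end{pmatrix};$$ flat coordinates exist near every point. **Densities and ambient metric.** $\mathcal{X}$ is the total space of the canonical bundle $K_X$ minus its zero section and $\mathcal{S}$ its restriction over $S$. For a coordinate $z$, $\zeta$ is the fiber coordinate given by $\zeta\,dz^1\wedge\dots\wedge dz^{n+1}$, and a branched fiber coordinate is a local branch $z^0=\zeta^{1/(n+2)}$; $Z_0=z^0\partial_{z^0}$. $\mathscr{E}(w)$ is the sheaf of smooth functions $\boldsymbol f$ on $\mathcal{S}$ with $Z_0$- and $\overline{Z_0}$-homogeneity $w$ (locally $|z^0|^{2w}$ times a function on $S$). $\boldsymbol h_S=|z^0|^{2(n+2)}$, with $z^0$ associated with any flat coordinate, is a well-defined positive function on $\mathcal{X}$ and gives a flat Hermitian metric of $K_X$; $\boldsymbol\rho_S=\rho_S\boldsymbol h_S^{1/(n+2)}$. The ambient metric is the Lorentz-Kähler metric $\boldsymbol g_{A\bar B}=\partial_A\partial_{\bar B}\boldsymbol\rho_S$ on $\mathcal{X}$, and $\boldsymbol\Delta=-\boldsymbol g^{A\bar B}\boldsymbol\nabla_A\boldsymbol\nabla_{\bar B}$ is its $\bar\partial$-Laplacian. **$Q$-prime curvature.** The contact form $\eta$ is pseudo-Einstein, with associated defining function $\rho_S$ (satisfying $d^c\rho_S|_S=\eta$) and flat Hermitian metric $\boldsymbol h_S=(\boldsymbol\rho_S/\rho_S)^{n+2}$. Its $Q$-prime curvature is $$\boldsymbol Q'_\eta=(n+2)^{-2}\bigl[\boldsymbol\Delta^{n+1}(\log\boldsymbol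 h_S)^2\bigr]\big|_{\mathcal{S}}\in\mathscr{E}(-n-1),$$ and $Q'_\eta=\boldsymbol Q'_\eta\cdot\boldsymbol h_S^{(n+1)/(n+2)}\in C^\infty(S)$. *)

theory Defs
  imports "HOL-Analysis.Analysis"
begin

section \<open>Smooth functions, tangent vectors and forms on a manifold\<close>

primrec C_k_on :: "nat \<Rightarrow> 'e::euclidean_space set \<Rightarrow> ('e \<Rightarrow> 'b::real_normed_vector) \<Rightarrow> bool" where
  "C_k_on 0 W f \<longleftrightarrow> continuous_on W f"
| "C_k_on (Suc k) W f \<longleftrightarrow> (\<forall>x\<in>W. f differentiable (at x)) \<and>
     (\<forall>v. C_k_on k W (\<lambda>x. frechet_derivative f (at x) v))"

definition smooth_on :: "'e::euclidean_space set \<Rightarrow> ('e \<Rightarrow> 'b::real_normed_vector) \<Rightarrow> bool" where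
  "smooth_on W f \<longleftrightarrow> (\<forall>k. C_k_on k W f)"

text \<open>A chart is a pair of a domain and a map that is meaningful on this domain only.\<close>

type_synonym ('s, 'e) chart = "'s set \<times> ('s \<Rightarrow> 'e)"

definition smooth_atlas :: "('s::topological_space, 'e::euclidean_space) chart set \<Rightarrow> bool" where
  "smooth_atlas A \<longleftrightarrow>
     (\<forall>(D, c)\<in>A. open D \<and> open (c ` D) \<and> homeomorphism D (c ` D) c (inv_into D c)) \<and>
     (\<Union>(D, c)\<in>A. D) = UNIV \<and>
     (\<forall>(D, c)\<in>A. \<forall>(D', c')\<in>A. smooth_on (c ` (D \<inter> D')) (c' \<circ> inv_into D c))"

definition mfd_smooth_on ::
  "('s::topological_space, 'e::euclidean_space) chart set \<Rightarrow> 's set \<Rightarrow> ('s \<Rightarrow> 'b::real_normed_vector) \<Rightarrow> bool" where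
  "mfd_smooth_on A W f \<longleftrightarrow> (\<forall>(D, c)\<in>A. smooth_on (c ` (D \<inter> W)) (f \<circ> inv_into D c))"

definition smooth_near ::
  "('s::topological_space, 'e::euclidean_space) chart set \<Rightarrow> 's \<Rightarrow> ('s \<Rightarrow> 'b::real_normed_vector) \<Rightarrow> bool" where
  "smooth_near A p f \<longleftrightarrow> (\<exists>W. open W \<and> p \<in> W \<and> mfd_smooth_on A W f)"

text \<open>Complex tangent vectors are derivations on germs of smooth complex functions: in a chart they
  are the combinations \<open>\<partial>\<^sub>u + \<i> \<partial>\<^sub>v\<close> of directional derivatives. As every function on the manifold is
  an admissible argument, they are given the value 0 at functions that are not smooth near the point;
  this makes the derivation independent of the chart.\<close>

type_synonym 's tvec = "('s \<Rightarrow> complex) \<Rightarrow> complex"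

definition complex_tangent ::
  "('s::topological_space, 'e::euclidean_space) chart set \<Rightarrow> 's \<Rightarrow> 's tvec set" where
  "complex_tangent A p =
     {X. \<exists>(D, c)\<in>A. p \<in> D \<and> (\<exists>u v. X = (\<lambda>f. if smooth_near A p f
          then frechet_derivative (f \<circ> inv_into D c) (at (c p)) u
               + \<i> * frechet_derivative (f \<circ> inv_into D c) (at (c p)) v
          else 0))}"

definition tadd :: "'s tvec \<Rightarrow> 's tvec \<Rightarrow> 's tvec" where
  "tadd X Y = (\<lambda>f. X f + Y f)"

definition tscale :: "complex \<Rightarrow> 's tvec \<Rightarrow> 's tvec" where
  "tscale a X = (\<lambda>f. a * X f)"

definition tcnj :: "'s tvec \<Rightarrow> 's tvec" where
  "tcnj X = (\<lambda>f. cnj (X (\<lambda>q. cnj (f q))))"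

definition real_tangent ::
  "('s::topological_space, 'e::euclidean_space) chart set \<Rightarrow> 's \<Rightarrow> 's tvec set" where
  "real_tangent A p = {X \<in> complex_tangent A p. tcnj X = X}"

type_synonym 's vfield = "'s \<Rightarrow> 's tvec"
type_synonym 's form1 = "'s \<Rightarrow> 's tvec \<Rightarrow> complex"

definition smooth_field ::
  "('s::topological_space, 'e::euclidean_space) chart set \<Rightarrow> 's set \<Rightarrow> 's vfield \<Rightarrow> bool" where
  "smooth_field A W V \<longleftrightarrow> (\<forall>p\<in>W. V p \<in> complex_tangent A p) \<and>
     (\<forall>U f. open U \<and> U \<subseteq> W \<and> mfd_smooth_on A U f \<longrightarrow> mfd_smooth_on A U (\<lambda>p. V p f))"

definition cnj_field :: "'s vfield \<Rightarrow> 's vfield" where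
  "cnj_field V = (\<lambda>p. tcnj (V p))"

definition bracket ::
  "('s::topological_space, 'e::euclidean_space) chart set \<Rightarrow> 's vfield \<Rightarrow> 's vfield \<Rightarrow> 's vfield" where
  "bracket A V V' = (\<lambda>p f. if smooth_near A p f
      then V p (\<lambda>q. V' q f) - V' p (\<lambda>q. V q f) else 0)"

definition smooth_form ::
  "('s::topological_space, 'e::euclidean_space) chart set \<Rightarrow> 's set \<Rightarrow> 's form1 \<Rightarrow> bool" where
  "smooth_form A W \<alpha> \<longleftrightarrow>
     (\<forall>p\<in>W. \<forall>X\<in>complex_tangent A p. \<forall>Y\<in>complex_tangent A p. \<forall>a.
        \<alpha> p (tadd X Y) = \<alpha> p X + \<alpha> p Y \<and> \<alpha> p (tscale a X) = a * \<alpha> p X) \<and>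
     (\<forall>U V. open U \<and> U \<subseteq> W \<and> smooth_field A U V \<longrightarrow> mfd_smooth_on A U (\<lambda>p. \<alpha> p (V p)))"

definition cnj_form :: "'s form1 \<Rightarrow> 's form1" where
  "cnj_form \<alpha> = (\<lambda>p X. cnj (\<alpha> p (tcnj X)))"

text \<open>Two-forms are evaluated on pairs of vector fields, normalized by
  \<open>(\<alpha> \<and> \<beta>)(V, V') = \<alpha>(V) \<beta>(V') - \<alpha>(V') \<beta>(V)\<close> and, accordingly, \<open>d\<close> without a factor 1/2.\<close>

definition ext_d ::
  "('s::topological_space, 'e::euclidean_space) chart set \<Rightarrow> 's form1 \<Rightarrow> 's vfield \<Rightarrow> 's vfield \<Rightarrow> 's \<Rightarrow> complex" where
  "ext_d A \<alpha> V V' p =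
     V p (\<lambda>q. \<alpha> q (V' q)) - V' p (\<lambda>q. \<alpha> q (V q)) - \<alpha> p (bracket A V V' p)"

definition wedge :: "'s form1 \<Rightarrow> 's form1 \<Rightarrow> 's vfield \<Rightarrow> 's vfield \<Rightarrow> 's \<Rightarrow> complex" where
  "wedge \<alpha> \<beta> V V' p = \<alpha> p (V p) * \<beta> p (V' p) - \<alpha> p (V' p) * \<beta> p (V p)"


section \<open>CR manifolds with a contact form, Tanaka-Webster connection\<close>

text \<open>The model space \<open>real \<times> complex^'n\<close> has real dimension \<open>2n + 1\<close> with \<open>n = CARD('n) \<ge> 1\<close>, and
  \<open>'n\<close> indexes the frames of \<open>T\<^sup>1\<^sup>,\<^sup>0S\<close>. The Reeb field is determined by the other components
  through \<open>reeb_field\<close> below.\<close>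

record ('s, 'n::finite) contact_data =
  charts :: "('s, real \<times> (complex^'n)) chart set"
  T10 :: "'s \<Rightarrow> 's tvec set"
  eta :: "'s form1"
  reeb :: "'s vfield"

definition local_frame ::
  "('s::topological_space, 'n::finite) contact_data \<Rightarrow> 's set \<Rightarrow> ('n \<Rightarrow> 's vfield) \<Rightarrow> bool" where
  "local_frame S W Z \<longleftrightarrow> open W \<and> (\<forall>\<alpha>. smooth_field (charts S) W (Z \<alpha>)) \<and>
     (\<forall>p\<in>W. bij_betw (\<lambda>a :: complex^'n. (\<lambda>f. \<Sum>\<alpha>\<in>UNIV. a $ \<alpha> * Z \<alpha> p f)) UNIV (T10 S p))"

definition cr_structure :: "('s::topological_space, 'n::finite) contact_data \<Rightarrow> bool" where
  "cr_structure S \<longleftrightarrow>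
     (\<forall>p. \<exists>W Z. p \<in> W \<and> local_frame S W Z) \<and>
     (\<forall>p. T10 S p \<inter> tcnj ` T10 S p = {\<lambda>f. 0}) \<and>
     (\<forall>W V V'. open W \<and> smooth_field (charts S) W V \<and> smooth_field (charts S) W V' \<and>
        (\<forall>p\<in>W. V p \<in> T10 S p \<and> V' p \<in> T10 S p) \<longrightarrow>
        (\<forall>p\<in>W. bracket (charts S) V V' p \<in> T10 S p))"

definition levi ::
  "('s::topological_space, 'n::finite) contact_data \<Rightarrow> 's vfield \<Rightarrow> 's vfield \<Rightarrow> 's \<Rightarrow> complex" where
  "levi S Z W p = - \<i> * ext_d (charts S) (eta S) Z (cnj_field W) p"

text \<open>\<open>eta\<close> is the complex linear extension of a real one-form. Positive definiteness is
  expressed with local sections \<open>Z\<close> of \<open>T\<^sup>1\<^sup>,\<^sup>0S\<close>, as \<open>ext_d\<close> acts on vector fields.\<close>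

definition contact_form :: "('s::topological_space, 'n::finite) contact_data \<Rightarrow> bool" where
  "contact_form S \<longleftrightarrow>
     smooth_form (charts S) UNIV (eta S) \<and>
     (\<forall>p. \<forall>X\<in>complex_tangent (charts S) p. eta S p (tcnj X) = cnj (eta S p X)) \<and>
     (\<forall>p. \<exists>X\<in>complex_tangent (charts S) p. eta S p X \<noteq> 0) \<and>
     (\<forall>p. \<forall>Z\<in>T10 S p. eta S p (tadd Z (tcnj Z)) = 0) \<and>
     (\<forall>W Z. open W \<and> smooth_field (charts S) W Z \<and> (\<forall>p\<in>W. Z p \<in> T10 S p) \<longrightarrow>
        (\<forall>p\<in>W. Z p \<noteq> (\<lambda>f. 0) \<longrightarrow> (\<exists>t>0. levi S Z Z p = complex_of_real t)))"

definition reeb_field :: "('s::topological_space, 'n::finite) contact_data \<Rightarrow> bool" where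
  "reeb_field S \<longleftrightarrow>
     smooth_field (charts S) UNIV (reeb S) \<and> (\<forall>p. tcnj (reeb S p) = reeb S p) \<and>
     (\<forall>p. eta S p (reeb S p) = 1) \<and>
     (\<forall>W V. open W \<and> smooth_field (charts S) W V \<longrightarrow>
        (\<forall>p\<in>W. ext_d (charts S) (eta S) (reeb S) V p = 0))"

text \<open>\<open>\<theta> \<alpha>\<close>, \<open>\<omega> \<alpha> \<beta>\<close> and \<open>T \<alpha> \<beta>\<close> are \<open>\<theta>\<^sup>\<alpha>\<close>, the connection form with lower index
  \<open>\<alpha>\<close> and upper index \<open>\<beta>\<close>, and the torsion with upper index \<open>\<alpha>\<close> and lower index \<open>\<beta>\<close> barred.
  Lowering the upper index with \<open>l\<close>, the first equation is
  \<open>dl\<^sub>\<alpha>\<^sub>\<beta> = \<omega>\<^sub>\<alpha>\<^sup>\<gamma> l\<^sub>\<gamma>\<^sub>\<beta> + cnj (\<omega>\<^sub>\<beta>\<^sup>\<gamma>) l\<^sub>\<alpha>\<^sub>\<gamma>\<close>, the second index of \<open>l\<close> being the barred one.\<close>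

definition tanaka_webster ::
  "('s::topological_space, 'n::finite) contact_data \<Rightarrow> 's set \<Rightarrow> ('n \<Rightarrow> 's vfield) \<Rightarrow> ('n \<Rightarrow> 's form1) \<Rightarrow>
    ('n \<Rightarrow> 'n \<Rightarrow> 's form1) \<Rightarrow> ('n \<Rightarrow> 'n \<Rightarrow> 's \<Rightarrow> complex) \<Rightarrow> bool" where
  "tanaka_webster S W Z \<theta> \<omega> T \<longleftrightarrow>
     (\<forall>\<alpha>. smooth_form (charts S) W (\<theta> \<alpha>)) \<and>
     (\<forall>p\<in>W. \<forall>\<alpha>. \<theta> \<alpha> p (reeb S p) = 0 \<and>
        (\<forall>\<beta>. \<theta> \<alpha> p (Z \<beta> p) = (if \<alpha> = \<beta> then 1 else 0) \<and> \<theta> \<alpha> p (tcnj (Z \<beta> p)) = 0)) \<and>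
     (\<forall>\<alpha> \<beta>. smooth_form (charts S) W (\<omega> \<alpha> \<beta>) \<and> mfd_smooth_on (charts S) W (T \<alpha> \<beta>)) \<and>
     (\<forall>U V V'. open U \<and> U \<subseteq> W \<and> smooth_field (charts S) U V \<and> smooth_field (charts S) U V' \<longrightarrow>
        (\<forall>p\<in>U.
          (\<forall>\<alpha> \<beta>. V p (\<lambda>q. levi S (Z \<alpha>) (Z \<beta>) q) =
             (\<Sum>\<gamma>\<in>UNIV. \<omega> \<alpha> \<gamma> p (V p) * levi S (Z \<gamma>) (Z \<beta>) p) +
             (\<Sum>\<gamma>\<in>UNIV. cnj_form (\<omega> \<beta> \<gamma>) p (V p) * levi S (Z \<alpha>) (Z \<gamma>) p)) \<and>
          (\<forall>\<alpha>. ext_d (charts S) (\<theta> \<alpha>) V V' p =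
             (\<Sum>\<beta>\<in>UNIV. wedge (\<theta> \<beta>) (\<omega> \<beta> \<alpha>) V V' p) +
             (\<Sum>\<beta>\<in>UNIV. T \<alpha> \<beta> p * wedge (eta S) (cnj_form (\<theta> \<beta>)) V V' p))))"

text \<open>The coefficient of \<open>\<theta>\<^sup>\<gamma> \<and> cnj \<theta>\<^sup>\<delta>\<close> in a two-form is its value on \<open>Z\<^sub>\<gamma>\<close> and \<open>cnj Z\<^sub>\<delta>\<close>.\<close>

definition tw_curvature ::
  "('s::topological_space, 'n::finite) contact_data \<Rightarrow> ('n \<Rightarrow> 's vfield) \<Rightarrow> ('n \<Rightarrow> 'n \<Rightarrow> 's form1) \<Rightarrow>
    'n \<Rightarrow> 'n \<Rightarrow> 'n \<Rightarrow> 'n \<Rightarrow> 's \<Rightarrow> complex" where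
  "tw_curvature S Z \<omega> \<alpha> \<beta> \<gamma> \<delta> p =
     ext_d (charts S) (\<omega> \<alpha> \<beta>) (Z \<gamma>) (cnj_field (Z \<delta>)) p -
     (\<Sum>\<epsilon>\<in>UNIV. wedge (\<omega> \<alpha> \<epsilon>) (\<omega> \<epsilon> \<beta>) (Z \<gamma>) (cnj_field (Z \<delta>)) p)"

definition tw_ricci ::
  "('s::topological_space, 'n::finite) contact_data \<Rightarrow> ('n \<Rightarrow> 's vfield) \<Rightarrow> ('n \<Rightarrow> 'n \<Rightarrow> 's form1) \<Rightarrow>
    'n \<Rightarrow> 'n \<Rightarrow> 's \<Rightarrow> complex" where
  "tw_ricci S Z \<omega> \<alpha> \<beta> p = (\<Sum>\<gamma>\<in>UNIV. tw_curvature S Z \<omega> \<gamma> \<gamma> \<alpha> \<beta> p)"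

definition contact_manifold :: "('s::topological_space, 'n::finite) contact_data \<Rightarrow> bool" where
  "contact_manifold S \<longleftrightarrow>
     smooth_atlas (charts S) \<and> cr_structure S \<and> contact_form S \<and> reeb_field S"

text \<open>The data \<open>\<theta>, \<omega>, T\<close> exist uniquely (on \<open>W\<close>) for every local frame, so it does not matter that
  they are quantified existentially in the next two definitions.\<close>

definition sasakian :: "('s::topological_space, 'n::finite) contact_data \<Rightarrow> bool" where
  "sasakian S \<longleftrightarrow> contact_manifold S \<and>
     (\<forall>W Z. local_frame S W Z \<longrightarrow>
        (\<exists>\<theta> \<omega> T. tanaka_webster S W Z \<theta> \<omega> T \<and> (\<forall>p\<in>W. \<forall>\<alpha> \<beta>. T \<alpha> \<beta> p = 0)))"

definition sasakian_eta_einstein :: "('s::topological_space, 'n::finite) contact_data \<Rightarrow> real \<Rightarrow> bool" where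
  "sasakian_eta_einstein S lam \<longleftrightarrow> sasakian S \<and>
     (\<forall>W Z. local_frame S W Z \<longrightarrow>
        (\<exists>\<theta> \<omega> T. tanaka_webster S W Z \<theta> \<omega> T \<and>
          (\<forall>p\<in>W. \<forall>\<alpha> \<beta>. tw_ricci S Z \<omega> \<alpha> \<beta> p =
             of_real (real (CARD('n) + 1) * lam) * levi S (Z \<alpha>) (Z \<beta>) p)))"


section \<open>The cone and its flat coordinates\<close>

definition HS_J :: "('s::topological_space, 'n::finite) contact_data \<Rightarrow> 's \<Rightarrow> 's tvec \<Rightarrow> 's tvec" where
  "HS_J S p V = (THE Y. \<exists>Z\<in>T10 S p. V = tadd Z (tcnj Z) \<and> Y = tadd (tscale \<i> Z) (tcnj (tscale \<i> Z)))"

text \<open>The cone is \<open>{0<..} \<times> UNIV\<close>; its tangent vector \<open>b r\<partial>\<^sub>r + v\<close> at \<open>(r, p)\<close>, with \<open>v\<close> a real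
  tangent vector of \<open>S\<close>, is the pair \<open>(b, v)\<close>, and \<open>cone_deriv\<close> applies it to a function.\<close>

definition cone :: "(real \<times> 's) set" where
  "cone = {0<..} \<times> UNIV"

definition cone_charts ::
  "('s, 'n::finite) contact_data \<Rightarrow> (real \<times> 's, real \<times> (real \<times> (complex^'n))) chart set" where
  "cone_charts S = (\<lambda>(D, c). ({0<..} \<times> D, \<lambda>(r, p). (r, c p))) ` charts S"

definition cone_tangent ::
  "('s::topological_space, 'n::finite) contact_data \<Rightarrow> real \<times> 's \<Rightarrow> (real \<times> 's tvec) set" where
  "cone_tangent S x = UNIV \<times> real_tangent (charts S) (snd x)"

definition cone_deriv :: "real \<times> 's \<Rightarrow> real \<times> 's tvec \<Rightarrow> (real \<times> 's \<Rightarrow> complex) \<Rightarrow> complex" where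
  "cone_deriv x v f =
     of_real (fst v * fst x) * vector_derivative (\<lambda>t. f (t, snd x)) (at (fst x)) +
     snd v (\<lambda>q. f (fst x, q))"

text \<open>With \<open>a = \<eta>(v)\<close>, the component of \<open>v\<close> in \<open>HS\<close> is \<open>v - a\<xi>\<close>.\<close>

definition cone_I ::
  "('s::topological_space, 'n::finite) contact_data \<Rightarrow> real \<times> 's \<Rightarrow> real \<times> 's tvec \<Rightarrow> real \<times> 's tvec" where
  "cone_I S x = (\<lambda>(b, v). let p = snd x; a = eta S p v in
     (- Re a,
      tadd (HS_J S p (tadd v (tscale (- a) (reeb S p)))) (tscale (of_real b) (reeb S p))))"

text \<open>Holomorphic coordinates of the cone; there are \<open>CARD('n option) = n + 1\<close> of them.\<close>

definition holo_coord ::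
  "('s::topological_space, 'n::finite) contact_data \<Rightarrow> (real \<times> 's) set \<Rightarrow>
    (real \<times> 's \<Rightarrow> complex^('n option)) \<Rightarrow> bool" where
  "holo_coord S U z \<longleftrightarrow>
     open U \<and> U \<subseteq> cone \<and> inj_on z U \<and> open (z ` U) \<and>
     mfd_smooth_on (cone_charts S) U z \<and>
     (\<forall>(D, c)\<in>cone_charts S. smooth_on (z ` (U \<inter> D)) (c \<circ> inv_into U z)) \<and>
     (\<forall>x\<in>U. \<forall>v\<in>cone_tangent S x. \<forall>a.
        cone_deriv x (cone_I S x v) (\<lambda>y. z y $ a) = \<i> * cone_deriv x v (\<lambda>y. z y $ a))"

definition wirt :: "'m::finite \<Rightarrow> (complex^'m \<Rightarrow> complex) \<Rightarrow> complex^'m \<Rightarrow> complex" where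
  "wirt a F w = (frechet_derivative F (at w) (axis a 1) - \<i> * frechet_derivative F (at w) (axis a \<i>)) / 2"

definition wirt_bar :: "'m::finite \<Rightarrow> (complex^'m \<Rightarrow> complex) \<Rightarrow> complex^'m \<Rightarrow> complex" where
  "wirt_bar a F w = (frechet_derivative F (at w) (axis a 1) + \<i> * frechet_derivative F (at w) (axis a \<i>)) / 2"

definition psi :: "real \<Rightarrow> real \<Rightarrow> real" where
  "psi lam x = (if lam = 0 then x else (exp (lam * x) - 1) / lam)"

definition rho_S :: "real \<Rightarrow> real \<times> 's \<Rightarrow> real" where
  "rho_S lam x = psi lam (ln ((fst x)\<^sup>2))"

text \<open>The operator \<open>\<J>\<^sub>z\<close>; row \<open>B\<close>, column \<open>A\<close>, the index \<open>None\<close> being the one without derivative.\<close>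

definition J_op ::
  "(real \<times> 's) set \<Rightarrow> (real \<times> 's \<Rightarrow> complex^('n::finite option)) \<Rightarrow> (real \<times> 's \<Rightarrow> real) \<Rightarrow> real \<times> 's \<Rightarrow> complex" where
  "J_op U z \<phi> x = (let F = (\<lambda>w. complex_of_real (\<phi> (inv_into U z w))); w = z x in
     - det (\<chi> B A. case B of
         None \<Rightarrow> (case A of None \<Rightarrow> F w | Some a \<Rightarrow> wirt a F w)
       | Some b \<Rightarrow> (case A of None \<Rightarrow> wirt_bar b F w | Some a \<Rightarrow> wirt a (wirt_bar b F) w)))"

definition flat_coord ::
  "('s::topological_space, 'n::finite) contact_data \<Rightarrow> real \<Rightarrow> (real \<times> 's) set \<Rightarrow>
    (real \<times> 's \<Rightarrow> complex^('n option)) \<Rightarrow> bool" where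
  "flat_coord S lam U z \<longleftrightarrow> holo_coord S U z \<and> (\<forall>x\<in>U. J_op U z (rho_S lam) x = 1)"


section \<open>The canonical bundle, the ambient metric and the Q-prime curvature\<close>

text \<open>\<open>vol_form\<close> is \<open>dz\<^sup>1 \<and> \<dots> \<and> dz\<^sup>n\<^sup>+\<^sup>1\<close> at \<open>x\<close>, as a function of \<open>n + 1\<close> tangent vectors of the cone
  (with value 0 outside the tangent space).\<close>

type_synonym ('s, 'n) canonical_elem = "(real \<times> 's) \<times> (('n option \<Rightarrow> real \<times> 's tvec) \<Rightarrow> complex)"

definition vol_form ::
  "('s::topological_space, 'n::finite) contact_data \<Rightarrow> (real \<times> 's \<Rightarrow> complex^('n option)) \<Rightarrow> real \<times> 's \<Rightarrow>
    ('n option \<Rightarrow> real \<times> 's tvec) \<Rightarrow> complex" where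
  "vol_form S z x v = (if \<forall>b. v b \<in> cone_tangent S x
     then det (\<chi> b a. cone_deriv x (v b) (\<lambda>y. z y $ a)) else 0)"

text \<open>\<open>\<X>\<close>, the canonical bundle of the cone minus its zero section.\<close>

definition canonical_bundle ::
  "('s::topological_space, 'n::finite) contact_data \<Rightarrow> ('s, 'n) canonical_elem set" where
  "canonical_bundle S = {(x, \<kappa>). \<exists>U z \<zeta>. holo_coord S U z \<and> x \<in> U \<and> \<zeta> \<noteq> 0 \<and>
     \<kappa> = (\<lambda>v. \<zeta> * vol_form S z x v)}"

definition fiber_coord ::
  "('s::topological_space, 'n::finite) contact_data \<Rightarrow> (real \<times> 's \<Rightarrow> complex^('n option)) \<Rightarrow>
    ('s, 'n) canonical_elem \<Rightarrow> complex" where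
  "fiber_coord S z k = (THE \<zeta>. snd k = (\<lambda>v. \<zeta> * vol_form S z (fst k) v))"

definition h_S ::
  "('s::topological_space, 'n::finite) contact_data \<Rightarrow> real \<Rightarrow> ('s, 'n) canonical_elem \<Rightarrow> real" where
  "h_S S lam k = (THE t. \<exists>U z z0. flat_coord S lam U z \<and> fst k \<in> U \<and>
     z0 ^ (CARD('n) + 2) = fiber_coord S z k \<and> t = cmod z0 ^ (2 * (CARD('n) + 2)))"

definition bold_rho ::
  "('s::topological_space, 'n::finite) contact_data \<Rightarrow> real \<Rightarrow> ('s, 'n) canonical_elem \<Rightarrow> real" where
  "bold_rho S lam k = rho_S lam (fst k) * h_S S lam k powr (1 / real (CARD('n) + 2))"

text \<open>Coordinates \<open>w = (z\<^sup>0, z\<^sup>1, \<dots>, z\<^sup>n\<^sup>+\<^sup>1)\<close> of \<open>\<X>\<close> induced by \<open>z\<close>; the index \<open>None\<close> is that of \<open>z\<^sup>0\<close>.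
  Instead of a branch \<open>z\<^sup>0 = \<zeta> powr (1/(n+2))\<close> we use the map from coordinates to points: its
  local inverses are exactly the coordinate systems obtained from the branches.\<close>

definition ambient_dom ::
  "(real \<times> 's) set \<Rightarrow> (real \<times> 's \<Rightarrow> complex^('n::finite option)) \<Rightarrow> (complex^('n option option)) set" where
  "ambient_dom U z = {w. w $ None \<noteq> 0 \<and> (\<chi> a. w $ Some a) \<in> z ` U}"

definition ambient_point ::
  "('s::topological_space, 'n::finite) contact_data \<Rightarrow> (real \<times> 's) set \<Rightarrow>
    (real \<times> 's \<Rightarrow> complex^('n option)) \<Rightarrow> complex^('n option option) \<Rightarrow> ('s, 'n) canonical_elem" where
  "ambient_point S U z w = (let x = inv_into U z (\<chi> a. w $ Some a) in
     (x, \<lambda>v. (w $ None) ^ (CARD('n) + 2) * vol_form S z x v))"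

definition ambient_metric ::
  "('s::topological_space, 'n::finite) contact_data \<Rightarrow> real \<Rightarrow> (real \<times> 's) set \<Rightarrow>
    (real \<times> 's \<Rightarrow> complex^('n option)) \<Rightarrow> complex^('n option option) \<Rightarrow>
    complex^('n option option)^('n option option)" where
  "ambient_metric S lam U z w =
     (\<chi> A B. wirt A (wirt_bar B (\<lambda>w. complex_of_real (bold_rho S lam (ambient_point S U z w)))) w)"

text \<open>On functions \<open>\<nabla>\<^sub>A \<nabla>\<^sub>B\<close> with \<open>B\<close> barred is \<open>\<partial>\<^sub>A \<partial>\<^sub>B\<close>, the mixed Christoffel symbols of a Kaehler
  metric being 0. The inverse metric satisfies \<open>g\<^sup>A\<^sup>B g\<^sub>C\<^sub>B = \<delta>\<^sup>A\<^sub>C\<close> (\<open>B\<close> barred), whence the transposition.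
  The value does not depend on the holomorphic coordinates.\<close>

definition ambient_laplacian ::
  "('s::topological_space, 'n::finite) contact_data \<Rightarrow> real \<Rightarrow>
    (('s, 'n) canonical_elem \<Rightarrow> complex) \<Rightarrow> ('s, 'n) canonical_elem \<Rightarrow> complex" where
  "ambient_laplacian S lam F k = (THE t. \<exists>U z w. holo_coord S U z \<and> w \<in> ambient_dom U z \<and>
     ambient_point S U z w = k \<and>
     t = - (\<Sum>A\<in>UNIV. \<Sum>B\<in>UNIV. matrix_inv (ambient_metric S lam U z w) $ B $ A *
              wirt A (wirt_bar B (\<lambda>w. F (ambient_point S U z w))) w))"

definition bold_Q_prime ::
  "('s::topological_space, 'n::finite) contact_data \<Rightarrow> real \<Rightarrow> ('s, 'n) canonical_elem \<Rightarrow> complex" where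
  "bold_Q_prime S lam k =
     ((ambient_laplacian S lam ^^ (CARD('n) + 1)) (\<lambda>k. complex_of_real ((ln (h_S S lam k))\<^sup>2))) k
       / of_nat ((CARD('n) + 2)\<^sup>2)"

text \<open>The product below is homogeneous of degree 0, so it depends only on the base point;
  \<open>S\<close> is identified with \<open>{1} \<times> UNIV\<close>.\<close>

definition Q_prime :: "('s::topological_space, 'n::finite) contact_data \<Rightarrow> real \<Rightarrow> 's \<Rightarrow> complex" where
  "Q_prime S lam p = (THE q. \<exists>k\<in>canonical_bundle S. fst k = (1, p) \<and>
     q = bold_Q_prime S lam k *
         of_real (h_S S lam k powr (real (CARD('n) + 1) / real (CARD('n) + 2))))"

end

theory Submission
  imports Defs
begin

text \<open>
  In flat coordinates the ambient potential is \<open>\<bar>z\<^sup>0\<bar>\<^sup>2 \<rho>\<close> with \<open>\<rho> = \<psi>(log r\<^sup>2)\<close>, and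
  \<open>log h / (n + 2) = log \<bar>z\<^sup>0\<bar>\<^sup>2\<close> is pluriharmonic and depends on the fibre only. Hence the Laplacian of
  a function \<open>\<chi>\<close> of \<open>\<theta> = log \<bar>z\<^sup>0\<bar>\<^sup>2\<close> sees only one entry of the inverse metric,
  \<open>\<Delta> \<chi>(\<theta>) = - g\<^sup>0\<^sup>0 \<chi>''(\<theta>) / \<bar>z\<^sup>0\<bar>\<^sup>2\<close>. The whole computation rests on the fact that this entry is
  the constant \<open>- \<lambda>\<close>: then \<open>\<Delta> \<chi>(\<theta>) = \<lambda> e\<^bsup>-\<theta>\<^esup> \<chi>''(\<theta>)\<close>, so \<open>\<theta>\<^sup>2\<close> is mapped to \<open>2 \<lambda> e\<^bsup>-\<theta>\<^esup>\<close> and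
  \<open>e\<^bsup>-k\<theta>\<^esup>\<close> to \<open>\<lambda> k\<^sup>2 e\<^bsup>-(k+1)\<theta>\<^esup>\<close>, and \<open>n + 1\<close> steps produce \<open>2 \<lambda>\<^bsup>n+1\<^esup> (n!)\<^sup>2 e\<^bsup>-(n+1)\<theta>\<^esup>\<close>
  (\<open>iterated_laplacian\<close>).

  The constant is found without computing a determinant. The complex structure of the cone does not
  depend on \<open>r\<close>, so \<open>r\<partial>\<^sub>r\<close> is the real part of a holomorphic vector field: the functions
  \<open>Y\<^sup>a = r\<partial>\<^sub>r z\<^sup>a\<close> are holomorphic (\<open>radial_holo_on\<close>), by symmetry of second derivatives. As \<open>\<rho>\<close> is a
  function of \<open>r\<close> with \<open>\<psi>' = 1 + \<lambda> \<psi>\<close>, it satisfies \<open>Y\<^sup>a \<rho>\<^sub>a = 1 + \<lambda> \<rho>\<close> (\<open>radial_rho\<close>). Differentiating the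
  conjugate of this identity shows that the vector \<open>(- \<lambda>, cnj Y)\<close> is the first row of the inverse of
  the bordered matrix of \<open>\<rho>\<close> (\<open>bordered_radial\<close>), which is congruent to the ambient metric up to a
  conformal factor (\<open>levi_form_cone_potential\<close>); this determines the entry (\<open>hat_metric_inverse\<close>). Flatness of the coordinates says that the bordered
  determinant is \<open>- 1\<close>; this is the form in which the Einstein condition enters the computation. It
  makes the metric nondegenerate, and makes \<open>h\<close> independent of the flat coordinates
  (\<open>h_S_bundle_point\<close>).

  The Laplacian is defined through arbitrary holomorphic coordinates, so its value has to be shown to
  be the same in all of them. The fibre coordinate \<open>\<zeta> = (z\<^sup>0)\<^sup>n\<^sup>+\<^sup>2\<close> over one flat coordinate serves as the
  reference: every other coordinate system is related to it by a holomorphic map that needs no choice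
  of a root (\<open>to_hat_holo\<close>), Levi forms transform by congruence under such maps
  (\<open>levi_form_compose\<close>), and the trace of one Levi form with respect to another is a congruence
  invariant (\<open>trace_congruence\<close>).
\<close>

section \<open>Smooth functions between Euclidean spaces\<close>

abbreviation fderiv :: "('a::real_normed_vector \<Rightarrow> 'b::real_normed_vector) \<Rightarrow> 'a \<Rightarrow> 'a \<Rightarrow> 'b" where
  "fderiv f x \<equiv> frechet_derivative f (at x)"

lemma C_k_on_cong:
  assumes "open W" "\<And>x. x \<in> W \<Longrightarrow> f x = g x"
  shows "C_k_on k W f \<longleftrightarrow> C_k_on k W g"
  using assms(2)
proof (induction k arbitrary: f g)
  case 0
  then show ?case by (simp cong: continuous_on_cong)
next
  case (Suc k)
  have ev: "(f has_derivative D) (at x) \<longleftrightarrow> (g has_derivative D) (at x)" if "x \<in> W" for x D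
    using has_derivative_transform_within_open[OF _ assms(1) that] Suc.prems by metis
  then have fd: "fderiv f x = fderiv g x" if "x \<in> W" for x
    using that by (simp add: frechet_derivative_def)
  have "f differentiable (at x) \<longleftrightarrow> g differentiable (at x)" if "x \<in> W" for x
    using ev[OF that] by (simp add: differentiable_def)
  moreover have "C_k_on k W (\<lambda>x. fderiv f x v) = C_k_on k W (\<lambda>x. fderiv g x v)" for v
    by (rule Suc.IH) (simp add: fd)
  ultimately show ?case by simp
qed

lemma C_k_on_subset:
  assumes "C_k_on k W f" "V \<subseteq> W"
  shows "C_k_on k V f"
  using assms(1)
proof (induction k arbitrary: f)
  case 0
  then show ?case using assms(2) continuous_on_subset by auto
next
  case (Suc k)
  then show ?case using assms(2) by auto
qed

lemma C_k_on_Suc_has_derivative: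
  assumes "C_k_on (Suc k) W f" "x \<in> W"
  shows "(f has_derivative fderiv f x) (at x)"
  using assms frechet_derivative_works by auto

text \<open>The recursion behind \<open>C_k_on\<close> mentions \<open>frechet_derivative\<close>; this rule replaces it by any family of
  derivatives. All closure properties below are inductions on \<open>k\<close> that pass from a function to the
  formula for its derivative.\<close>
lemma C_k_on_SucI:
  assumes "open W" "\<And>x. x \<in> W \<Longrightarrow> (f has_derivative f' x) (at x)"
    and "\<And>v. C_k_on k W (\<lambda>x. f' x v)"
  shows "C_k_on (Suc k) W f"
proof -
  have "fderiv f x = f' x" if "x \<in> W" for x
    using frechet_derivative_at[OF assms(2)[OF that]] by simp
  then have "C_k_on k W (\<lambda>x. fderiv f x v)" for v
    using C_k_on_cong[OF assms(1), of "\<lambda>x. fderiv f x v" "\<lambda>x. f' x v"] assms(3) by simp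
  then show ?thesis using assms(2) by (auto simp: differentiable_def)
qed

lemma C_k_on_Suc_imp:
  assumes "C_k_on (Suc k) W f"
  shows "C_k_on k W f"
  using assms
proof (induction k arbitrary: f)
  case 0
  then show ?case
    by (auto intro!: continuous_at_imp_continuous_on differentiable_imp_continuous_within)
next
  case (Suc k)
  then show ?case by (simp del: C_k_on.simps(2) add: C_k_on.simps(2)[of "Suc k"]) (auto)
qed

lemma C_k_on_const: "open W \<Longrightarrow> C_k_on k W (\<lambda>x. c)"
proof (induction k arbitrary: c)
  case (Suc k)
  show ?case by (rule C_k_on_SucI[where f' = "\<lambda>x v. 0"]) (use Suc in auto)
qed simp

lemma C_k_on_add:
  assumes "open W" "C_k_on k W f" "C_k_on k W g"
  shows "C_k_on k W (\<lambda>x. f x + g x)"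
  using assms(2,3)
proof (induction k arbitrary: f g)
  case 0
  then show ?case by (simp add: continuous_on_add)
next
  case (Suc k)
  show ?case
    by (rule C_k_on_SucI[OF assms(1)
          has_derivative_add[OF C_k_on_Suc_has_derivative[OF Suc.prems(1)] C_k_on_Suc_has_derivative[OF Suc.prems(2)]]])
      (use Suc in auto)
qed

lemma C_k_on_sum:
  assumes "open W" "finite I" "\<And>i. i \<in> I \<Longrightarrow> C_k_on k W (f i)"
  shows "C_k_on k W (\<lambda>x. \<Sum>i\<in>I. f i x)"
  using assms(2,3)
  by (induction I rule: finite_induct) (auto intro: C_k_on_const C_k_on_add assms(1))

lemma C_k_on_linear:
  assumes "open W" "bounded_linear L" "C_k_on k W f"
  shows "C_k_on k W (\<lambda>x. L (f x))"
  using assms(3)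
proof (induction k arbitrary: f)
  case 0
  then show ?case using bounded_linear.continuous_on[OF assms(2)] by simp
next
  case (Suc k)
  show ?case
    by (rule C_k_on_SucI[OF assms(1)
          bounded_linear.has_derivative[OF assms(2) C_k_on_Suc_has_derivative[OF Suc.prems(1)]]])
      (use Suc in auto)
qed

lemma C_k_on_bilinear:
  assumes "open W" "bounded_bilinear B" "C_k_on k W f" "C_k_on k W g"
  shows "C_k_on k W (\<lambda>x. B (f x) (g x))"
  using assms(3,4)
proof (induction k arbitrary: f g)
  case 0
  then show ?case using bounded_bilinear.continuous_on[OF assms(2)] by simp
next
  case (Suc k)
  note IH = Suc.IH and le = C_k_on_Suc_imp[OF Suc.prems(1)] C_k_on_Suc_imp[OF Suc.prems(2)]
  show ?case
    by (rule C_k_on_SucI[OF assms(1)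
          bounded_bilinear.FDERIV[OF assms(2) C_k_on_Suc_has_derivative[OF Suc.prems(1)] C_k_on_Suc_has_derivative[OF Suc.prems(2)]]],
        assumption, assumption,
        rule C_k_on_add[OF assms(1)]; rule IH)
      (use Suc.prems le in auto)
qed

text \<open>The chain rule differentiates \<open>g\<close> in a direction that varies with the point, whereas \<open>C_k_on\<close> speaks of
  fixed directions; expanding the direction in a basis reduces to products.\<close>
lemma C_k_on_compose:
  fixes f :: "'a::euclidean_space \<Rightarrow> 'b::euclidean_space" and g :: "'b \<Rightarrow> 'c::real_normed_vector"
  assumes "open W" "open V" "C_k_on k W f" "C_k_on k V g" "f ` W \<subseteq> V"
  shows "C_k_on k W (\<lambda>x. g (f x))"
  using assms(3,4)
proof (induction k arbitrary: g)
  case 0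
  then show ?case using continuous_on_compose2 assms(5) by auto
next
  case (Suc k)
  have der: "((\<lambda>x. g (f x)) has_derivative
      (\<lambda>v. \<Sum>b\<in>Basis. (fderiv f x v \<bullet> b) *\<^sub>R fderiv g (f x) b)) (at x)"
    if "x \<in> W" for x
  proof -
    have dg: "(g has_derivative fderiv g (f x)) (at (f x))"
      using C_k_on_Suc_has_derivative[OF Suc.prems(2)] assms(5) that by blast
    then have l: "linear (fderiv g (f x))"
      by (rule has_derivative_linear)
    have eq: "fderiv g (f x) u = (\<Sum>b\<in>Basis. (u \<bullet> b) *\<^sub>R fderiv g (f x) b)" for u
    proof -
      have "fderiv g (f x) u =
          fderiv g (f x) (\<Sum>b\<in>Basis. (u \<bullet> b) *\<^sub>R b)"
        by (simp add: euclidean_representation)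
      also have "\<dots> = (\<Sum>b\<in>Basis. fderiv g (f x) ((u \<bullet> b) *\<^sub>R b))"
        by (rule linear_sum[OF l])
      finally show ?thesis by (simp add: linear_scale[OF l])
    qed
    have "((\<lambda>x. g (f x)) has_derivative
      (\<lambda>v. fderiv g (f x) (fderiv f x v))) (at x)"
      by (rule has_derivative_compose[OF C_k_on_Suc_has_derivative[OF Suc.prems(1) that] dg])
    then show ?thesis
      by (rule has_derivative_eq_rhs) (rule ext, rule eq)
  qed
  note le = C_k_on_Suc_imp[OF Suc.prems(1)]
  have "C_k_on k W (\<lambda>x. (fderiv f x v \<bullet> b) *\<^sub>R fderiv g (f x) b)" for v b
  proof (rule C_k_on_bilinear[OF assms(1) bounded_bilinear_scaleR])
    show "C_k_on k W (\<lambda>x. fderiv f x v \<bullet> b)"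
      by (rule C_k_on_linear[OF assms(1) bounded_linear_inner_left]) (use Suc.prems in auto)
    show "C_k_on k W (\<lambda>x. fderiv g (f x) b)"
      using Suc.IH[OF le, of "\<lambda>y. fderiv g y b"] Suc.prems(2) by simp
  qed
  then show ?case
    by (intro C_k_on_SucI[OF assms(1) der] C_k_on_sum assms(1)) auto
qed

lemma C_k_on_local:
  assumes "\<And>x. x \<in> W \<Longrightarrow> \<exists>V. open V \<and> x \<in> V \<and> C_k_on k V f"
  shows "C_k_on k W f"
  using assms
proof (induction k arbitrary: f)
  case 0
  have "isCont f x" if "x \<in> W" for x
    using 0[OF that] continuous_on_interior interior_open by fastforce
  then show ?case by (simp add: continuous_at_imp_continuous_on)
next
  case (Suc k)
  have "f differentiable (at x)" if "x \<in> W" for x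
    using Suc.prems[OF that] by auto
  moreover have "C_k_on k W (\<lambda>x. fderiv f x v)" for v
    by (rule Suc.IH) (use Suc.prems in fastforce)
  ultimately show ?case by simp
qed

lemma smooth_on_cong: "open W \<Longrightarrow> (\<And>x. x \<in> W \<Longrightarrow> f x = g x) \<Longrightarrow> smooth_on W f \<longleftrightarrow> smooth_on W g"
  unfolding smooth_on_def using C_k_on_cong by blast

lemma smooth_on_eq: "smooth_on W f \<Longrightarrow> open W \<Longrightarrow> (\<And>x. x \<in> W \<Longrightarrow> f x = g x) \<Longrightarrow> smooth_on W g"
  using smooth_on_cong[of W f g] by simp

lemma smooth_on_subset: "smooth_on W f \<Longrightarrow> V \<subseteq> W \<Longrightarrow> smooth_on V f"
  unfolding smooth_on_def using C_k_on_subset by blast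

lemma smooth_on_const: "open W \<Longrightarrow> smooth_on W (\<lambda>x. c)"
  unfolding smooth_on_def using C_k_on_const by blast

lemma smooth_on_add: "open W \<Longrightarrow> smooth_on W f \<Longrightarrow> smooth_on W g \<Longrightarrow> smooth_on W (\<lambda>x. f x + g x)"
  unfolding smooth_on_def using C_k_on_add by blast

lemma smooth_on_sum: "open W \<Longrightarrow> finite I \<Longrightarrow> (\<And>i. i \<in> I \<Longrightarrow> smooth_on W (f i)) \<Longrightarrow> smooth_on W (\<lambda>x. \<Sum>i\<in>I. f i x)"
  unfolding smooth_on_def using C_k_on_sum by blast

lemma smooth_on_linear: "open W \<Longrightarrow> bounded_linear L \<Longrightarrow> smooth_on W f \<Longrightarrow> smooth_on W (\<lambda>x. L (f x))"
  unfolding smooth_on_def using C_k_on_linear by blast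

lemma smooth_on_bilinear:
  "open W \<Longrightarrow> bounded_bilinear B \<Longrightarrow> smooth_on W f \<Longrightarrow> smooth_on W g \<Longrightarrow> smooth_on W (\<lambda>x. B (f x) (g x))"
  unfolding smooth_on_def using C_k_on_bilinear by blast

lemma smooth_on_mult:
  fixes f g :: "_ \<Rightarrow> 'b::real_normed_algebra"
  shows "open W \<Longrightarrow> smooth_on W f \<Longrightarrow> smooth_on W g \<Longrightarrow> smooth_on W (\<lambda>x. f x * g x)"
  using smooth_on_bilinear[OF _ bounded_bilinear_mult] .

lemma smooth_on_compose:
  fixes f :: "'a::euclidean_space \<Rightarrow> 'b::euclidean_space" and g :: "'b \<Rightarrow> 'c::real_normed_vector"
  shows "open W \<Longrightarrow> open V \<Longrightarrow> smooth_on W f \<Longrightarrow> smooth_on V g \<Longrightarrow> f ` W \<subseteq> V \<Longrightarrow> smooth_on W (\<lambda>x. g (f x))"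
  unfolding smooth_on_def using C_k_on_compose by blast

lemma smooth_on_local:
  assumes "\<And>x. x \<in> W \<Longrightarrow> \<exists>V. open V \<and> x \<in> V \<and> smooth_on V f"
  shows "smooth_on W f"
  unfolding smooth_on_def using assms unfolding smooth_on_def by (intro allI C_k_on_local) blast

lemma smooth_on_derivative: "smooth_on W f \<Longrightarrow> smooth_on W (\<lambda>x. fderiv f x v)"
  unfolding smooth_on_def by (metis C_k_on.simps(2))

lemma smooth_on_has_derivative:
  "smooth_on W f \<Longrightarrow> x \<in> W \<Longrightarrow> (f has_derivative fderiv f x) (at x)"
  unfolding smooth_on_def using C_k_on_Suc_has_derivative by blast

lemma smooth_on_continuous_on: "smooth_on W f \<Longrightarrow> continuous_on W f"
  unfolding smooth_on_def by (metis C_k_on.simps(1))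

lemma smooth_onI:
  assumes "open W" "continuous_on W f" "\<And>x. x \<in> W \<Longrightarrow> (f has_derivative f' x) (at x)"
    and "\<And>v. smooth_on W (\<lambda>x. f' x v)"
  shows "smooth_on W f"
  unfolding smooth_on_def
proof
  fix k show "C_k_on k W f"
    using assms C_k_on_SucI[OF assms(1,3)] by (cases k) (auto simp: smooth_on_def simp del: C_k_on.simps(2))
qed

lemma smooth_on_ident: "open W \<Longrightarrow> smooth_on W (\<lambda>x. x)"
  by (rule smooth_onI[where f' = "\<lambda>x v. v"]) (auto intro: smooth_on_const)

lemma smooth_on_bounded_linear: "open W \<Longrightarrow> bounded_linear L \<Longrightarrow> smooth_on W L"
  using smooth_on_linear[OF _ _ smooth_on_ident] .

lemma smooth_on_inverse:
  fixes f :: "_ \<Rightarrow> 'b::real_normed_field"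
  assumes "open W" "smooth_on W f" "\<And>x. x \<in> W \<Longrightarrow> f x \<noteq> 0"
  shows "smooth_on W (\<lambda>x. inverse (f x))"
  unfolding smooth_on_def
proof
  fix k show "C_k_on k W (\<lambda>x. inverse (f x))"
  proof (induction k)
    case 0
    then show ?case using smooth_on_continuous_on[OF assms(2)] assms(3) by (auto intro: continuous_on_inverse)
  next
    case (Suc k)
    show ?case
    proof (rule C_k_on_SucI[OF assms(1)])
      fix x assume "x \<in> W"
      then show "((\<lambda>x. inverse (f x)) has_derivative
          (\<lambda>v. - (inverse (f x) * fderiv f x v * inverse (f x)))) (at x)"
        using Deriv.has_derivative_inverse[OF assms(3) smooth_on_has_derivative[OF assms(2)], of x] by simp
    next
      fix v
      have "C_k_on k W (\<lambda>x. fderiv f x v)"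
        using smooth_on_derivative[OF assms(2)] by (auto simp: smooth_on_def)
      then show "C_k_on k W (\<lambda>x. - (inverse (f x) * fderiv f x v * inverse (f x)))"
        by (intro C_k_on_linear[OF assms(1) bounded_linear_minus[OF bounded_linear_ident]]
             C_k_on_bilinear[OF assms(1) bounded_bilinear_mult] Suc)
    qed
  qed
qed

lemma smooth_on_exp:
  fixes f :: "_ \<Rightarrow> complex"
  assumes "open W" "smooth_on W f"
  shows "smooth_on W (\<lambda>x. exp (f x))"
  unfolding smooth_on_def
proof
  fix k show "C_k_on k W (\<lambda>x. exp (f x))"
  proof (induction k)
    case 0
    then show ?case using smooth_on_continuous_on[OF assms(2)] by (auto intro: continuous_on_exp)
  next
    case (Suc k)
    show ?case
    proof (rule C_k_on_SucI[OF assms(1)])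
      fix x assume "x \<in> W"
      then show "((\<lambda>x. exp (f x)) has_derivative
          (\<lambda>v. exp (f x) * fderiv f x v)) (at x)"
        using has_derivative_compose[OF smooth_on_has_derivative[OF assms(2)]
            DERIV_exp[unfolded has_field_derivative_def], of x] by simp
    next
      fix v
      have "C_k_on k W (\<lambda>x. fderiv f x v)"
        using smooth_on_derivative[OF assms(2)] by (auto simp: smooth_on_def)
      then show "C_k_on k W (\<lambda>x. exp (f x) * fderiv f x v)"
        by (intro C_k_on_bilinear[OF assms(1) bounded_bilinear_mult] Suc)
    qed
  qed
qed

section \<open>Symmetry of second derivatives\<close>

lemma mvt_along_real:
  fixes f :: "real \<Rightarrow> 'b::real_normed_vector"
  assumes "0 \<le> t" "\<And>s. s \<in> {0..t} \<Longrightarrow> (f has_vector_derivative f' s) (at s)"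
    and "\<And>s. s \<in> {0..t} \<Longrightarrow> norm (f' s) \<le> e"
  shows "norm (f t - f 0) \<le> e * t"
proof -
  have "norm (f t - f 0) \<le> e * norm (t - 0)"
  proof (rule differentiable_bound[of "{0..t}" f "\<lambda>s h. h *\<^sub>R f' s"])
    fix s assume s: "s \<in> {0..t}"
    show "(f has_derivative (\<lambda>h. h *\<^sub>R f' s)) (at s within {0..t})"
      using assms(2)[OF s] has_derivative_at_withinI by (auto simp: has_vector_derivative_def)
    show "onorm (\<lambda>h. h *\<^sub>R f' s) \<le> e"
    proof (rule onorm_le)
      fix h :: real
      show "norm (h *\<^sub>R f' s) \<le> e * norm h"
        using mult_right_mono[OF assms(3)[OF s], of "\<bar>h\<bar>"] by (simp add: mult.commute)
    qed
  qed (use assms(1) in auto)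
  then show ?thesis using assms(1) by simp
qed

text \<open>The mean value inequality, applied first along \<open>w\<close> to the derivative in direction \<open>v\<close> and then along
  \<open>v\<close>, compares the mixed second derivative with a second difference. The latter is symmetric in \<open>v\<close>
  and \<open>w\<close>, hence so is the derivative.\<close>
lemma second_difference:
  fixes f :: "'a::euclidean_space \<Rightarrow> 'b::real_normed_vector" and v w x :: 'a
  assumes "open W" "C_k_on 2 W f" "x \<in> W" "e > 0"
  defines "a \<equiv> fderiv (\<lambda>y. fderiv f y v) x w"
  shows "\<exists>d>0. \<forall>t. 0 < t \<and> t < d \<longrightarrow>
    norm (f (x + t *\<^sub>R v + t *\<^sub>R w) - f (x + t *\<^sub>R v) - f (x + t *\<^sub>R w) + f x - (t * t) *\<^sub>R a) \<le> e * (t * t)"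
proof -
  let ?g = "\<lambda>y. fderiv f y v"
  let ?h = "\<lambda>y. fderiv ?g y w"
  have C1: "C_k_on (Suc 0) W ?g" and Cf: "C_k_on (Suc (Suc 0)) W f"
    using assms(2) by (auto simp: numeral_2_eq_2)
  have "continuous_on W ?h" using C1 by simp
  then have "isCont ?h x" using assms(1,3) continuous_on_eq_continuous_at by blast
  then obtain d0 where d0: "d0 > 0" "\<And>y. dist y x < d0 \<Longrightarrow> dist (?h y) (?h x) < e"
    using assms(4) unfolding continuous_at_eps_delta by blast
  obtain d1 where d1: "d1 > 0" "ball x d1 \<subseteq> W" using assms(1,3) open_contains_ball by blast
  \<comment> \<open>the parallelogram with sides \<open>d v\<close> and \<open>d w\<close> stays in the balls of radius \<open>d0\<close> and \<open>d1\<close>\<close>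
  define d where "d = min d0 d1 / (norm v + norm w + 1)"
  have n0: "norm v + norm w + 1 > 0" by (smt (verit) norm_ge_zero)
  have d: "d > 0" using d0 d1 n0 by (simp add: d_def)
  have near: "x + s *\<^sub>R v + t *\<^sub>R w \<in> W" "dist (x + s *\<^sub>R v + t *\<^sub>R w) x < d0"
    if "0 \<le> s" "s < d" "0 \<le> t" "t < d" for s t
  proof -
    have "norm (s *\<^sub>R v + t *\<^sub>R w) \<le> s * norm v + t * norm w"
      using norm_triangle_ineq[of "s *\<^sub>R v" "t *\<^sub>R w"] that by simp
    also have "\<dots> \<le> d * norm v + d * norm w"
      using that by (intro add_mono mult_right_mono) auto
    also have "\<dots> < d * (norm v + norm w + 1)" using d by (simp add: algebra_simps)
    also have "\<dots> = min d0 d1" using n0 by (simp add: d_def)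
    finally have "norm (s *\<^sub>R v + t *\<^sub>R w) < min d0 d1" .
    then have *: "dist (x + s *\<^sub>R v + t *\<^sub>R w) x < min d0 d1" by (simp add: dist_norm add.assoc)
    then show "dist (x + s *\<^sub>R v + t *\<^sub>R w) x < d0" by simp
    from * d1(2) show "x + s *\<^sub>R v + t *\<^sub>R w \<in> W" by (auto simp: dist_commute subset_iff)
  qed
  have bound1: "norm (?g (x + s *\<^sub>R v + t *\<^sub>R w) - ?g (x + s *\<^sub>R v) - t *\<^sub>R a) \<le> e * t"
    if st: "0 \<le> s" "s < d" "0 \<le> t" "t < d" for s t
  proof -
    have "norm ((?g (x + s *\<^sub>R v + t *\<^sub>R w) - t *\<^sub>R a) - (?g (x + s *\<^sub>R v + 0 *\<^sub>R w) - 0 *\<^sub>R a)) \<le> e * t"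
    proof (rule mvt_along_real[where f = "\<lambda>t. ?g (x + s *\<^sub>R v + t *\<^sub>R w) - t *\<^sub>R a"])
      fix u assume u: "u \<in> {0..t}"
      then have n: "x + s *\<^sub>R v + u *\<^sub>R w \<in> W" "dist (x + s *\<^sub>R v + u *\<^sub>R w) x < d0" using near st by auto
      let ?D = "fderiv ?g (x + s *\<^sub>R v + u *\<^sub>R w)"
      have gd: "(?g has_derivative ?D) (at (x + s *\<^sub>R v + u *\<^sub>R w))"
        using C_k_on_Suc_has_derivative[OF C1 n(1)] .
      have "((\<lambda>u. x + s *\<^sub>R v + u *\<^sub>R w) has_derivative (\<lambda>h. h *\<^sub>R w)) (at u)"
        by (auto intro!: derivative_eq_intros)
      from has_derivative_compose[OF this gd]
      have "((\<lambda>u. ?g (x + s *\<^sub>R v + u *\<^sub>R w)) has_derivative (\<lambda>h. ?D (h *\<^sub>R w))) (at u)" .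
      then have "((\<lambda>u. ?g (x + s *\<^sub>R v + u *\<^sub>R w)) has_vector_derivative ?D w) (at u)"
        unfolding has_vector_derivative_def using linear_scale[OF has_derivative_linear[OF gd]] by simp
      then show "((\<lambda>t. ?g (x + s *\<^sub>R v + t *\<^sub>R w) - t *\<^sub>R a) has_vector_derivative ?h (x + s *\<^sub>R v + u *\<^sub>R w) - a) (at u)"
        by (auto intro!: derivative_eq_intros)
      show "norm (?h (x + s *\<^sub>R v + u *\<^sub>R w) - a) \<le> e"
        using d0(2)[OF n(2)] by (simp add: a_def dist_norm)
    qed (use st in auto)
    then show ?thesis by (simp add: algebra_simps)
  qed
  have "norm (f (x + t *\<^sub>R v + t *\<^sub>R w) - f (x + t *\<^sub>R v) - f (x + t *\<^sub>R w) + f x - (t * t) *\<^sub>R a) \<le> e * (t * t)"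
    if t: "0 < t" "t < d" for t
  proof -
    let ?F = "\<lambda>s. f (x + s *\<^sub>R v + t *\<^sub>R w) - f (x + s *\<^sub>R v) - (s * t) *\<^sub>R a"
    have "norm (?F t - ?F 0) \<le> (e * t) * t"
    proof (rule mvt_along_real)
      fix s assume s: "s \<in> {0..t}"
      have dd: "((\<lambda>s. f (x + s *\<^sub>R v + c)) has_vector_derivative ?g (x + s *\<^sub>R v + c)) (at s)"
        if "x + s *\<^sub>R v + c \<in> W" for c
      proof -
        have fd: "(f has_derivative fderiv f (x + s *\<^sub>R v + c)) (at (x + s *\<^sub>R v + c))"
          using C_k_on_Suc_has_derivative[OF Cf that] .
        have "((\<lambda>s. x + s *\<^sub>R v + c) has_derivative (\<lambda>h. h *\<^sub>R v)) (at s)"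
          by (auto intro!: derivative_eq_intros)
        from has_derivative_compose[OF this fd] show ?thesis
          unfolding has_vector_derivative_def using linear_scale[OF has_derivative_linear[OF fd]] by simp
      qed
      have "((\<lambda>s. f (x + s *\<^sub>R v + t *\<^sub>R w)) has_vector_derivative ?g (x + s *\<^sub>R v + t *\<^sub>R w)) (at s)"
        by (rule dd) (use near s t in auto)
      moreover have "((\<lambda>s. f (x + s *\<^sub>R v)) has_vector_derivative ?g (x + s *\<^sub>R v)) (at s)"
        using dd[of 0] near[of s 0] s t by auto
      ultimately show "(?F has_vector_derivative
          (?g (x + s *\<^sub>R v + t *\<^sub>R w) - ?g (x + s *\<^sub>R v) - t *\<^sub>R a)) (at s)"
        by (auto intro!: derivative_eq_intros)
      show "norm (?g (x + s *\<^sub>R v + t *\<^sub>R w) - ?g (x + s *\<^sub>R v) - t *\<^sub>R a) \<le> e * t"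
        using bound1 s t by auto
    qed (use t in auto)
    then show ?thesis by (simp add: algebra_simps)
  qed
  then show ?thesis using d by blast
qed

lemma C_2_symmetric:
  assumes "open W" "C_k_on 2 W f" "x \<in> W"
  shows "fderiv (\<lambda>y. fderiv f y v) x w =
         fderiv (\<lambda>y. fderiv f y w) x v" (is "?a = ?b")
proof (rule ccontr)
  assume ne: "?a \<noteq> ?b"
  define e where "e = norm (?a - ?b) / 3"
  have e: "e > 0" using ne by (simp add: e_def)
  obtain d1 where d1: "d1 > 0" "\<And>t. 0 < t \<Longrightarrow> t < d1 \<Longrightarrow>
    norm (f (x + t *\<^sub>R v + t *\<^sub>R w) - f (x + t *\<^sub>R v) - f (x + t *\<^sub>R w) + f x - (t * t) *\<^sub>R ?a) \<le> e * (t * t)"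
    using second_difference[OF assms e, of v w] by blast
  obtain d2 where d2: "d2 > 0" "\<And>t. 0 < t \<Longrightarrow> t < d2 \<Longrightarrow>
    norm (f (x + t *\<^sub>R w + t *\<^sub>R v) - f (x + t *\<^sub>R w) - f (x + t *\<^sub>R v) + f x - (t * t) *\<^sub>R ?b) \<le> e * (t * t)"
    using second_difference[OF assms e, of w v] by blast
  define t where "t = min d1 d2 / 2"
  have t: "0 < t" "t < d1" "t < d2" using d1(1) d2(1) by (auto simp: t_def)
  let ?X = "f (x + t *\<^sub>R v + t *\<^sub>R w) - f (x + t *\<^sub>R v) - f (x + t *\<^sub>R w) + f x"
  have X2: "f (x + t *\<^sub>R w + t *\<^sub>R v) - f (x + t *\<^sub>R w) - f (x + t *\<^sub>R v) + f x = ?X"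
    by (simp add: algebra_simps)
  have "norm ((t * t) *\<^sub>R (?a - ?b)) = norm ((?X - (t * t) *\<^sub>R ?b) - (?X - (t * t) *\<^sub>R ?a))"
    by (simp add: algebra_simps)
  also have "\<dots> \<le> e * (t * t) + e * (t * t)"
    using norm_triangle_ineq4 d1(2)[OF t(1,2)] d2(2)[OF t(1,3)] X2
    by (smt (verit))
  finally have "(t * t) * norm (?a - ?b) \<le> (t * t) * (2 * e)" by (simp add: mult_ac)
  then have "norm (?a - ?b) \<le> 2 * e" using t by (simp add: mult_le_cancel_left)
  then show False using e unfolding e_def by simp
qed

lemma smooth_symmetric:
  assumes "open W" "smooth_on W f" "x \<in> W"
  shows "fderiv (\<lambda>y. fderiv f y v) x w =
         fderiv (\<lambda>y. fderiv f y w) x v"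
  using C_2_symmetric assms smooth_on_def by blast

section \<open>Wirtinger derivatives\<close>

lemma frechet_derivative_cong_open:
  assumes "open W" "x \<in> W" "\<And>y. y \<in> W \<Longrightarrow> f y = g y"
  shows "fderiv f x = fderiv g x"
proof -
  have "(f has_derivative D) (at x) \<longleftrightarrow> (g has_derivative D) (at x)" for D
    using has_derivative_transform_within_open[OF _ assms(1,2)] assms(3) by metis
  then show ?thesis by (simp add: frechet_derivative_def)
qed

definition times_i :: "complex^'m \<Rightarrow> complex^'m::finite" where
  "times_i v = (\<chi> a. \<i> * v $ a)"

lemma vec_eq_sum_axes:
  fixes v :: "complex^'m::finite"
  shows "v = (\<Sum>a\<in>UNIV. Re (v $ a) *\<^sub>R axis a 1 + Im (v $ a) *\<^sub>R axis a \<i>)"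
proof (rule vec_eq_iff[THEN iffD2], rule allI)
  fix i
  have "(\<Sum>a\<in>UNIV. Re (v $ a) *\<^sub>R axis a 1 + Im (v $ a) *\<^sub>R axis a \<i>) $ i
      = (\<Sum>a\<in>UNIV. (if a = i then complex_of_real (Re (v $ a)) + Im (v $ a) * \<i> else 0))"
    unfolding sum_component by (intro sum.cong refl) (simp add: axis_def complex_eq_iff)
  also have "\<dots> = v $ i" by (simp add: complex_eq_iff)
  finally show "v $ i = (\<Sum>a\<in>UNIV. Re (v $ a) *\<^sub>R axis a 1 + Im (v $ a) *\<^sub>R axis a \<i>) $ i" by simp
qed

text \<open>The real derivative splits into its complex linear and antilinear parts.\<close>
lemma derivative_wirt:
  fixes F :: "complex^'m::finite \<Rightarrow> complex"
  assumes "F differentiable (at w)"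
  shows "fderiv F w v =
    (\<Sum>a\<in>UNIV. v $ a * wirt a F w + cnj (v $ a) * wirt_bar a F w)"
proof -
  let ?D = "fderiv F w"
  have l: "linear ?D" by (rule linear_frechet_derivative[OF assms])
  have "?D v = ?D (\<Sum>a\<in>UNIV. Re (v $ a) *\<^sub>R axis a 1 + Im (v $ a) *\<^sub>R axis a \<i>)"
    using vec_eq_sum_axes[of v] by simp
  also have "\<dots> = (\<Sum>a\<in>UNIV. Re (v $ a) *\<^sub>R ?D (axis a 1) + Im (v $ a) *\<^sub>R ?D (axis a \<i>))"
    by (simp add: linear_sum[OF l] linear_add[OF l] linear_scale[OF l])
  also have "\<dots> = (\<Sum>a\<in>UNIV. v $ a * wirt a F w + cnj (v $ a) * wirt_bar a F w)"
  proof (rule sum.cong[OF refl])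
    fix a
    have "v $ a = Re (v $ a) + \<i> * Im (v $ a)" by (rule complex_eq)
    moreover have "cnj (v $ a) = Re (v $ a) - \<i> * Im (v $ a)" by (simp add: complex_eq_iff)
    ultimately show "Re (v $ a) *\<^sub>R ?D (axis a 1) + Im (v $ a) *\<^sub>R ?D (axis a \<i>)
        = v $ a * wirt a F w + cnj (v $ a) * wirt_bar a F w"
      unfolding wirt_def wirt_bar_def scaleR_conv_of_real
      by (simp add: complex_eq_iff) (simp add: field_simps)
  qed
  finally show ?thesis .
qed

lemma wirt_of_derivative:
  fixes F :: "complex^'m::finite \<Rightarrow> complex"
  assumes "(F has_derivative (\<lambda>v. \<Sum>a\<in>UNIV. v $ a * P a + cnj (v $ a) * Q a)) (at w)"
  shows "wirt a F w = P a" "wirt_bar a F w = Q a"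
proof -
  have D: "fderiv F w = (\<lambda>v. \<Sum>a\<in>UNIV. v $ a * P a + cnj (v $ a) * Q a)"
    using frechet_derivative_at[OF assms] by simp
  have ax: "(\<Sum>b\<in>UNIV. axis a c $ b * P b + cnj (axis a c $ b) * Q b) = c * P a + cnj c * Q a" for c
  proof -
    have "(\<Sum>b\<in>UNIV. axis a c $ b * P b + cnj (axis a c $ b) * Q b)
        = (\<Sum>b\<in>UNIV. if b = a then c * P a + cnj c * Q a else 0)"
      by (intro sum.cong refl) (auto simp: axis_def)
    then show ?thesis by simp
  qed
  show "wirt a F w = P a" "wirt_bar a F w = Q a"
    unfolding wirt_def wirt_bar_def D ax by (simp_all add: algebra_simps)
qed

lemma wirt_cong:
  assumes "open W" "w \<in> W" "\<And>y. y \<in> W \<Longrightarrow> f y = g y"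
  shows "wirt a f w = wirt a g w" "wirt_bar a f w = wirt_bar a g w"
  using frechet_derivative_cong_open[OF assms] by (auto simp: wirt_def wirt_bar_def)

lemma wirt_const: "wirt a (\<lambda>w. c) w = 0" "wirt_bar a (\<lambda>w. c) w = 0"
  by (auto simp: wirt_def wirt_bar_def)

lemma frechet_derivative_eqI: "(f has_derivative D) (at x) \<Longrightarrow> fderiv f x = D"
  using frechet_derivative_at by metis

lemma wirt_add:
  assumes "f differentiable (at w)" "g differentiable (at w)"
  shows "wirt a (\<lambda>w. f w + g w) w = wirt a f w + wirt a g w"
    "wirt_bar a (\<lambda>w. f w + g w) w = wirt_bar a f w + wirt_bar a g w"
  using frechet_derivative_eqI[OF has_derivative_add[OF assms[unfolded frechet_derivative_works]]]
  by (auto simp: wirt_def wirt_bar_def field_simps)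

lemma wirt_sum:
  assumes "finite I" "\<And>i. i \<in> I \<Longrightarrow> f i differentiable (at w)"
  shows "wirt a (\<lambda>w. \<Sum>i\<in>I. f i w) w = (\<Sum>i\<in>I. wirt a (f i) w)"
    "wirt_bar a (\<lambda>w. \<Sum>i\<in>I. f i w) w = (\<Sum>i\<in>I. wirt_bar a (f i) w)"
proof -
  have "((\<lambda>w. \<Sum>i\<in>I. f i w) has_derivative (\<lambda>v. \<Sum>i\<in>I. fderiv (f i) w v)) (at w)"
    by (intro has_derivative_sum) (use assms(2) frechet_derivative_works in blast)
  note D = frechet_derivative_eqI[OF this]
  show "wirt a (\<lambda>w. \<Sum>i\<in>I. f i w) w = (\<Sum>i\<in>I. wirt a (f i) w)"
    "wirt_bar a (\<lambda>w. \<Sum>i\<in>I. f i w) w = (\<Sum>i\<in>I. wirt_bar a (f i) w)"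
    unfolding wirt_def wirt_bar_def D
    by (simp_all add: sum.distrib sum_subtractf sum_distrib_left sum_divide_distrib[symmetric])
qed

lemma wirt_mult:
  assumes "f differentiable (at w)" "g differentiable (at w)"
  shows "wirt a (\<lambda>w. f w * g w) w = wirt a f w * g w + f w * wirt a g w"
    "wirt_bar a (\<lambda>w. f w * g w) w = wirt_bar a f w * g w + f w * wirt_bar a g w"
  using frechet_derivative_eqI[OF has_derivative_mult[OF assms[unfolded frechet_derivative_works]]]
  by (auto simp: wirt_def wirt_bar_def field_simps)

lemma wirt_cnj:
  assumes "f differentiable (at w)"
  shows "wirt a (\<lambda>w. cnj (f w)) w = cnj (wirt_bar a f w)"
    "wirt_bar a (\<lambda>w. cnj (f w)) w = cnj (wirt a f w)"
  using frechet_derivative_eqI[OF has_derivative_cnj[OF assms[unfolded frechet_derivative_works]]]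
  by (auto simp: wirt_def wirt_bar_def field_simps)

lemma wirt_coord:
  fixes w :: "complex^'m::finite"
  shows "wirt a (\<lambda>w. w $ b) w = (if a = b then 1 else 0)" "wirt_bar a (\<lambda>w. w $ b) w = 0"
proof -
  have "((\<lambda>w. w $ b) has_derivative (\<lambda>v. v $ b)) (at w)" for w :: "complex^'m"
    by (rule bounded_linear_imp_has_derivative[OF bounded_linear_vec_nth])
  then have D: "fderiv (\<lambda>w. w $ b) w = (\<lambda>v. v $ b)" for w :: "complex^'m"
    using frechet_derivative_eqI by blast
  show "wirt a (\<lambda>w. w $ b) w = (if a = b then 1 else 0)" "wirt_bar a (\<lambda>w. w $ b) w = 0"
    unfolding wirt_def wirt_bar_def D by (auto simp: axis_def)
qed

lemma wirt_field_compose: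
  assumes "(h has_field_derivative h') (at (f w))" "f differentiable (at w)"
  shows "wirt a (\<lambda>w. h (f w)) w = h' * wirt a f w" "wirt_bar a (\<lambda>w. h (f w)) w = h' * wirt_bar a f w"
  using frechet_derivative_eqI[OF has_derivative_compose[OF assms(2)[unfolded frechet_derivative_works]
        assms(1)[unfolded has_field_derivative_def]]]
  by (auto simp: wirt_def wirt_bar_def field_simps)

lemma smooth_on_differentiable: "smooth_on W f \<Longrightarrow> x \<in> W \<Longrightarrow> f differentiable (at x)"
  using smooth_on_has_derivative differentiable_def by blast

lemma smooth_on_cnj: "open W \<Longrightarrow> smooth_on W f \<Longrightarrow> smooth_on W (\<lambda>x. cnj (f x))"
  by (rule smooth_on_linear[OF _ bounded_linear_cnj])

lemma smooth_on_wirt: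
  assumes "open W" "smooth_on W f"
  shows "smooth_on W (wirt a f)" "smooth_on W (wirt_bar a f)"
proof -
  have w: "wirt a f = (\<lambda>w. (1/2) * fderiv f w (axis a 1) + (- \<i>/2) * fderiv f w (axis a \<i>))"
    and wb: "wirt_bar a f = (\<lambda>w. (1/2) * fderiv f w (axis a 1) + (\<i>/2) * fderiv f w (axis a \<i>))"
    by (auto simp: wirt_def wirt_bar_def fun_eq_iff field_simps)
  show "smooth_on W (wirt a f)" "smooth_on W (wirt_bar a f)"
    unfolding w wb by (intro smooth_on_add smooth_on_mult smooth_on_const smooth_on_derivative assms)+
qed

lemma wirt_commute:
  assumes "open W" "smooth_on W f" "w \<in> W"
  shows "wirt_bar a (wirt b f) w = wirt b (wirt_bar a f) w"
proof -
  let ?D = "\<lambda>v y. fderiv f y v"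
  let ?DD = "\<lambda>v u. fderiv (?D v) w u"
  have d: "(?D v has_derivative ?DD v) (at w)" for v
    using smooth_on_has_derivative[OF smooth_on_derivative[OF assms(2)] assms(3)] .
  have comb: "fderiv (\<lambda>y. (?D v y + c * ?D v' y) / 2) w u = (?DD v u + c * ?DD v' u) / 2" for v v' u c
  proof -
    have "((\<lambda>y. (?D v y + c * ?D v' y) / 2) has_derivative (\<lambda>u. (?DD v u + c * ?DD v' u) / 2)) (at w)"
      by (intro bounded_linear.has_derivative[OF bounded_linear_divide] has_derivative_add has_derivative_mult_right d)
    then show ?thesis by (simp add: frechet_derivative_eqI)
  qed
  have 1: "fderiv (wirt b f) w u = (?DD (axis b 1) u - \<i> * ?DD (axis b \<i>) u) / 2" for u
    using comb[of "axis b 1" "- \<i>" "axis b \<i>" u] by (simp add: wirt_def[abs_def])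
  have 2: "fderiv (wirt_bar a f) w u = (?DD (axis a 1) u + \<i> * ?DD (axis a \<i>) u) / 2" for u
    using comb[of "axis a 1" "\<i>" "axis a \<i>" u] by (simp add: wirt_bar_def[abs_def])
  have s: "?DD (axis b c) (axis a c') = ?DD (axis a c') (axis b c)" for c c'
    by (rule smooth_symmetric[OF assms])
  have alg: "((p - \<i> * q) / 2 + \<i> * ((r - \<i> * t) / 2)) / 2 = ((p + \<i> * r) / 2 - \<i> * ((q + \<i> * t) / 2)) / 2"
    for p q r t :: complex
    by (simp add: complex_eq_iff field_simps)
  have "wirt_bar a (wirt b f) w
    = ((?DD (axis b 1) (axis a 1) - \<i> * ?DD (axis b \<i>) (axis a 1)) / 2 +
     \<i> * ((?DD (axis b 1) (axis a \<i>) - \<i> * ?DD (axis b \<i>) (axis a \<i>)) / 2)) / 2"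
    unfolding wirt_bar_def[of a "wirt b f"] 1 ..
  also have "\<dots> = ((?DD (axis a 1) (axis b 1) + \<i> * ?DD (axis a \<i>) (axis b 1)) / 2 -
     \<i> * ((?DD (axis a 1) (axis b \<i>) + \<i> * ?DD (axis a \<i>) (axis b \<i>)) / 2)) / 2"
    unfolding s[of 1 1] s[of 1 \<i>] s[of \<i> 1] s[of \<i> \<i>] by (rule alg)
  also have "\<dots> = wirt b (wirt_bar a f) w"
    unfolding wirt_def[of b "wirt_bar a f"] 2 ..
  finally show ?thesis .
qed

section \<open>Holomorphic functions of several variables\<close>

definition holo_on :: "(complex^'m::finite) set \<Rightarrow> (complex^'m \<Rightarrow> complex) \<Rightarrow> bool" where
  "holo_on W f \<longleftrightarrow> smooth_on W f \<and> (\<forall>w\<in>W. \<forall>a. wirt_bar a f w = 0)"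

lemma holo_onD: "holo_on W f \<Longrightarrow> smooth_on W f" "holo_on W f \<Longrightarrow> w \<in> W \<Longrightarrow> wirt_bar a f w = 0"
  by (auto simp: holo_on_def)

lemma holo_on_const: "open W \<Longrightarrow> holo_on W (\<lambda>w. c)"
  by (simp add: holo_on_def smooth_on_const wirt_const)

lemma holo_on_coord: "open W \<Longrightarrow> holo_on W (\<lambda>w. w $ b)"
  by (simp add: holo_on_def wirt_coord smooth_on_bounded_linear bounded_linear_vec_nth)

lemma holo_on_mult:
  assumes "open W" "holo_on W f" "holo_on W g"
  shows "holo_on W (\<lambda>w. f w * g w)"
  unfolding holo_on_def
proof (intro conjI ballI allI)
  show "smooth_on W (\<lambda>w. f w * g w)"
    using assms by (intro smooth_on_mult holo_onD)
  fix w a assume w: "w \<in> W"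
  show "wirt_bar a (\<lambda>w. f w * g w) w = 0"
    by (simp add: wirt_mult(2) smooth_on_differentiable[OF holo_onD(1) w] assms holo_onD(2)[OF _ w])
qed

lemma holo_on_add:
  assumes "open W" "holo_on W f" "holo_on W g"
  shows "holo_on W (\<lambda>w. f w + g w)"
  unfolding holo_on_def
proof (intro conjI ballI allI)
  show "smooth_on W (\<lambda>w. f w + g w)"
    using assms by (intro smooth_on_add holo_onD)
  fix w a assume w: "w \<in> W"
  show "wirt_bar a (\<lambda>w. f w + g w) w = 0"
    by (simp add: wirt_add(2) smooth_on_differentiable[OF holo_onD(1) w] assms holo_onD(2)[OF _ w])
qed

lemma holo_on_sum:
  assumes "open W" "finite I" "\<And>i. i \<in> I \<Longrightarrow> holo_on W (f i)"
  shows "holo_on W (\<lambda>w. \<Sum>i\<in>I. f i w)"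
  using assms(2,3) by (induction I rule: finite_induct) (auto intro: holo_on_const holo_on_add assms(1))

lemma holo_on_prod:
  assumes "open W" "finite I" "\<And>i. i \<in> I \<Longrightarrow> holo_on W (f i)"
  shows "holo_on W (\<lambda>w. \<Prod>i\<in>I. f i w)"
  using assms(2,3) by (induction I rule: finite_induct) (auto intro: holo_on_const holo_on_mult assms(1))

lemma holo_on_power: "open W \<Longrightarrow> holo_on W f \<Longrightarrow> holo_on W (\<lambda>w. f w ^ k)"
  by (induction k) (auto intro: holo_on_const holo_on_mult)

lemma holo_on_inverse:
  assumes "open W" "holo_on W f" "\<And>w. w \<in> W \<Longrightarrow> f w \<noteq> 0"
  shows "holo_on W (\<lambda>w. inverse (f w))"
  unfolding holo_on_def
proof (intro conjI ballI allI)
  show "smooth_on W (\<lambda>w. inverse (f w))"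
    using assms by (intro smooth_on_inverse holo_onD)
  fix w a assume w: "w \<in> W"
  have "wirt_bar a (\<lambda>w. inverse (f w)) w = - (inverse (f w) ^ 2) * wirt_bar a f w"
    by (rule wirt_field_compose)
      (use assms(3)[OF w] smooth_on_differentiable[OF holo_onD(1)[OF assms(2)] w]
        DERIV_inverse[of "f w" UNIV] in \<open>auto simp: numeral_2_eq_2\<close>)
  then show "wirt_bar a (\<lambda>w. inverse (f w)) w = 0"
    using holo_onD(2)[OF assms(2) w] by simp
qed

text \<open>Symmetry of second derivatives moves the antiholomorphic derivative past the holomorphic one.\<close>
lemma holo_on_wirt:
  assumes "open W" "holo_on W f"
  shows "holo_on W (wirt b f)"
  unfolding holo_on_def
proof (intro conjI ballI allI)
  show "smooth_on W (wirt b f)" using assms holo_onD smooth_on_wirt by blast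
  fix w a assume w: "w \<in> W"
  have "wirt_bar a (wirt b f) w = wirt b (wirt_bar a f) w"
    using wirt_commute[OF assms(1) holo_onD(1)[OF assms(2)] w] .
  also have "\<dots> = wirt b (\<lambda>w. 0) w"
    by (rule wirt_cong[OF assms(1) w]) (use holo_onD(2)[OF assms(2)] in auto)
  finally show "wirt_bar a (wirt b f) w = 0" by (simp add: wirt_const)
qed

lemma holo_on_det:
  fixes M :: "complex^'m::finite \<Rightarrow> complex^'k^'k::finite"
  assumes "open W" "\<And>i j. holo_on W (\<lambda>w. M w $ i $ j)"
  shows "holo_on W (\<lambda>w. det (M w))"
  unfolding det_def
  by (intro holo_on_sum holo_on_mult holo_on_const holo_on_prod assms) auto

lemma smooth_on_vec:
  fixes f :: "'a::euclidean_space \<Rightarrow> complex^'k::finite"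
  assumes "open W" "\<And>i. smooth_on W (\<lambda>w. f w $ i)"
  shows "smooth_on W f"
proof -
  have bl: "bounded_linear (axis i :: complex \<Rightarrow> complex^'k)" for i
    by (rule linear_conv_bounded_linear[THEN iffD1])
      (auto intro!: linearI simp: axis_def vec_eq_iff)
  have "f = (\<lambda>w. \<Sum>i\<in>UNIV. axis i (f w $ i))"
    by (auto simp: fun_eq_iff vec_eq_iff axis_def sum_component)
  moreover have "smooth_on W (\<lambda>w. \<Sum>i\<in>UNIV. axis i (f w $ i))"
    by (intro smooth_on_sum smooth_on_linear[OF _ bl] assms) auto
  ultimately show ?thesis by simp
qed

lemma frechet_derivative_component:
  fixes f :: "'a::euclidean_space \<Rightarrow> complex^'k::finite"
  assumes "f differentiable (at x)"
  shows "fderiv (\<lambda>x. f x $ i) x v = fderiv f x v $ i"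
  using frechet_derivative_eqI[OF bounded_linear.has_derivative[OF bounded_linear_vec_nth
        assms[unfolded frechet_derivative_works]], of i] by metis

text \<open>For a holomorphic inner map the chain rule does not mix the two kinds of derivatives.\<close>
lemma wirt_compose:
  fixes \<Phi> :: "complex^'m::finite \<Rightarrow> complex^'k::finite"
  assumes "\<Phi> differentiable (at w)" "\<And>D. wirt_bar B (\<lambda>w. \<Phi> w $ D) w = 0"
    and "F differentiable (at (\<Phi> w))"
  shows "wirt B (\<lambda>w. F (\<Phi> w)) w = (\<Sum>D\<in>UNIV. wirt B (\<lambda>w. \<Phi> w $ D) w * wirt D F (\<Phi> w))"
    "wirt_bar B (\<lambda>w. F (\<Phi> w)) w = (\<Sum>D\<in>UNIV. cnj (wirt B (\<lambda>w. \<Phi> w $ D) w) * wirt_bar D F (\<Phi> w))"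
proof -
  let ?P = "\<lambda>v D. fderiv (\<lambda>w. \<Phi> w $ D) w v"
  have D: "fderiv (\<lambda>w. F (\<Phi> w)) w v =
      (\<Sum>D\<in>UNIV. ?P v D * wirt D F (\<Phi> w) + cnj (?P v D) * wirt_bar D F (\<Phi> w))" for v
  proof -
    have "fderiv (\<lambda>w. F (\<Phi> w)) w v =
      fderiv F (\<Phi> w) (fderiv \<Phi> w v)"
      using frechet_derivative_eqI[OF has_derivative_compose[OF assms(1,3)[unfolded frechet_derivative_works]]]
      by metis
    then show ?thesis
      by (simp add: derivative_wirt[OF assms(3)] frechet_derivative_component[OF assms(1)])
  qed
  have pi: "?P (axis B \<i>) D = \<i> * ?P (axis B 1) D" for D
    using assms(2)[of D] unfolding wirt_bar_def
    by (simp add: complex_eq_iff)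
  have p1: "wirt B (\<lambda>w. \<Phi> w $ D) w = ?P (axis B 1) D" for D
    unfolding wirt_def pi by simp
  let ?X = "\<Sum>D\<in>UNIV. ?P (axis B 1) D * wirt D F (\<Phi> w)"
  let ?Y = "\<Sum>D\<in>UNIV. cnj (?P (axis B 1) D) * wirt_bar D F (\<Phi> w)"
  have D1: "fderiv (\<lambda>w. F (\<Phi> w)) w (axis B 1) = ?X + ?Y"
    unfolding D by (rule sum.distrib)
  have Di: "fderiv (\<lambda>w. F (\<Phi> w)) w (axis B \<i>) = \<i> * ?X - \<i> * ?Y"
    unfolding D pi by (simp add: sum_distrib_left sum_subtractf[symmetric] mult_ac)
  show "wirt B (\<lambda>w. F (\<Phi> w)) w = (\<Sum>D\<in>UNIV. wirt B (\<lambda>w. \<Phi> w $ D) w * wirt D F (\<Phi> w))"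
    "wirt_bar B (\<lambda>w. F (\<Phi> w)) w = (\<Sum>D\<in>UNIV. cnj (wirt B (\<lambda>w. \<Phi> w $ D) w) * wirt_bar D F (\<Phi> w))"
    unfolding p1 unfolding wirt_def[of B "\<lambda>w. F (\<Phi> w)"] wirt_bar_def[of B "\<lambda>w. F (\<Phi> w)"] D1 Di
    by (simp_all add: algebra_simps)
qed

text \<open>The first derivatives of a holomorphic map are again holomorphic, so their conjugates are killed by
  \<open>\<partial>\<close> and no second derivatives of the map survive: the Levi form transforms as a Hermitian form.\<close>
lemma levi_form_compose:
  fixes \<Phi> :: "complex^'m::finite \<Rightarrow> complex^'k::finite"
  assumes "open W" "open V" "\<Phi> ` W \<subseteq> V" "smooth_on V F"
    and hol: "\<And>D. holo_on W (\<lambda>w. \<Phi> w $ D)" and w: "w \<in> W"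
  shows "wirt A (wirt_bar B (\<lambda>w. F (\<Phi> w))) w =
    (\<Sum>C\<in>UNIV. \<Sum>D\<in>UNIV. wirt A (\<lambda>w. \<Phi> w $ C) w * wirt C (wirt_bar D F) (\<Phi> w) * cnj (wirt B (\<lambda>w. \<Phi> w $ D) w))"
proof -
  have sP: "smooth_on W \<Phi>" by (rule smooth_on_vec[OF assms(1) holo_onD(1)[OF hol]])
  have cF: "smooth_on V (wirt_bar D F)" for D using smooth_on_wirt[OF assms(2,4)] by blast
  have sF: "smooth_on W (\<lambda>w. wirt_bar D F (\<Phi> w))" for D
    by (rule smooth_on_compose[OF assms(1,2) sP cF assms(3)])
  have hB: "holo_on W (wirt B (\<lambda>w. \<Phi> w $ D))" for D
    by (rule holo_on_wirt[OF assms(1) hol])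
  have sB: "smooth_on W (\<lambda>w. cnj (wirt B (\<lambda>w. \<Phi> w $ D) w))" for D
    by (rule smooth_on_cnj[OF assms(1)]) (use hB holo_onD in blast)
  have "wirt A (wirt_bar B (\<lambda>w. F (\<Phi> w))) w =
      wirt A (\<lambda>w. \<Sum>D\<in>UNIV. cnj (wirt B (\<lambda>w. \<Phi> w $ D) w) * wirt_bar D F (\<Phi> w)) w"
  proof (rule wirt_cong[OF assms(1) w])
    fix y assume y: "y \<in> W"
    show "wirt_bar B (\<lambda>w. F (\<Phi> w)) y = (\<Sum>D\<in>UNIV. cnj (wirt B (\<lambda>w. \<Phi> w $ D) y) * wirt_bar D F (\<Phi> y))"
      by (rule wirt_compose(2)[OF smooth_on_differentiable[OF sP y] holo_onD(2)[OF hol y]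
            smooth_on_differentiable[OF assms(4)]]) (use y assms(3) in auto)
  qed
  also have "\<dots> = (\<Sum>D\<in>UNIV. wirt A (\<lambda>w. cnj (wirt B (\<lambda>w. \<Phi> w $ D) w) * wirt_bar D F (\<Phi> w)) w)"
    by (rule wirt_sum) (auto intro!: smooth_on_differentiable[OF smooth_on_mult[OF assms(1) sB sF] w])
  also have "\<dots> = (\<Sum>D\<in>UNIV. cnj (wirt B (\<lambda>w. \<Phi> w $ D) w) *
     (\<Sum>C\<in>UNIV. wirt A (\<lambda>w. \<Phi> w $ C) w * wirt C (wirt_bar D F) (\<Phi> w)))"
  proof (rule sum.cong[OF refl])
    fix D
    have c0: "wirt A (\<lambda>w. cnj (wirt B (\<lambda>w. \<Phi> w $ D) w)) w = 0"
      using wirt_cnj(1)[OF smooth_on_differentiable[OF holo_onD(1)[OF hB] w]] holo_onD(2)[OF hB w] by simp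
    have "wirt A (\<lambda>w. wirt_bar D F (\<Phi> w)) w = (\<Sum>C\<in>UNIV. wirt A (\<lambda>w. \<Phi> w $ C) w * wirt C (wirt_bar D F) (\<Phi> w))"
      by (rule wirt_compose(1)[OF smooth_on_differentiable[OF sP w] holo_onD(2)[OF hol w]
            smooth_on_differentiable[OF cF]]) (use w assms(3) in auto)
    then show "wirt A (\<lambda>w. cnj (wirt B (\<lambda>w. \<Phi> w $ D) w) * wirt_bar D F (\<Phi> w)) w = cnj (wirt B (\<lambda>w. \<Phi> w $ D) w) *
     (\<Sum>C\<in>UNIV. wirt A (\<lambda>w. \<Phi> w $ C) w * wirt C (wirt_bar D F) (\<Phi> w))"
      using wirt_mult(1)[OF smooth_on_differentiable[OF sB w] smooth_on_differentiable[OF sF w]] c0 by simp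
  qed
  also have "\<dots> = (\<Sum>D\<in>UNIV. \<Sum>C\<in>UNIV. wirt A (\<lambda>w. \<Phi> w $ C) w * wirt C (wirt_bar D F) (\<Phi> w) * cnj (wirt B (\<lambda>w. \<Phi> w $ D) w))"
    by (simp add: sum_distrib_left mult_ac)
  also have "\<dots> = (\<Sum>C\<in>UNIV. \<Sum>D\<in>UNIV. wirt A (\<lambda>w. \<Phi> w $ C) w * wirt C (wirt_bar D F) (\<Phi> w) * cnj (wirt B (\<lambda>w. \<Phi> w $ D) w))"
    by (rule sum.swap)
  finally show ?thesis .
qed

lemma holo_on_compose:
  fixes \<Phi> :: "complex^'m::finite \<Rightarrow> complex^'k::finite"
  assumes "open W" "open V" "\<Phi> ` W \<subseteq> V" "holo_on V F"
    and hol: "\<And>D. holo_on W (\<lambda>w. \<Phi> w $ D)"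
  shows "holo_on W (\<lambda>w. F (\<Phi> w))"
  unfolding holo_on_def
proof (intro conjI ballI allI)
  have sP: "smooth_on W \<Phi>" by (rule smooth_on_vec[OF assms(1) holo_onD(1)[OF hol]])
  show "smooth_on W (\<lambda>w. F (\<Phi> w))"
    by (rule smooth_on_compose[OF assms(1,2) sP holo_onD(1)[OF assms(4)] assms(3)])
  fix w a assume w: "w \<in> W"
  then have "\<Phi> w \<in> V" using assms(3) by auto
  then show "wirt_bar a (\<lambda>w. F (\<Phi> w)) w = 0"
    using wirt_compose(2)[OF smooth_on_differentiable[OF sP w] holo_onD(2)[OF hol w]
        smooth_on_differentiable[OF holo_onD(1)[OF assms(4)]]] holo_onD(2)[OF assms(4)] by simp
qed

lemma wirt_bar_eq_0I:
  assumes "fderiv F w (times_i (axis a 1)) = \<i> * fderiv F w (axis a 1)"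
  shows "wirt_bar a F w = 0"
proof -
  have "times_i (axis a 1) = axis a \<i>" by (simp add: times_i_def axis_def vec_eq_iff)
  then show ?thesis using assms by (simp add: wirt_bar_def complex_eq_iff)
qed

text \<open>The derivative in the antiholomorphic direction determined by \<open>c\<close>, in terms of real derivatives along
  \<open>c\<close> and \<open>\<i> c\<close>; the latter are accessible geometrically.\<close>
lemma sum_wirt_direction:
  fixes F :: "complex^'m::finite \<Rightarrow> complex"
  assumes "F differentiable (at w)"
  shows "(\<Sum>a\<in>UNIV. cnj (c $ a) * wirt_bar a F w) =
    (fderiv F w c + \<i> * fderiv F w (times_i c)) / 2"
  unfolding derivative_wirt[OF assms] times_i_def
  by (simp add: sum_distrib_left sum.distrib sum_subtractf algebra_simps sum_negf)

section \<open>Inverses, traces and determinants of matrices\<close>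

lemma matrix_inv_works:
  fixes A :: "complex^'m::finite^'m"
  assumes "invertible A"
  shows "A ** matrix_inv A = mat 1" "matrix_inv A ** A = mat 1"
  using someI_ex[OF assms[unfolded invertible_def]] by (auto simp: matrix_inv_def)

text \<open>The trace of a form with respect to another one is invariant under a simultaneous change of frame.\<close>
lemma trace_congruence:
  fixes K g H L :: "complex^'m::finite^'m"
  assumes "invertible K" "invertible g" "invertible H"
  shows "trace (matrix_inv (K ** g ** H) ** (K ** L ** H)) = trace (matrix_inv g ** L)"
proof -
  let ?M = "matrix_inv H ** matrix_inv g ** matrix_inv K"
  have inv: "invertible (K ** g ** H)" using assms invertible_mult by blast
  have 1: "K ** g ** H ** ?M = mat 1"
  proof -
    have "K ** g ** H ** ?M = K ** (g ** (H ** matrix_inv H) ** matrix_inv g) ** matrix_inv K"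
      by (simp add: matrix_mul_assoc)
    then show ?thesis by (simp add: matrix_inv_works assms)
  qed
  have X: "matrix_inv (K ** g ** H) = ?M"
  proof -
    have "matrix_inv (K ** g ** H) = matrix_inv (K ** g ** H) ** (K ** g ** H ** ?M)" by (simp add: 1)
    also have "\<dots> = (matrix_inv (K ** g ** H) ** (K ** g ** H)) ** ?M" by (simp add: matrix_mul_assoc)
    finally show ?thesis by (simp add: matrix_inv_works(2)[OF inv])
  qed
  have "matrix_inv (K ** g ** H) ** (K ** L ** H) = matrix_inv H ** (matrix_inv g ** (matrix_inv K ** K) ** L ** H)"
    unfolding X by (simp add: matrix_mul_assoc)
  also have "trace \<dots> = trace ((matrix_inv g ** L ** H) ** matrix_inv H)"
    by (subst trace_mul_sym) (simp add: matrix_inv_works assms)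
  also have "(matrix_inv g ** L ** H) ** matrix_inv H = matrix_inv g ** L ** (H ** matrix_inv H)"
    by (simp add: matrix_mul_assoc)
  finally show ?thesis by (simp add: matrix_inv_works assms)
qed

text \<open>Expansion along the first row: only permutations that fix \<open>None\<close> contribute, and these are the
  permutations of the remaining indices.\<close>
lemma det_option:
  fixes A :: "'a::comm_ring_1^('m::finite option)^('m option)"
  assumes "\<And>i. A $ None $ Some i = 0"
  shows "det A = A $ None $ None * det (\<chi> i j. A $ Some i $ Some j)"
proof -
  let ?mp = "\<lambda>p :: 'm \<Rightarrow> 'm. map_permutation UNIV Some p"
  let ?R = "range (Some :: 'm \<Rightarrow> 'm option)"
  let ?f = "\<lambda>p. of_int (sign p) * (\<Prod>i\<in>UNIV. A $ i $ p i)"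
  have bR: "bij_betw (Some :: 'm \<Rightarrow> 'm option) UNIV ?R" by (simp add: bij_betw_def)
  have bR': "bij_betw the ?R (UNIV :: 'm set)" by (rule bij_betwI[where g = Some]) auto
  have R: "?R = UNIV - {None}" by (auto simp: image_iff)
  have mpN: "?mp p None = None" if "p permutes UNIV" for p
    using permutes_not_in[OF map_permutation_permutes[OF bR that], of None] by auto
  have mpS: "?mp p (Some i) = Some (p i)" for p i
    by (rule map_permutation_apply) auto
  have bij: "bij_betw ?mp {p. p permutes UNIV} {p. p permutes ?R}"
  proof (rule bij_betw_byWitness[where f' = "map_permutation ?R the"])
    show "\<forall>p\<in>{p. p permutes UNIV}. map_permutation ?R the (?mp p) = p"
      using map_permutation_compose_inv[OF bR] by auto
    show "\<forall>p\<in>{p. p permutes ?R}. ?mp (map_permutation ?R the p) = p"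
      by (auto intro!: map_permutation_compose_inv[OF bR'])
    show "?mp ` {p. p permutes UNIV} \<subseteq> {p. p permutes ?R}"
      using map_permutation_permutes[OF bR] by auto
    show "map_permutation ?R the ` {p. p permutes ?R} \<subseteq> {p. p permutes UNIV}"
      using map_permutation_permutes[OF bR'] by auto
  qed
  have U: "(UNIV :: 'm option set) = insert None ?R" using R by auto
  have "det A = (\<Sum>p\<in>{p. p permutes UNIV}. ?f p)" by (simp add: det_def)
  also have "\<dots> = (\<Sum>p\<in>{p. p permutes ?R}. ?f p)"
  proof (rule sum.mono_neutral_right)
    show "{p. p permutes ?R} \<subseteq> {p. p permutes UNIV}"
      using permutes_subset by blast
    show "\<forall>p\<in>{p. p permutes UNIV} - {p. p permutes ?R}. ?f p = 0"
    proof
      fix p :: "'m option \<Rightarrow> 'm option" assume p: "p \<in> {p. p permutes UNIV} - {p. p permutes ?R}"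
      have "p None \<noteq> None"
      proof
        assume "p None = None"
        then have "p permutes ?R"
          using p unfolding permutes_def R by auto
        then show False using p by auto
      qed
      then obtain i where "p None = Some i" by auto
      then have "A $ None $ p None = 0" using assms by simp
      then have "(\<Prod>i\<in>UNIV. A $ i $ p i) = 0" by (intro prod_zero) auto
      then show "?f p = 0" by simp
    qed
  qed (simp add: finite_permutations)
  also have "\<dots> = (\<Sum>p\<in>{p. p permutes UNIV}. ?f (?mp p))"
    by (rule sum.reindex_bij_betw[OF bij, symmetric])
  also have "\<dots> = (\<Sum>p\<in>{p. p permutes UNIV}. A $ None $ None * (of_int (sign p) * (\<Prod>i\<in>UNIV. A $ Some i $ Some (p i))))"
  proof (rule sum.cong[OF refl])
    fix p :: "'m \<Rightarrow> 'm" assume p: "p \<in> {p. p permutes UNIV}"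
    have "(\<Prod>i\<in>UNIV. A $ i $ ?mp p i) = A $ None $ None * (\<Prod>i\<in>?R. A $ i $ ?mp p i)"
      using p by (subst U, subst prod.insert) (auto simp: mpN)
    also have "(\<Prod>i\<in>?R. A $ i $ ?mp p i) = (\<Prod>i\<in>UNIV. A $ Some i $ Some (p i))"
      by (subst prod.reindex) (auto simp: mpS)
    finally show "?f (?mp p) = A $ None $ None * (of_int (sign p) * (\<Prod>i\<in>UNIV. A $ Some i $ Some (p i)))"
      using p by (simp add: sign_map_permutation mult_ac)
  qed
  finally show ?thesis by (simp add: det_def sum_distrib_left)
qed

section \<open>Tangent vectors in charts\<close>

text \<open>The value 0 at functions that are not smooth near \<open>p\<close> agrees with the convention of \<open>complex_tangent\<close>,
  so complex tangent vectors are literally the combinations of two such derivations.\<close>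
definition chart_vec ::
  "('s::topological_space, 'e::euclidean_space) chart set \<Rightarrow> 's set \<Rightarrow> ('s \<Rightarrow> 'e) \<Rightarrow> 's \<Rightarrow> 'e \<Rightarrow> 's tvec" where
  "chart_vec A D c p u = (\<lambda>f. if smooth_near A p f
     then fderiv (f \<circ> inv_into D c) (c p) u else 0)"

lemma atlas_chart:
  assumes "smooth_atlas A" "(D, c) \<in> A"
  shows "open D" "open (c ` D)" "inj_on c D" "homeomorphism D (c ` D) c (inv_into D c)"
  using assms by (auto simp: smooth_atlas_def intro!: inj_on_inverseI[where g = "inv_into D c"] dest: homeomorphism_apply1)

lemma atlas_cover: "smooth_atlas A \<Longrightarrow> \<exists>D c. (D, c) \<in> A \<and> p \<in> D"
  unfolding smooth_atlas_def by blast

lemma atlas_open_image: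
  assumes "smooth_atlas A" "(D, c) \<in> A" "open V"
  shows "open (c ` (D \<inter> V))"
proof -
  note ch = atlas_chart[OF assms(1,2)]
  have "openin (top_of_set (c ` D)) (c ` (D \<inter> V))"
    by (rule homeomorphism_imp_open_map[OF ch(4)]) (use assms(3) in \<open>auto simp: openin_open\<close>)
  then show ?thesis using ch(2) openin_open_trans by blast
qed

lemma atlas_transition:
  assumes "smooth_atlas A" "(D, c) \<in> A" "(D', c') \<in> A"
  shows "smooth_on (c ` (D \<inter> D')) (c' \<circ> inv_into D c)"
  using assms unfolding smooth_atlas_def by fastforce

lemma mfd_smooth_onD: "mfd_smooth_on A W f \<Longrightarrow> (D, c) \<in> A \<Longrightarrow> smooth_on (c ` (D \<inter> W)) (f \<circ> inv_into D c)"
  unfolding mfd_smooth_on_def by fast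

lemma mfd_smooth_on_subset: "mfd_smooth_on A W f \<Longrightarrow> V \<subseteq> W \<Longrightarrow> mfd_smooth_on A V f"
  unfolding mfd_smooth_on_def by (fast intro: smooth_on_subset)

lemma smooth_near_chart:
  assumes "smooth_atlas A" "(D, c) \<in> A" "p \<in> D" "smooth_near A p f"
  obtains V where "open V" "c p \<in> V" "V \<subseteq> c ` D" "smooth_on V (f \<circ> inv_into D c)"
proof -
  obtain W where W: "open W" "p \<in> W" "mfd_smooth_on A W f"
    using assms(4) by (auto simp: smooth_near_def)
  show ?thesis
    by (rule that[OF atlas_open_image[OF assms(1,2) W(1)] _ _ mfd_smooth_onD[OF W(3) assms(2)]])
      (use W assms(3) in auto)
qed

lemma smooth_near_differentiable:
  assumes "smooth_atlas A" "(D, c) \<in> A" "p \<in> D" "smooth_near A p f"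
  shows "(f \<circ> inv_into D c) differentiable (at (c p))"
  using smooth_near_chart[OF assms] smooth_on_differentiable by metis

lemma chart_vec_change:
  assumes "smooth_atlas A" "(D, c) \<in> A" "(D', c') \<in> A" "p \<in> D" "p \<in> D'"
  shows "chart_vec A D' c' p u = chart_vec A D c p (fderiv (c \<circ> inv_into D' c') (c' p) u)"
proof
  fix f
  let ?\<phi> = "c \<circ> inv_into D' c'"
  show "chart_vec A D' c' p u f = chart_vec A D c p (fderiv ?\<phi> (c' p) u) f"
  proof (cases "smooth_near A p f")
    case True
    note ch = atlas_chart[OF assms(1,2)] and ch' = atlas_chart[OF assms(1,3)]
    have o: "open (c' ` (D' \<inter> D))" by (rule atlas_open_image[OF assms(1,3) ch(1)])
    have m: "c' p \<in> c' ` (D' \<inter> D)" using assms by auto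
    have phi_p: "?\<phi> (c' p) = c p" using assms ch'(3) by simp
    have d\<phi>: "(?\<phi> has_derivative fderiv ?\<phi> (c' p)) (at (c' p))"
      by (rule smooth_on_has_derivative[OF atlas_transition[OF assms(1,3,2)] m])
    have df: "((f \<circ> inv_into D c) has_derivative fderiv (f \<circ> inv_into D c) (c p)) (at (?\<phi> (c' p)))"
      unfolding phi_p using smooth_near_differentiable[OF assms(1,2,4) True] frechet_derivative_works by blast
    have "((\<lambda>y. (f \<circ> inv_into D c) (?\<phi> y)) has_derivative
        (\<lambda>u. fderiv (f \<circ> inv_into D c) (c p) (fderiv ?\<phi> (c' p) u))) (at (c' p))"
      by (rule has_derivative_compose[OF d\<phi> df])
    then have "((f \<circ> inv_into D' c') has_derivative
        (\<lambda>u. fderiv (f \<circ> inv_into D c) (c p) (fderiv ?\<phi> (c' p) u))) (at (c' p))"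
      by (rule has_derivative_transform_within_open[OF _ o m]) (use ch(3) ch'(3) in auto)
    then show ?thesis using True by (simp add: chart_vec_def frechet_derivative_eqI)
  qed (simp add: chart_vec_def)
qed

lemma chart_vec_linear:
  assumes "smooth_atlas A" "(D, c) \<in> A" "p \<in> D"
  shows "chart_vec A D c p (u + v) = tadd (chart_vec A D c p u) (chart_vec A D c p v)"
    and "chart_vec A D c p (r *\<^sub>R u) = tscale (of_real r) (chart_vec A D c p u)"
    and "chart_vec A D c p 0 = (\<lambda>f. 0)"
proof -
  have l: "linear (fderiv (f \<circ> inv_into D c) (c p))" if "smooth_near A p f" for f :: "'a \<Rightarrow> complex"
    by (rule linear_frechet_derivative[OF smooth_near_differentiable[OF assms that]])
  show "chart_vec A D c p (u + v) = tadd (chart_vec A D c p u) (chart_vec A D c p v)"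
    and "chart_vec A D c p (r *\<^sub>R u) = tscale (of_real r) (chart_vec A D c p u)"
    and "chart_vec A D c p 0 = (\<lambda>f. 0)"
    using linear_add[OF l] linear_scale[OF l] linear_0[OF l]
    by (auto simp: fun_eq_iff chart_vec_def tadd_def tscale_def scaleR_conv_of_real)
qed

lemma complex_tangent_chart:
  assumes "smooth_atlas A" "(D, c) \<in> A" "p \<in> D"
  shows "X \<in> complex_tangent A p \<longleftrightarrow> (\<exists>u v. X = tadd (chart_vec A D c p u) (tscale \<i> (chart_vec A D c p v)))"
proof
  assume "X \<in> complex_tangent A p"
  then obtain D' c' u v where D': "(D', c') \<in> A" "p \<in> D'"
    and X: "X = (\<lambda>f. if smooth_near A p f
          then fderiv (f \<circ> inv_into D' c') (c' p) u
               + \<i> * fderiv (f \<circ> inv_into D' c') (c' p) v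
          else 0)"
    unfolding complex_tangent_def by blast
  have "X = tadd (chart_vec A D' c' p u) (tscale \<i> (chart_vec A D' c' p v))"
    unfolding X by (auto simp: fun_eq_iff chart_vec_def tadd_def tscale_def)
  then show "\<exists>u v. X = tadd (chart_vec A D c p u) (tscale \<i> (chart_vec A D c p v))"
    unfolding chart_vec_change[OF assms(1,2) D'(1) assms(3) D'(2)] by blast
next
  assume "\<exists>u v. X = tadd (chart_vec A D c p u) (tscale \<i> (chart_vec A D c p v))"
  then obtain u v where "X = tadd (chart_vec A D c p u) (tscale \<i> (chart_vec A D c p v))" by blast
  then have "X = (\<lambda>f. if smooth_near A p f
          then fderiv (f \<circ> inv_into D c) (c p) u
               + \<i> * fderiv (f \<circ> inv_into D c) (c p) v
          else 0)"
    by (auto simp: fun_eq_iff chart_vec_def tadd_def tscale_def)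
  then show "X \<in> complex_tangent A p"
    unfolding complex_tangent_def using assms(2,3) by blast
qed

lemma smooth_near_cnj: "smooth_near A p (\<lambda>q. cnj (f q)) \<longleftrightarrow> smooth_near A p f"
  if "smooth_atlas A" for A :: "('s::topological_space, 'e::euclidean_space) chart set"
proof -
  have *: "smooth_near A p (\<lambda>q. cnj (f q))" if f: "smooth_near A p f" for f
  proof -
    obtain W where W: "open W" "p \<in> W" "mfd_smooth_on A W f" using f by (auto simp: smooth_near_def)
    have "mfd_smooth_on A W (\<lambda>q. cnj (f q))"
      unfolding mfd_smooth_on_def
      using smooth_on_cnj[OF atlas_open_image[OF \<open>smooth_atlas A\<close> _ W(1)] mfd_smooth_onD[OF W(3)]]
      by (auto simp: comp_def)
    then show ?thesis using W by (auto simp: smooth_near_def)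
  qed
  show ?thesis using *[of f] *[of "\<lambda>q. cnj (f q)"] by auto
qed

lemma tcnj_tadd: "tcnj (tadd X Y) = tadd (tcnj X) (tcnj Y)"
  and tcnj_tscale: "tcnj (tscale a X) = tscale (cnj a) (tcnj X)"
  and tcnj_tcnj: "tcnj (tcnj X) = X"
  by (auto simp: tcnj_def tadd_def tscale_def)

lemma tcnj_chart_vec:
  assumes "smooth_atlas A" "(D, c) \<in> A" "p \<in> D"
  shows "tcnj (chart_vec A D c p u) = chart_vec A D c p u"
proof
  fix f
  show "tcnj (chart_vec A D c p u) f = chart_vec A D c p u f"
  proof (cases "smooth_near A p f")
    case True
    have "((f \<circ> inv_into D c) has_derivative fderiv (f \<circ> inv_into D c) (c p)) (at (c p))"
      using smooth_near_differentiable[OF assms True] frechet_derivative_works by blast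
    from frechet_derivative_eqI[OF has_derivative_cnj[OF this]]
    show ?thesis using True by (simp add: tcnj_def chart_vec_def smooth_near_cnj[OF assms(1)] comp_def)
  qed (simp add: tcnj_def chart_vec_def smooth_near_cnj[OF assms(1)])
qed

text \<open>A tangent vector is recovered from its values at the coordinate functions. What they are outside the
  chart domain does not matter, as tangent vectors only see germs.\<close>
definition coord_fun :: "('s \<Rightarrow> 'e::euclidean_space) \<Rightarrow> 'e \<Rightarrow> 's \<Rightarrow> complex" where
  "coord_fun c b = (\<lambda>q. complex_of_real (c q \<bullet> b))"

lemma smooth_near_coord_fun:
  assumes "smooth_atlas A" "(D, c) \<in> A" "p \<in> D"
  shows "smooth_near A p (coord_fun c b)"
proof -
  have bl: "bounded_linear (\<lambda>y. complex_of_real (y \<bullet> b))" for b :: 'b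
    using bounded_linear_compose[OF bounded_linear_of_real bounded_linear_inner_left] .
  have "mfd_smooth_on A D (coord_fun c b)"
    unfolding mfd_smooth_on_def
  proof (clarify)
    fix D' c' assume D': "(D', c') \<in> A"
    show "smooth_on (c' ` (D' \<inter> D)) (coord_fun c b \<circ> inv_into D' c')"
      using smooth_on_linear[OF atlas_open_image[OF assms(1) D' atlas_chart(1)[OF assms(1,2)]] bl
          atlas_transition[OF assms(1) D' assms(2)], of b]
      by (simp add: coord_fun_def comp_def)
  qed
  then show ?thesis using atlas_chart(1)[OF assms(1,2)] assms(3) by (auto simp: smooth_near_def)
qed

lemma chart_vec_coord_fun:
  assumes "smooth_atlas A" "(D, c) \<in> A" "p \<in> D"
  shows "chart_vec A D c p u (coord_fun c b) = complex_of_real (u \<bullet> b)"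
proof -
  note ch = atlas_chart[OF assms(1,2)]
  have bl: "bounded_linear (\<lambda>y. complex_of_real (y \<bullet> b))"
    using bounded_linear_compose[OF bounded_linear_of_real bounded_linear_inner_left] .
  have "((coord_fun c b \<circ> inv_into D c) has_derivative (\<lambda>u. complex_of_real (u \<bullet> b))) (at (c p))"
    by (rule has_derivative_transform_within_open[OF bounded_linear_imp_has_derivative[OF bl] ch(2)])
      (use assms(3) in \<open>auto simp: coord_fun_def f_inv_into_f\<close>)
  then show ?thesis
    using smooth_near_coord_fun[OF assms] by (simp add: chart_vec_def frechet_derivative_eqI)
qed

text \<open>A derivation \<open>\<partial>\<^sub>u + \<i> \<partial>\<^sub>v\<close> is real only if \<open>\<partial>\<^sub>v\<close> vanishes.\<close>
lemma real_tangent_chart: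
  assumes "smooth_atlas A" "(D, c) \<in> A" "p \<in> D"
  shows "X \<in> real_tangent A p \<longleftrightarrow> (\<exists>u. X = chart_vec A D c p u)"
proof
  assume "X \<in> real_tangent A p"
  then obtain u v where X: "X = tadd (chart_vec A D c p u) (tscale \<i> (chart_vec A D c p v))" "tcnj X = X"
    unfolding real_tangent_def using complex_tangent_chart[OF assms] by auto
  have "tadd (chart_vec A D c p u) (tscale (- \<i>) (chart_vec A D c p v)) =
      tadd (chart_vec A D c p u) (tscale \<i> (chart_vec A D c p v))"
    using X(2) unfolding X(1) tcnj_tadd tcnj_tscale tcnj_chart_vec[OF assms] by simp
  then have "chart_vec A D c p v f = 0" for f
    unfolding tadd_def tscale_def fun_eq_iff by simp
  then have "X = chart_vec A D c p u" unfolding X by (simp add: tadd_def tscale_def)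
  then show "\<exists>u. X = chart_vec A D c p u" by blast
next
  assume "\<exists>u. X = chart_vec A D c p u"
  then obtain u where X: "X = chart_vec A D c p u" by blast
  have "X = tadd (chart_vec A D c p u) (tscale \<i> (chart_vec A D c p 0))"
    unfolding X chart_vec_linear(3)[OF assms] by (simp add: tadd_def tscale_def)
  then show "X \<in> real_tangent A p"
    using complex_tangent_chart[OF assms] tcnj_chart_vec[OF assms] X by (auto simp: real_tangent_def)
qed

lemma complex_tangent_linear:
  assumes "smooth_atlas A" "X \<in> complex_tangent A p"
  shows "Y \<in> complex_tangent A p \<Longrightarrow> tadd X Y \<in> complex_tangent A p"
    and "tscale a X \<in> complex_tangent A p" and "tcnj X \<in> complex_tangent A p"
proof -
  obtain D c where D: "(D, c) \<in> A" "p \<in> D" using atlas_cover[OF assms(1)] by blast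
  note ch = complex_tangent_chart[OF assms(1) D] and lin = chart_vec_linear[OF assms(1) D]
  obtain u v where X: "X = tadd (chart_vec A D c p u) (tscale \<i> (chart_vec A D c p v))"
    using ch[THEN iffD1, OF assms(2)] by blast
  show "tadd X Y \<in> complex_tangent A p" if Y_tangent: "Y \<in> complex_tangent A p"
  proof -
    obtain u' v' where Y: "Y = tadd (chart_vec A D c p u') (tscale \<i> (chart_vec A D c p v'))"
      using ch[THEN iffD1, OF Y_tangent] by blast
    have "tadd X Y = tadd (chart_vec A D c p (u + u')) (tscale \<i> (chart_vec A D c p (v + v')))"
      unfolding X Y lin by (auto simp: tadd_def tscale_def algebra_simps)
    then show ?thesis by (subst ch) blast
  qed
  have "tscale a X = tadd (chart_vec A D c p (Re a *\<^sub>R u + (- Im a) *\<^sub>R v)) (tscale \<i> (chart_vec A D c p (Re a *\<^sub>R v + Im a *\<^sub>R u)))"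
    unfolding X lin
    by (auto simp: tadd_def tscale_def fun_eq_iff complex_eq_iff algebra_simps)
  then show "tscale a X \<in> complex_tangent A p" by (subst ch) blast
  have "tcnj X = tadd (chart_vec A D c p u) (tscale \<i> (chart_vec A D c p ((-1) *\<^sub>R v)))"
    unfolding X tcnj_tadd tcnj_tscale tcnj_chart_vec[OF assms(1) D] lin
    by (auto simp: tadd_def tscale_def fun_eq_iff)
  then show "tcnj X \<in> complex_tangent A p" by (subst ch) blast
qed

lemma complex_tangent_const:
  assumes "smooth_atlas A" "X \<in> complex_tangent A p"
  shows "X (\<lambda>q. k) = 0"
proof -
  obtain D c where D: "(D, c) \<in> A" "p \<in> D" using atlas_cover[OF assms(1)] by blast
  have "((\<lambda>q. k) \<circ> inv_into D c) = (\<lambda>y. k)" by auto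
  then have "chart_vec A D c p u (\<lambda>q. k) = 0" for u
    by (simp add: chart_vec_def del: comp_apply)
  then show ?thesis using assms(2) complex_tangent_chart[OF assms(1) D]
    by (auto simp: tadd_def tscale_def)
qed

section \<open>The tangent space of a contact manifold\<close>

locale contact_mfd =
  fixes S :: "('s::topological_space, 'n::finite) contact_data"
  assumes contact: "contact_manifold S"
begin

lemma atlas: "smooth_atlas (charts S)"
  and cr: "cr_structure S" and cf: "contact_form S" and rf: "reeb_field S"
  using contact by (auto simp: contact_manifold_def)

lemma cr_frame: "\<exists>W Z. p \<in> W \<and> local_frame S W Z"
  using conjunct1[OF cr[unfolded cr_structure_def]] by (rule spec)

lemma T10_inter_conjugate: "T10 S p \<inter> tcnj ` T10 S p = {\<lambda>f. 0}"
  using conjunct1[OF conjunct2[OF cr[unfolded cr_structure_def]]] by (rule spec)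

lemma eta_smooth_form: "smooth_form (charts S) UNIV (eta S)"
  using conjunct1[OF cf[unfolded contact_form_def]] .

lemma eta_real_part: "Z \<in> T10 S p \<Longrightarrow> eta S p (tadd Z (tcnj Z)) = 0"
  using conjunct1[OF conjunct2[OF conjunct2[OF conjunct2[OF cf[unfolded contact_form_def]]]]] by simp

lemma eta_reeb: "eta S p (reeb S p) = 1"
  using rf by (simp add: reeb_field_def)

lemma smooth_field_tangent: "smooth_field A W V \<Longrightarrow> p \<in> W \<Longrightarrow> V p \<in> complex_tangent A p"
  by (simp add: smooth_field_def)

lemma reeb_tangent: "reeb S p \<in> real_tangent (charts S) p"
proof -
  have "smooth_field (charts S) UNIV (reeb S)" "tcnj (reeb S p) = reeb S p"
    using rf by (simp_all add: reeb_field_def)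
  then show ?thesis using smooth_field_tangent[of _ UNIV] by (simp add: real_tangent_def)
qed

lemma frame_at:
  obtains Z :: "'n \<Rightarrow> 's tvec" where "\<And>\<alpha>. Z \<alpha> \<in> complex_tangent (charts S) p"
    "bij_betw (\<lambda>a :: complex^'n. (\<lambda>f. \<Sum>\<alpha>\<in>UNIV. a $ \<alpha> * Z \<alpha> f)) UNIV (T10 S p)"
proof -
  obtain W Z where W: "p \<in> W" "local_frame S W Z" using cr_frame by metis
  have "\<forall>\<alpha>. smooth_field (charts S) W (Z \<alpha>)"
    and b: "\<forall>p\<in>W. bij_betw (\<lambda>a :: complex^'n. (\<lambda>f. \<Sum>\<alpha>\<in>UNIV. a $ \<alpha> * Z \<alpha> p f)) UNIV (T10 S p)"
    using W(2) by (simp_all add: local_frame_def)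
  then have "Z \<alpha> p \<in> complex_tangent (charts S) p" for \<alpha>
    using W(1) smooth_field_tangent by metis
  then show ?thesis using that[of "\<lambda>\<alpha>. Z \<alpha> p"] b W(1) by simp
qed

lemma T10_tangent: "Z \<in> T10 S p \<Longrightarrow> Z \<in> complex_tangent (charts S) p"
proof -
  assume Z: "Z \<in> T10 S p"
  obtain F :: "'n \<Rightarrow> 's tvec" where F: "\<And>\<alpha>. F \<alpha> \<in> complex_tangent (charts S) p"
    "bij_betw (\<lambda>a :: complex^'n. (\<lambda>f. \<Sum>\<alpha>\<in>UNIV. a $ \<alpha> * F \<alpha> f)) UNIV (T10 S p)"
    by (rule frame_at[of p]) (rule that)
  obtain D c where D: "(D, c) \<in> charts S" "p \<in> D" using atlas_cover[OF atlas] by blast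
  have zero: "(\<lambda>f. 0) \<in> complex_tangent (charts S) p"
    using complex_tangent_linear(2)[OF atlas F(1), of 0] by (simp add: tscale_def)
  have "(\<lambda>f. \<Sum>\<alpha>\<in>I. a $ \<alpha> * F \<alpha> f) \<in> complex_tangent (charts S) p" if "finite I" for I and a :: "complex^'n"
    using that
  proof (induction I rule: finite_induct)
    case (insert \<alpha> I)
    then have "(\<lambda>f. \<Sum>\<alpha>\<in>insert \<alpha> I. a $ \<alpha> * F \<alpha> f) = tadd (tscale (a $ \<alpha>) (F \<alpha>)) (\<lambda>f. \<Sum>\<alpha>\<in>I. a $ \<alpha> * F \<alpha> f)"
      by (auto simp: tadd_def tscale_def)
    then show ?case using insert complex_tangent_linear[OF atlas] F(1) by auto
  qed (simp add: zero)
  moreover obtain a where "Z = (\<lambda>f. \<Sum>\<alpha>\<in>UNIV. a $ \<alpha> * F \<alpha> f)"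
    using F(2) Z unfolding bij_betw_def by blast
  ultimately show ?thesis by simp
qed

lemma T10_combination:
  assumes "Z \<in> T10 S p" "Z' \<in> T10 S p"
  shows "(\<lambda>f. a * Z f + b * Z' f) \<in> T10 S p"
proof -
  obtain F :: "'n \<Rightarrow> 's tvec" where F:
    "bij_betw (\<lambda>a :: complex^'n. (\<lambda>f. \<Sum>\<alpha>\<in>UNIV. a $ \<alpha> * F \<alpha> f)) UNIV (T10 S p)"
    by (rule frame_at[of p]) (rule that)
  obtain k k' where Z: "Z = (\<lambda>f. \<Sum>\<alpha>\<in>UNIV. k $ \<alpha> * F \<alpha> f)" "Z' = (\<lambda>f. \<Sum>\<alpha>\<in>UNIV. k' $ \<alpha> * F \<alpha> f)"
    using F assms unfolding bij_betw_def by blast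
  have "(\<lambda>f. a * Z f + b * Z' f) = (\<lambda>f. \<Sum>\<alpha>\<in>UNIV. (\<chi> \<alpha>. a * k $ \<alpha> + b * k' $ \<alpha>) $ \<alpha> * F \<alpha> f)"
    unfolding Z by (simp add: sum_distrib_left sum.distrib algebra_simps)
  then show ?thesis using F unfolding bij_betw_def by blast
qed

text \<open>A difference of two solutions lies in the intersection of \<open>T\<^sup>1\<^sup>,\<^sup>0\<close> with its conjugate. This makes the
  definite description in \<open>HS_J\<close> meaningful.\<close>
lemma T10_real_part_inj:
  assumes "Z \<in> T10 S p" "Z' \<in> T10 S p" "tadd Z (tcnj Z) = tadd Z' (tcnj Z')"
  shows "Z = Z'"
proof -
  let ?W = "\<lambda>f. 1 * Z f + (-1) * Z' f" and ?W' = "\<lambda>f. 1 * Z' f + (-1) * Z f"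
  have "?W \<in> T10 S p" "?W' \<in> T10 S p" using T10_combination assms by blast+
  moreover have "?W = tcnj ?W'"
    using assms(3) unfolding fun_eq_iff tadd_def tcnj_def by (simp add: algebra_simps)
  ultimately have "?W \<in> T10 S p \<inter> tcnj ` T10 S p" by blast
  then have "?W = (\<lambda>f. 0)" unfolding T10_inter_conjugate by simp
  then show ?thesis by (simp add: fun_eq_iff)
qed

lemma HS_J_real_part:
  assumes "Z \<in> T10 S p"
  shows "HS_J S p (tadd Z (tcnj Z)) = tadd (tscale \<i> Z) (tcnj (tscale \<i> Z))"
  unfolding HS_J_def using assms T10_real_part_inj by (intro the_equality) auto

lemma eta_linear:
  assumes "X \<in> complex_tangent (charts S) p" "Y \<in> complex_tangent (charts S) p"
  shows "eta S p (tadd X Y) = eta S p X + eta S p Y" "eta S p (tscale a X) = a * eta S p X"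
  using conjunct1[OF eta_smooth_form[unfolded smooth_form_def]] assms by simp_all

lemma eta_decomposition:
  assumes "Z \<in> T10 S p"
  shows "eta S p (tadd (tscale (of_real a) (reeb S p)) (tadd Z (tcnj Z))) = of_real a"
proof -
  have R: "reeb S p \<in> complex_tangent (charts S) p" using reeb_tangent by (auto simp: real_tangent_def)
  have Z: "tadd Z (tcnj Z) \<in> complex_tangent (charts S) p"
    using assms T10_tangent complex_tangent_linear[OF atlas] by blast
  show ?thesis
    using R Z by (simp add: eta_linear complex_tangent_linear(2)[OF atlas R] eta_real_part[OF assms] eta_reeb)
qed

lemma cone_I_decomposition:
  assumes "Z \<in> T10 S (snd x)"
  shows "cone_I S x (b, tadd (tscale (of_real a) (reeb S (snd x))) (tadd Z (tcnj Z))) =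
    (- a, tadd (tadd (tscale \<i> Z) (tcnj (tscale \<i> Z))) (tscale (of_real b) (reeb S (snd x))))"
proof -
  have "tadd (tadd (tscale (of_real a) (reeb S (snd x))) (tadd Z (tcnj Z))) (tscale (- of_real a) (reeb S (snd x)))
      = tadd Z (tcnj Z)"
    by (auto simp: tadd_def tscale_def)
  then show ?thesis
    unfolding cone_I_def using eta_decomposition[OF assms] HS_J_real_part[OF assms] by simp
qed

text \<open>The real tangent space is spanned by the Reeb vector and \<open>HS\<close>: the map \<open>(a, k) \<mapsto> a \<xi> + Z\<^sub>k + cnj Z\<^sub>k\<close>
  goes between real vector spaces of the same dimension \<open>2n + 1\<close>, and it is injective because \<open>\<eta>\<close>
  detects \<open>a\<close> and \<open>T\<^sup>1\<^sup>,\<^sup>0\<close> meets its conjugate trivially.\<close>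
lemma real_tangent_decomposition:
  assumes "X \<in> real_tangent (charts S) p"
  obtains a Z where "Z \<in> T10 S p" "X = tadd (tscale (of_real a) (reeb S p)) (tadd Z (tcnj Z))"
proof -
  obtain D c where D: "(D, c) \<in> charts S" "p \<in> D" using atlas_cover[OF atlas] by blast
  note cvc = chart_vec_coord_fun[OF atlas D] and rt = real_tangent_chart[OF atlas D]
  obtain F :: "'n \<Rightarrow> 's tvec" where
    F: "bij_betw (\<lambda>a :: complex^'n. (\<lambda>f. \<Sum>\<alpha>\<in>UNIV. a $ \<alpha> * F \<alpha> f)) UNIV (T10 S p)"
    by (rule frame_at[of p]) (rule that)
  define Zc where "Zc = (\<lambda>k :: complex^'n. (\<lambda>f. \<Sum>\<alpha>\<in>UNIV. k $ \<alpha> * F \<alpha> f))"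
  have ZT: "Zc k \<in> T10 S p" for k using F unfolding bij_betw_def Zc_def by blast
  define V where "V = (\<lambda>(a :: real, k). tadd (tscale (of_real a) (reeb S p)) (tadd (Zc k) (tcnj (Zc k))))"
  have VR: "V y \<in> real_tangent (charts S) p" for y
  proof -
    obtain a k where y: "y = (a, k)" by (cases y)
    have "V y \<in> complex_tangent (charts S) p"
      unfolding V_def y using T10_tangent[OF ZT] reeb_tangent complex_tangent_linear[OF atlas]
      by (auto simp: real_tangent_def)
    moreover have "tcnj (V y) = V y"
      unfolding V_def y using reeb_tangent[of p]
      by (auto simp: tcnj_tadd tcnj_tscale tcnj_tcnj real_tangent_def) (auto simp: tadd_def)
    ultimately show ?thesis by (simp add: real_tangent_def)
  qed
  \<comment> \<open>chart components of the tangent vector \<open>V y\<close>, read off from the coordinate functions\<close>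
  define L where "L = (\<lambda>y. \<Sum>b\<in>Basis. Re (V y (coord_fun c b)) *\<^sub>R b)"
  have VL: "V y = chart_vec (charts S) D c p (L y)" for y
  proof -
    obtain u where u: "V y = chart_vec (charts S) D c p u" using rt[THEN iffD1, OF VR] by blast
    have "L y = u" unfolding L_def u cvc by (simp add: euclidean_representation)
    then show ?thesis using u by simp
  qed
  have "linear L"
  proof (rule linearI)
    have V1: "V (x + y) f = V x f + V y f" for x y f
      by (auto simp: V_def Zc_def tadd_def tscale_def tcnj_def split_def sum.distrib algebra_simps)
    have V2: "V (r *\<^sub>R y) f = r * V y f" for r y f
      by (auto simp: V_def Zc_def tadd_def tscale_def tcnj_def split_def sum_distrib_left algebra_simps
          scaleR_conv_of_real[where 'a = complex])
    show "L (x + y) = L x + L y" for x y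
      unfolding L_def V1 by (simp add: sum.distrib algebra_simps)
    show "L (r *\<^sub>R y) = r *\<^sub>R L y" for r y
      unfolding L_def V2 by (simp add: scaleR_sum_right)
  qed
  moreover have "inj L"
  proof (rule injI)
    fix y y' assume "L y = L y'"
    then have e: "V y = V y'" using VL by simp
    obtain a k a' k' where y: "y = (a, k)" "y' = (a', k')" by (cases y; cases y')
    have a: "a = a'"
      using e eta_decomposition[OF ZT[of k], of a] eta_decomposition[OF ZT[of k'], of a']
      unfolding V_def y by simp
    have "tadd (Zc k) (tcnj (Zc k)) = tadd (Zc k') (tcnj (Zc k'))"
      using e unfolding V_def y a by (auto simp: tadd_def fun_eq_iff)
    then have "Zc k = Zc k'" by (rule T10_real_part_inj[OF ZT ZT])
    then have "k = k'" using F unfolding bij_betw_def inj_on_def Zc_def by blast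
    then show "y = y'" using a y by simp
  qed
  ultimately have "surj L" by (rule linear_injective_imp_surjective) simp
  obtain u where u: "X = chart_vec (charts S) D c p u" using rt[THEN iffD1, OF assms] by blast
  obtain y where "u = L y" using \<open>surj L\<close> by (rule surjE)
  then have "X = V y" using u VL by simp
  then show ?thesis using that ZT unfolding V_def by (cases y) auto
qed

text \<open>Without this the Cauchy-Riemann equations in \<open>holo_coord\<close> could not be read as equations between
  derivatives of the coordinates.\<close>
lemma cone_I_tangent:
  assumes "v \<in> cone_tangent S x"
  shows "cone_I S x v \<in> cone_tangent S x"
proof -
  obtain b X where v: "v = (b, X)" by (cases v)
  then have "X \<in> real_tangent (charts S) (snd x)" using assms by (auto simp: cone_tangent_def)
  from real_tangent_decomposition[OF this] obtain a Z where
    Z: "Z \<in> T10 S (snd x)" and X: "X = tadd (tscale (of_real a) (reeb S (snd x))) (tadd Z (tcnj Z))" .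
  let ?Y = "tadd (tadd (tscale \<i> Z) (tcnj (tscale \<i> Z))) (tscale (of_real b) (reeb S (snd x)))"
  have "?Y \<in> complex_tangent (charts S) (snd x)"
    using T10_tangent[OF Z] reeb_tangent complex_tangent_linear[OF atlas] by (auto simp: real_tangent_def)
  moreover have "tcnj ?Y = ?Y"
    using reeb_tangent[of "snd x"]
    by (auto simp: tcnj_tadd tcnj_tscale tcnj_tcnj real_tangent_def) (auto simp: tadd_def)
  ultimately show ?thesis
    unfolding v X cone_I_decomposition[OF Z] by (simp add: cone_tangent_def real_tangent_def)
qed

lemma zero_tangent: "(\<lambda>f. 0) \<in> real_tangent (charts S) p"
proof -
  obtain D c where D: "(D, c) \<in> charts S" "p \<in> D" using atlas_cover[OF atlas] by blast
  show ?thesis using real_tangent_chart[OF atlas D] chart_vec_linear(3)[OF atlas D] by metis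
qed

lemma cone_I_radial: "cone_I S x (1, \<lambda>f. 0) = (0, reeb S (snd x))"
proof -
  have "(\<lambda>f. 0) \<in> T10 S (snd x)" using T10_inter_conjugate[of "snd x"] by blast
  from cone_I_decomposition[OF this, of 1 0] show ?thesis
    by (simp add: tadd_def tscale_def tcnj_def)
qed

end

section \<open>Charts of the cone\<close>

definition cchart :: "('s \<Rightarrow> 'e) \<Rightarrow> real \<times> 's \<Rightarrow> real \<times> 'e" where
  "cchart c = (\<lambda>(r, p). (r, c p))"

abbreviation chart_image :: "'s set \<Rightarrow> ('s \<Rightarrow> 'e) \<Rightarrow> (real \<times> 's) set \<Rightarrow> (real \<times> 'e) set" where
  "chart_image D c V \<equiv> cchart c ` (({0<..} \<times> D) \<inter> V)"

definition cchart_inv :: "'s set \<Rightarrow> ('s \<Rightarrow> 'e) \<Rightarrow> real \<times> 'e \<Rightarrow> real \<times> 's" where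
  "cchart_inv D c = inv_into ({0<..} \<times> D) (cchart c)"

lemma smooth_on_Pair_right:
  fixes W :: "'e::euclidean_space set"
  assumes "open W"
  shows "smooth_on W (\<lambda>u. (r :: real, u))"
proof -
  have "smooth_on W (\<lambda>u :: 'e. (r, 0 :: 'e) + (0, u))"
    by (intro smooth_on_add smooth_on_const smooth_on_bounded_linear assms)
      (auto intro!: bounded_linear_Pair bounded_linear_zero bounded_linear_ident)
  then show ?thesis by simp
qed

context contact_mfd
begin

abbreviation "cone_smooth V f \<equiv> mfd_smooth_on (cone_charts S) V f"

lemma cone_charts_iff: "K \<in> cone_charts S \<longleftrightarrow> (\<exists>D c. (D, c) \<in> charts S \<and> K = ({0<..} \<times> D, cchart c))"
  unfolding cone_charts_def cchart_def image_iff Bex_def split_paired_Ex by simp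

lemma cchart_inj: "(D, c) \<in> charts S \<Longrightarrow> inj_on (cchart c) ({0<..} \<times> D)"
  using atlas_chart(3)[OF atlas, of D c] by (auto simp: inj_on_def cchart_def)

lemma cchart_inv_cchart: "(D, c) \<in> charts S \<Longrightarrow> x \<in> {0<..} \<times> D \<Longrightarrow> cchart_inv D c (cchart c x) = x"
  unfolding cchart_inv_def using inv_into_f_f[OF cchart_inj] by blast

lemma cchart_inv_eq: "(D, c) \<in> charts S \<Longrightarrow> r > 0 \<Longrightarrow> u \<in> c ` D \<Longrightarrow> cchart_inv D c (r, u) = (r, inv_into D c u)"
proof -
  assume a: "(D, c) \<in> charts S" "r > 0" "u \<in> c ` D"
  have "cchart c (r, inv_into D c u) = (r, u)" using a(3) by (simp add: cchart_def f_inv_into_f)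
  then show ?thesis
    using cchart_inv_cchart[OF a(1), of "(r, inv_into D c u)"] a by (simp add: inv_into_into)
qed

lemma cchart_image_open:
  assumes "(D, c) \<in> charts S" "open V"
  shows "open (chart_image D c V)"
proof -
  note ch = atlas_chart[OF atlas assms(1)]
  let ?g = "\<lambda>(r :: real, u). (r, inv_into D c u)"
  have cg: "continuous_on ({0::real<..} \<times> c ` D) ?g"
    unfolding split_def
    by (intro continuous_intros continuous_on_compose2[OF homeomorphism_cont2[OF ch(4)]]) auto
  have "open ({0::real<..} \<times> c ` D)" using ch(2) by (intro open_Times) auto
  then have "open (({0<..} \<times> c ` D) \<inter> ?g -` V)"
    using continuous_open_preimage[OF cg] assms(2) by blast
  moreover have "chart_image D c V = ({0<..} \<times> c ` D) \<inter> ?g -` V"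
  proof (intro set_eqI iffI)
    fix y assume "y \<in> chart_image D c V"
    then show "y \<in> ({0<..} \<times> c ` D) \<inter> ?g -` V"
      using ch(3) by (auto simp: cchart_def)
  next
    fix y assume y: "y \<in> ({0<..} \<times> c ` D) \<inter> ?g -` V"
    then obtain r q where "y = (r, c q)" "r > 0" "q \<in> D" by auto
    then show "y \<in> chart_image D c V"
      using y ch(3) by (auto simp: cchart_def intro!: image_eqI[where x = "(r, q)"])
  qed
  ultimately show ?thesis by simp
qed

lemma cone_smoothD:
  assumes "cone_smooth V f" "(D, c) \<in> charts S"
  shows "smooth_on (chart_image D c V) (f \<circ> cchart_inv D c)"
  unfolding cchart_inv_def
  by (rule mfd_smooth_onD[OF assms(1)]) (use assms(2) cone_charts_iff in blast)

lemma cone_smoothI: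
  assumes "\<And>D c. (D, c) \<in> charts S \<Longrightarrow> smooth_on (chart_image D c V) (f \<circ> cchart_inv D c)"
  shows "cone_smooth V f"
  unfolding mfd_smooth_on_def
proof (clarify)
  fix E C assume "(E, C) \<in> cone_charts S"
  then obtain D c where "(D, c) \<in> charts S" "E = {0<..} \<times> D" "C = cchart c"
    using cone_charts_iff by auto
  then show "smooth_on (C ` (E \<inter> V)) (f \<circ> inv_into E C)"
    using assms unfolding cchart_inv_def by simp
qed

lemma open_radial_slice: "open V \<Longrightarrow> open {s. (s, p) \<in> V}"
  for V :: "(real \<times> 's) set"
  using open_vimage[of V "\<lambda>s. (s, p)"] by (simp add: continuous_on_Pair vimage_def)

lemma smooth_near_slice:
  assumes "open V" "V \<subseteq> cone" "cone_smooth V f" "(r, p) \<in> V"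
  shows "smooth_near (charts S) p (\<lambda>q. f (r, q))"
proof -
  define W where "W = {q. (r, q) \<in> V}"
  have W: "open W"
  proof -
    have "W = Pair r -` V" by (auto simp: W_def)
    then show ?thesis using open_vimage[OF assms(1), of "Pair r"] by (simp add: continuous_on_Pair)
  qed
  have r: "r > 0" using assms(2,4) by (auto simp: cone_def)
  have "mfd_smooth_on (charts S) W (\<lambda>q. f (r, q))"
    unfolding mfd_smooth_on_def
  proof (clarify)
    fix D c assume D: "(D, c) \<in> charts S"
    have o: "open (c ` (D \<inter> W))" by (rule atlas_open_image[OF atlas D W])
    have "smooth_on (c ` (D \<inter> W)) (\<lambda>u. (f \<circ> cchart_inv D c) (r, u))"
    proof (rule smooth_on_compose[OF o cchart_image_open[OF D assms(1)] smooth_on_Pair_right[OF o] cone_smoothD[OF assms(3) D]])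
      show "Pair r ` c ` (D \<inter> W) \<subseteq> chart_image D c V"
      proof (rule image_subsetI)
        fix u assume "u \<in> c ` (D \<inter> W)"
        then obtain q where "q \<in> D" "q \<in> W" "u = c q" by blast
        then show "(r, u) \<in> chart_image D c V"
          using r by (intro image_eqI[where x = "(r, q)"]) (auto simp: W_def cchart_def)
      qed
    qed
    then show "smooth_on (c ` (D \<inter> W)) ((\<lambda>q. f (r, q)) \<circ> inv_into D c)"
    proof (rule smooth_on_eq[OF _ o])
      fix u assume "u \<in> c ` (D \<inter> W)"
      then show "(f \<circ> cchart_inv D c) (r, u) = ((\<lambda>q. f (r, q)) \<circ> inv_into D c) u"
        using cchart_inv_eq[OF D r, of u] by auto
    qed
  qed
  then show ?thesis using W assms(4) unfolding smooth_near_def by (auto simp: W_def)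
qed

text \<open>A tangent vector \<open>b r\<partial>\<^sub>r + \<partial>\<^sub>u\<close> is represented by \<open>(b r, u)\<close> in a chart of the cone.\<close>
lemma cone_deriv_chart:
  fixes f :: "real \<times> 's \<Rightarrow> complex"
  assumes "open V" "V \<subseteq> cone" "cone_smooth V f" "(r, p) \<in> V"
    and D: "(D, c) \<in> charts S" "p \<in> D"
  shows "cone_deriv (r, p) (b, chart_vec (charts S) D c p u) f =
    fderiv (f \<circ> cchart_inv D c) (r, c p) (b * r, u)"
proof -
  let ?G = "f \<circ> cchart_inv D c"
  let ?D = "fderiv ?G (r, c p)"
  note ch = atlas_chart[OF atlas D(1)]
  have r: "r > 0" using assms(2,4) by (auto simp: cone_def)
  have cp: "c p \<in> c ` D" using D by auto
  have rp: "(r, c p) \<in> chart_image D c V"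
    using assms(4) D r by (intro image_eqI[where x = "(r, p)"]) (auto simp: cchart_def)
  have G: "(?G has_derivative ?D) (at (r, c p))"
    by (rule smooth_on_has_derivative[OF cone_smoothD[OF assms(3) D(1)] rp])
  have l: "linear ?D" using G by (rule has_derivative_linear)
  have "((\<lambda>t. (t, c p)) has_derivative (\<lambda>h. (h, 0))) (at r)"
    by (auto intro!: derivative_eq_intros)
  from has_derivative_compose[OF this G]
  have "((\<lambda>t. ?G (t, c p)) has_derivative (\<lambda>h. ?D (h, 0))) (at r)" .
  then have "((\<lambda>t. ?G (t, c p)) has_vector_derivative ?D (1, 0)) (at r)"
    unfolding has_vector_derivative_def
    by (rule has_derivative_eq_rhs) (rule ext, subst linear_scale[OF l, symmetric], simp)
  then have "((\<lambda>t. f (t, p)) has_vector_derivative ?D (1, 0)) (at r)"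
    by (rule has_vector_derivative_transform_within_open[where S = "{0<..}"])
      (use r cchart_inv_eq[OF D(1) _ cp] ch(3) D in auto)
  then have 1: "vector_derivative (\<lambda>t. f (t, p)) (at r) = ?D (1, 0)"
    by (rule vector_derivative_at)
  have "((\<lambda>u. (r, u)) has_derivative (\<lambda>u. (0, u))) (at (c p))"
    by (auto intro!: derivative_eq_intros)
  from has_derivative_compose[OF this G]
  have "((\<lambda>u. ?G (r, u)) has_derivative (\<lambda>u. ?D (0, u))) (at (c p))" .
  then have "(((\<lambda>q. f (r, q)) \<circ> inv_into D c) has_derivative (\<lambda>u. ?D (0, u))) (at (c p))"
    by (rule has_derivative_transform_within_open[OF _ ch(2) cp]) (use cchart_inv_eq[OF D(1) r] in auto)
  then have 2: "chart_vec (charts S) D c p u (\<lambda>q. f (r, q)) = ?D (0, u)"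
    using smooth_near_slice[OF assms(1-4)] by (simp add: chart_vec_def frechet_derivative_eqI)
  have "?D (b * r, u) = ?D ((b * r) *\<^sub>R (1, 0) + (0, u))" by simp
  also have "\<dots> = (b * r) *\<^sub>R ?D (1, 0) + ?D (0, u)"
    using linear_add[OF l] linear_scale[OF l] by metis
  finally show ?thesis unfolding cone_deriv_def using 1 2 by (simp add: scaleR_conv_of_real)
qed

lemma cone_tangent_chart:
  assumes "v \<in> cone_tangent S x" "(D, c) \<in> charts S" "snd x \<in> D"
  obtains b u where "v = (b, chart_vec (charts S) D c (snd x) u)"
proof -
  have "snd v \<in> real_tangent (charts S) (snd x)" using assms(1) by (auto simp: cone_tangent_def)
  then obtain u where "snd v = chart_vec (charts S) D c (snd x) u"
    using real_tangent_chart[OF atlas assms(2,3), THEN iffD1] by blast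
  then show ?thesis using that[of "fst v" u] by (metis prod.collapse)
qed

section \<open>Holomorphic coordinates of the cone\<close>

text \<open>The differential \<open>dz\<close> at \<open>x\<close>.\<close>
definition coord_diff :: "(real \<times> 's \<Rightarrow> complex^'k) \<Rightarrow> real \<times> 's \<Rightarrow> real \<times> 's tvec \<Rightarrow> complex^('k::finite)" where
  "coord_diff z x v = (\<chi> a. cone_deriv x v (\<lambda>y. z y $ a))"

lemma holo_coordD:
  assumes "holo_coord S U z"
  shows "open U" "U \<subseteq> cone" "inj_on z U" "open (z ` U)" "cone_smooth U z"
    "(D, c) \<in> charts S \<Longrightarrow> smooth_on (z ` (U \<inter> ({0<..} \<times> D))) (cchart c \<circ> inv_into U z)"
    "x \<in> U \<Longrightarrow> v \<in> cone_tangent S x \<Longrightarrow> coord_diff z x (cone_I S x v) = times_i (coord_diff z x v)"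
proof -
  note h = assms[unfolded holo_coord_def]
  show "open U" "U \<subseteq> cone" "inj_on z U" "open (z ` U)" "cone_smooth U z"
    using h by simp_all
  show "smooth_on (z ` (U \<inter> ({0<..} \<times> D))) (cchart c \<circ> inv_into U z)" if "(D, c) \<in> charts S"
  proof -
    have "\<forall>K\<in>cone_charts S. case K of (E, C) \<Rightarrow> smooth_on (z ` (U \<inter> E)) (C \<circ> inv_into U z)" using h by simp
    moreover have "({0<..} \<times> D, cchart c) \<in> cone_charts S" using that cone_charts_iff by blast
    ultimately show ?thesis by fastforce
  qed
  show "coord_diff z x (cone_I S x v) = times_i (coord_diff z x v)" if "x \<in> U" "v \<in> cone_tangent S x"
    using h that by (simp add: coord_diff_def times_i_def vec_eq_iff)
qed

lemma mfd_smooth_component: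
  fixes f :: "real \<times> 's \<Rightarrow> complex^'k::finite"
  assumes "open V" "cone_smooth V f"
  shows "cone_smooth V (\<lambda>y. f y $ a)"
proof (rule cone_smoothI)
  fix D c assume D: "(D, c) \<in> charts S"
  show "smooth_on (chart_image D c V) ((\<lambda>y. f y $ a) \<circ> cchart_inv D c)"
    using smooth_on_linear[OF cchart_image_open[OF D assms(1)] bounded_linear_vec_nth cone_smoothD[OF assms(2) D]]
    by (simp add: comp_def)
qed

lemma cone_point_chart:
  assumes "x \<in> cone"
  obtains D c where "(D, c) \<in> charts S" "x \<in> {0<..} \<times> D" "snd x \<in> D"
proof -
  obtain D c where "(D, c) \<in> charts S" "snd x \<in> D" using atlas_cover[OF atlas] by blast
  then show ?thesis using that assms by (auto simp: cone_def)
qed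

text \<open>Coordinates are injective and continuous between spaces of the same dimension, so invariance of domain
  applies.\<close>
lemma holo_coord_open_chart_image:
  assumes "holo_coord S U z" "open V" "V \<subseteq> U" "(D, c) \<in> charts S"
  shows "open (z ` (({0<..} \<times> D) \<inter> V))"
proof -
  note h = holo_coordD[OF assms(1)]
  let ?P = "({0<..} \<times> D) \<inter> V"
  have im: "(z \<circ> cchart_inv D c) ` (cchart c ` ?P) = z ` ?P"
    using cchart_inv_cchart[OF assms(4)] by (auto simp: image_iff) (metis IntI SigmaI greaterThan_iff)+
  have "open ((z \<circ> cchart_inv D c) ` (cchart c ` ?P))"
  proof (rule invariance_of_domain_gen[OF cchart_image_open[OF assms(4,2)]])
    show "continuous_on (cchart c ` ?P) (z \<circ> cchart_inv D c)"
      by (rule smooth_on_continuous_on[OF cone_smoothD[OF mfd_smooth_on_subset[OF h(5) assms(3)] assms(4)]])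
    show "inj_on (z \<circ> cchart_inv D c) (cchart c ` ?P)"
    proof (rule inj_onI)
      fix y y' assume "y \<in> cchart c ` ?P" "y' \<in> cchart c ` ?P"
        and e: "(z \<circ> cchart_inv D c) y = (z \<circ> cchart_inv D c) y'"
      then obtain x x' where x: "x \<in> ?P" "y = cchart c x" "x' \<in> ?P" "y' = cchart c x'" by blast
      then have "z x = z x'" using e cchart_inv_cchart[OF assms(4)] by simp
      then have "x = x'" using h(3) x assms(3) unfolding inj_on_def by blast
      then show "y = y'" using x by simp
    qed
  qed simp
  then show ?thesis unfolding im .
qed

lemma holo_coord_open_image:
  assumes "holo_coord S U z" "open V" "V \<subseteq> U"
  shows "open (z ` V)"
proof (rule openI)
  fix w assume "w \<in> z ` V"
  then obtain x where x: "x \<in> V" "w = z x" by blast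
  then have "x \<in> cone" using assms(3) holo_coordD(2)[OF assms(1)] by blast
  then obtain D c where D: "(D, c) \<in> charts S" "x \<in> {0<..} \<times> D" by (rule cone_point_chart)
  have "open (z ` (({0<..} \<times> D) \<inter> V))" by (rule holo_coord_open_chart_image[OF assms D(1)])
  moreover have "w \<in> z ` (({0<..} \<times> D) \<inter> V)" using x D by blast
  ultimately obtain e where "e > 0" "ball w e \<subseteq> z ` (({0<..} \<times> D) \<inter> V)" using openE by blast
  then show "\<exists>e>0. ball w e \<subseteq> z ` V" by blast
qed

lemma smooth_in_coord:
  assumes "holo_coord S U z" "open V" "V \<subseteq> U" "cone_smooth V f"
  shows "smooth_on (z ` V) (f \<circ> inv_into U z)"
proof (rule smooth_on_local)
  note h = holo_coordD[OF assms(1)]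
  fix w assume "w \<in> z ` V"
  then obtain x where x: "x \<in> V" "w = z x" by blast
  then have "x \<in> cone" using assms(3) h(2) by blast
  then obtain D c where D: "(D, c) \<in> charts S" "x \<in> {0<..} \<times> D" by (rule cone_point_chart)
  let ?P = "({0<..} \<times> D) \<inter> V"
  have o: "open (z ` ?P)" by (rule holo_coord_open_chart_image[OF assms(1-3) D(1)])
  have inv: "inv_into U z (z y) = y" if "y \<in> V" for y
    by (rule inv_into_f_f[OF h(3)]) (use that assms(3) in blast)
  have s1: "smooth_on (z ` ?P) (cchart c \<circ> inv_into U z)"
    by (rule smooth_on_subset[OF h(6)[OF D(1)]]) (use assms(3) in blast)
  have "smooth_on (z ` ?P) (\<lambda>w. (f \<circ> cchart_inv D c) ((cchart c \<circ> inv_into U z) w))"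
    by (rule smooth_on_compose[OF o cchart_image_open[OF D(1) assms(2)] s1 cone_smoothD[OF assms(4) D(1)]])
      (auto simp: inv)
  then have "smooth_on (z ` ?P) (f \<circ> inv_into U z)"
    by (rule smooth_on_eq[OF _ o]) (use inv cchart_inv_cchart[OF D(1)] in auto)
  then show "\<exists>T. open T \<and> w \<in> T \<and> smooth_on T (f \<circ> inv_into U z)"
    using o x D by blast
qed

lemma chart_point:
  assumes "(D, c) \<in> charts S" "x \<in> {0<..} \<times> D" "x \<in> V"
  shows "cchart c x \<in> chart_image D c V"
  using assms by blast

lemma coord_diff_chart:
  assumes "holo_coord S U z" "(r, p) \<in> U" "(D, c) \<in> charts S" "p \<in> D"
  shows "coord_diff z (r, p) (b, chart_vec (charts S) D c p u) =
    fderiv (z \<circ> cchart_inv D c) (r, c p) (b * r, u)"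
proof -
  note h = holo_coordD[OF assms(1)]
  have r: "r > 0" using h(2) assms(2) by (auto simp: cone_def)
  have "(r, c p) \<in> chart_image D c U"
    using assms r by (intro image_eqI[where x = "(r, p)"]) (auto simp: cchart_def)
  then have d: "(z \<circ> cchart_inv D c) differentiable (at (r, c p))"
    by (rule smooth_on_differentiable[OF cone_smoothD[OF h(5) assms(3)]])
  show ?thesis
    unfolding vec_eq_iff coord_diff_def
    using cone_deriv_chart[OF h(1,2) mfd_smooth_component[OF h(1,5)] assms(2-4)]
      frechet_derivative_component[OF d] by (simp add: comp_def)
qed

lemma cone_deriv_coord:
  fixes f :: "real \<times> 's \<Rightarrow> complex"
  assumes "holo_coord S U z" "open V" "V \<subseteq> U" "cone_smooth V f"
    and x: "x \<in> V" and v: "v \<in> cone_tangent S x"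
  shows "cone_deriv x v f = fderiv (f \<circ> inv_into U z) (z x) (coord_diff z x v)"
proof -
  note h = holo_coordD[OF assms(1)]
  have xc: "x \<in> cone" using x assms(3) h(2) by blast
  then obtain D c where D: "(D, c) \<in> charts S" "x \<in> {0<..} \<times> D" "snd x \<in> D" by (rule cone_point_chart)
  obtain r p where rp: "x = (r, p)" by (cases x)
  obtain b u where bu: "v = (b, chart_vec (charts S) D c p u)"
    using cone_tangent_chart[OF v D(1,3)] rp by auto
  let ?P = "({0<..} \<times> D) \<inter> V"
  have inv: "inv_into U z (z y) = y" if "y \<in> V" for y
    by (rule inv_into_f_f[OF h(3)]) (use that assms(3) in blast)
  have cx: "cchart c x = (r, c p)" by (simp add: rp cchart_def)
  have m: "(r, c p) \<in> cchart c ` ?P" using chart_point[OF D(1,2) x] by (simp add: cx)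
  have ix: "cchart_inv D c (r, c p) = x" using cchart_inv_cchart[OF D(1,2)] by (simp add: cx)
  have dz: "((z \<circ> cchart_inv D c) has_derivative fderiv (z \<circ> cchart_inv D c) (r, c p)) (at (r, c p))"
    by (rule smooth_on_has_derivative[OF cone_smoothD[OF mfd_smooth_on_subset[OF h(5) assms(3)] D(1)] m])
  have df: "((f \<circ> inv_into U z) has_derivative fderiv (f \<circ> inv_into U z) (z x)) (at ((z \<circ> cchart_inv D c) (r, c p)))"
    using smooth_on_has_derivative[OF smooth_in_coord[OF assms(1-4)], of "z x"] x by (simp add: ix)
  have "((\<lambda>y. (f \<circ> inv_into U z) ((z \<circ> cchart_inv D c) y)) has_derivative
     (\<lambda>y. fderiv (f \<circ> inv_into U z) (z x) (fderiv (z \<circ> cchart_inv D c) (r, c p) y))) (at (r, c p))"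
    by (rule has_derivative_compose[OF dz df])
  then have "((f \<circ> cchart_inv D c) has_derivative
     (\<lambda>y. fderiv (f \<circ> inv_into U z) (z x) (fderiv (z \<circ> cchart_inv D c) (r, c p) y))) (at (r, c p))"
    by (rule has_derivative_transform_within_open[OF _ cchart_image_open[OF D(1) assms(2)] m])
      (use inv cchart_inv_cchart[OF D(1)] in auto)
  note fd = frechet_derivative_eqI[OF this]
  have "x \<in> U" using x assms(3) by blast
  then have "coord_diff z x v = fderiv (z \<circ> cchart_inv D c) (r, c p) (b * r, u)"
    using coord_diff_chart[OF assms(1) _ D(1)] D(3) unfolding rp bu by simp
  moreover have "cone_deriv x v f = fderiv (f \<circ> cchart_inv D c) (r, c p) (b * r, u)"
    using cone_deriv_chart[OF assms(2) subset_trans[OF assms(3) h(2)] assms(4) _ D(1)] D(3) x unfolding rp bu by simp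
  ultimately show ?thesis by (simp add: fd)
qed

text \<open>The coordinate change to a chart of the cone is a diffeomorphism, so \<open>dz\<close> is onto.\<close>
lemma coord_diff_surj:
  assumes "holo_coord S U z" "x \<in> U"
  obtains v where "v \<in> cone_tangent S x" "coord_diff z x v = \<xi>"
proof -
  note h = holo_coordD[OF assms(1)]
  have xc: "x \<in> cone" using assms(2) h(2) by blast
  then obtain D c where D: "(D, c) \<in> charts S" "x \<in> {0<..} \<times> D" "snd x \<in> D" by (rule cone_point_chart)
  obtain r p where rp: "x = (r, p)" by (cases x)
  have r: "r > 0" using D(2) rp by auto
  have cx: "cchart c x = (r, c p)" by (simp add: rp cchart_def)
  have m: "(r, c p) \<in> chart_image D c U" using chart_point[OF D(1,2) assms(2)] by (simp add: cx)
  have ix: "cchart_inv D c (r, c p) = x" using cchart_inv_cchart[OF D(1,2)] by (simp add: cx)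
  let ?P = "U \<inter> ({0<..} \<times> D)"
  have o: "open (z ` ?P)" using holo_coord_open_chart_image[OF assms(1) h(1) subset_refl D(1)] by (simp add: Int_commute)
  have zx: "z x \<in> z ` ?P" using D assms(2) by blast
  have inv: "inv_into U z (z y) = y" if "y \<in> U" for y
    by (rule inv_into_f_f[OF h(3) that])
  have d1: "((cchart c \<circ> inv_into U z) has_derivative fderiv (cchart c \<circ> inv_into U z) (z x)) (at (z x))"
    by (rule smooth_on_has_derivative[OF h(6)[OF D(1)] zx])
  have d2: "((z \<circ> cchart_inv D c) has_derivative fderiv (z \<circ> cchart_inv D c) (r, c p)) (at ((cchart c \<circ> inv_into U z) (z x)))"
    using smooth_on_has_derivative[OF cone_smoothD[OF h(5) D(1)] m] assms(2) by (simp add: inv cx)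
  have "((\<lambda>y. (z \<circ> cchart_inv D c) ((cchart c \<circ> inv_into U z) y)) has_derivative
     (\<lambda>y. fderiv (z \<circ> cchart_inv D c) (r, c p) (fderiv (cchart c \<circ> inv_into U z) (z x) y))) (at (z x))"
    by (rule has_derivative_compose[OF d1 d2])
  then have "((\<lambda>y. y) has_derivative
     (\<lambda>y. fderiv (z \<circ> cchart_inv D c) (r, c p) (fderiv (cchart c \<circ> inv_into U z) (z x) y))) (at (z x))"
    by (rule has_derivative_transform_within_open[OF _ o zx])
      (use inv cchart_inv_cchart[OF D(1)] in auto)
  from has_derivative_unique[OF has_derivative_ident this]
  have e: "fderiv (z \<circ> cchart_inv D c) (r, c p) (fderiv (cchart c \<circ> inv_into U z) (z x) \<xi>) = \<xi>"
    by metis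
  obtain \<beta> u where bu: "fderiv (cchart c \<circ> inv_into U z) (z x) \<xi> = (\<beta>, u)" by (metis surj_pair)
  let ?v = "(\<beta> / r, chart_vec (charts S) D c p u)"
  have "p \<in> D" using D(3) rp by simp
  then have "chart_vec (charts S) D c p u \<in> real_tangent (charts S) p"
    using real_tangent_chart[OF atlas D(1)] by blast
  then have "?v \<in> cone_tangent S x" by (simp add: cone_tangent_def rp)
  moreover have "coord_diff z x ?v = \<xi>"
    using coord_diff_chart[OF assms(1) _ D(1)] D(3) assms(2) r e bu unfolding rp by simp
  ultimately show ?thesis using that by blast
qed

text \<open>Since \<open>dz\<close> is onto and intertwines the complex structure with multiplication by \<open>\<i>\<close>, the
  Cauchy-Riemann equations on tangent vectors of the cone are those in the coordinates.\<close>
lemma CR_function_holo_on: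
  fixes f :: "real \<times> 's \<Rightarrow> complex"
  assumes "holo_coord S U z" "open V" "V \<subseteq> U" "cone_smooth V f"
    and I: "\<And>x v. x \<in> V \<Longrightarrow> v \<in> cone_tangent S x \<Longrightarrow> cone_deriv x (cone_I S x v) f = \<i> * cone_deriv x v f"
  shows "holo_on (z ` V) (f \<circ> inv_into U z)"
  unfolding holo_on_def
proof (intro conjI ballI allI)
  show "smooth_on (z ` V) (f \<circ> inv_into U z)" by (rule smooth_in_coord[OF assms(1-4)])
  fix w a assume "w \<in> z ` V"
  then obtain x where x: "x \<in> V" "w = z x" by blast
  then have xU: "x \<in> U" using assms(3) by blast
  obtain v where v: "v \<in> cone_tangent S x" "coord_diff z x v = axis a 1" by (rule coord_diff_surj[OF assms(1) xU])
  show "wirt_bar a (f \<circ> inv_into U z) w = 0"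
  proof (rule wirt_bar_eq_0I)
    show "fderiv (f \<circ> inv_into U z) w (times_i (axis a 1)) =
        \<i> * fderiv (f \<circ> inv_into U z) w (axis a 1)"
      using I[OF x(1) v(1)] unfolding cone_deriv_coord[OF assms(1-4) x(1) v(1)]
        cone_deriv_coord[OF assms(1-4) x(1) cone_I_tangent[OF v(1)]]
        holo_coordD(7)[OF assms(1) xU v(1)] v(2) x(2) .
  qed
qed

lemma transition_holo_on:
  assumes "holo_coord S U z" "holo_coord S U' z'"
  shows "holo_on (z ` (U \<inter> U')) (\<lambda>w. z' (inv_into U z w) $ a)"
proof -
  note h = holo_coordD[OF assms(1)] and h' = holo_coordD[OF assms(2)]
  have "holo_on (z ` (U \<inter> U')) ((\<lambda>y. z' y $ a) \<circ> inv_into U z)"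
  proof (rule CR_function_holo_on[OF assms(1)])
    show "cone_smooth (U \<inter> U') (\<lambda>y. z' y $ a)"
      by (rule mfd_smooth_on_subset[OF mfd_smooth_component[OF h'(1,5)]]) auto
    fix x v assume "x \<in> U \<inter> U'" "v \<in> cone_tangent S x"
    then have "coord_diff z' x (cone_I S x v) = times_i (coord_diff z' x v)" using h'(7) by blast
    then show "cone_deriv x (cone_I S x v) (\<lambda>y. z' y $ a) = \<i> * cone_deriv x v (\<lambda>y. z' y $ a)"
      unfolding coord_diff_def times_i_def vec_eq_iff by simp
  qed (use h h' in auto)
  then show ?thesis by (simp add: comp_def)
qed

section \<open>The radial vector field\<close>

text \<open>The derivative along \<open>r\<partial>\<^sub>r\<close>, the tangent vector that \<open>cone_deriv\<close> encodes as \<open>(1, 0)\<close>.\<close>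
definition radial :: "(real \<times> 's \<Rightarrow> complex) \<Rightarrow> real \<times> 's \<Rightarrow> complex" where
  "radial g x = cone_deriv x (1, \<lambda>f. 0) g"

lemma smooth_on_fst_mult:
  fixes g :: "real \<times> 'e::euclidean_space \<Rightarrow> complex"
  assumes "open W" "smooth_on W g"
  shows "smooth_on W (\<lambda>y. of_real (fst y) * g y)"
  by (intro smooth_on_mult assms smooth_on_bounded_linear
      bounded_linear_compose[OF bounded_linear_of_real bounded_linear_fst])

lemma radial_chart:
  assumes "open V" "V \<subseteq> cone" "cone_smooth V g" "(D, c) \<in> charts S"
    and y: "y \<in> chart_image D c V"
  shows "(radial g \<circ> cchart_inv D c) y = of_real (fst y) * fderiv (g \<circ> cchart_inv D c) y (1, 0)"
proof -
  obtain r p where rp: "(r, p) \<in> V" "p \<in> D" "r > 0" "y = (r, c p)" using y by (auto simp: cchart_def)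
  have y': "cchart_inv D c y = (r, p)"
    using cchart_inv_cchart[OF assms(4), of "(r, p)"] rp by (simp add: cchart_def)
  have "linear (fderiv (g \<circ> cchart_inv D c) y)"
    using smooth_on_has_derivative[OF cone_smoothD[OF assms(3,4)] y] has_derivative_linear by blast
  from linear_scale[OF this, of r "(1, 0)"]
  have "fderiv (g \<circ> cchart_inv D c) y (r, 0) = of_real r * fderiv (g \<circ> cchart_inv D c) y (1, 0)"
    by (simp add: scaleR_conv_of_real)
  moreover have "radial g (r, p) = fderiv (g \<circ> cchart_inv D c) y (r, 0)"
    using cone_deriv_chart[OF assms(1-3) rp(1) assms(4) rp(2), of 1 0]
    by (simp add: radial_def chart_vec_linear(3)[OF atlas assms(4) rp(2)] rp(4))
  ultimately show ?thesis by (simp add: y'[unfolded rp(4)] rp(4))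
qed

lemma radial_smooth:
  assumes "open V" "V \<subseteq> cone" "cone_smooth V g"
  shows "cone_smooth V (radial g)"
proof (rule cone_smoothI)
  fix D c assume D: "(D, c) \<in> charts S"
  have o: "open (chart_image D c V)" by (rule cchart_image_open[OF D assms(1)])
  have "smooth_on (chart_image D c V)
      (\<lambda>y. of_real (fst y) * fderiv (g \<circ> cchart_inv D c) y (1, 0))"
    by (rule smooth_on_fst_mult[OF o smooth_on_derivative[OF cone_smoothD[OF assms(3) D]]])
  then show "smooth_on (chart_image D c V) (radial g \<circ> cchart_inv D c)"
    by (rule smooth_on_eq[OF _ o]) (simp only: radial_chart[OF assms D])
qed

text \<open>The vector field that extends \<open>(b, X)\<close> with constant components commutes with \<open>r\<partial>\<^sub>r\<close>. In a chart both sides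
  are second derivatives plus the same first order term, which comes from the factor \<open>r\<close>.\<close>
lemma cone_deriv_radial:
  assumes "open V" "V \<subseteq> cone" "cone_smooth V g" "(r, p) \<in> V"
    and X: "X \<in> real_tangent (charts S) p"
  shows "((\<lambda>s. of_real r * cone_deriv (s, p) (b, X) g) has_vector_derivative cone_deriv (r, p) (b, X) (radial g)) (at r)"
proof -
  obtain D c where D: "(D, c) \<in> charts S" "p \<in> D" using atlas_cover[OF atlas] by blast
  obtain u where u: "X = chart_vec (charts S) D c p u"
    using real_tangent_chart[OF atlas D, THEN iffD1, OF X] by blast
  let ?P = "chart_image D c V"
  define G where "G = g \<circ> cchart_inv D c"
  define DG where "DG = (\<lambda>a y. fderiv G y a)"
  have o: "open ?P" by (rule cchart_image_open[OF D(1) assms(1)])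
  have sG: "smooth_on ?P G" unfolding G_def by (rule cone_smoothD[OF assms(3) D(1)])
  have r: "r > 0" using assms(2,4) by (auto simp: cone_def)
  have y: "(r, c p) \<in> ?P"
    using assms(4) D r by (intro image_eqI[where x = "(r, p)"]) (auto simp: cchart_def)
  have dDG: "(DG a has_derivative fderiv (DG a) (r, c p)) (at (r, c p))" for a
    unfolding DG_def by (rule smooth_on_has_derivative[OF smooth_on_derivative[OF sG] y])
  have sym: "fderiv (DG a) (r, c p) a' = fderiv (DG a') (r, c p) a" for a a'
    unfolding DG_def by (rule smooth_symmetric[OF o sG y])
  have lin: "linear (fderiv (DG a) (r, c p))" for a
    using dDG has_derivative_linear by blast
  have linG: "linear (\<lambda>a. DG a y)" if "y \<in> ?P" for y
    unfolding DG_def using smooth_on_has_derivative[OF sG that] has_derivative_linear by blast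
  have "((\<lambda>y. of_real (fst y) * DG (1, 0) y) has_derivative
      (\<lambda>h. of_real r * fderiv (DG (1, 0)) (r, c p) h + of_real (fst h) * DG (1, 0) (r, c p))) (at (r, c p))"
    by (rule derivative_eq_intros dDG | simp)+
  then have "((radial g \<circ> cchart_inv D c) has_derivative
      (\<lambda>h. of_real r * fderiv (DG (1, 0)) (r, c p) h + of_real (fst h) * DG (1, 0) (r, c p))) (at (r, c p))"
    by (rule has_derivative_transform_within_open[OF _ o y])
      (simp only: radial_chart[OF assms(1-3) D(1)] DG_def G_def)
  note fd = frechet_derivative_eqI[OF this]
  have L: "cone_deriv (r, p) (b, X) (radial g) =
      of_real r * fderiv (DG (1, 0)) (r, c p) (b * r, u) + of_real (b * r) * DG (1, 0) (r, c p)"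
    unfolding u cone_deriv_chart[OF assms(1,2) radial_smooth[OF assms(1-3)] assms(4) D] fd by simp
  have split: "DG (b * s, u) y = of_real (b * s) * DG (1, 0) y + DG (0, u) y" if "y \<in> ?P" for s y
  proof -
    have "DG (b * s, u) y = DG ((b * s) *\<^sub>R (1, 0) + (0, u)) y" by simp
    also have "\<dots> = (b * s) *\<^sub>R DG (1, 0) y + DG (0, u) y"
      using linear_add[OF linG[OF that]] linear_scale[OF linG[OF that]] by metis
    finally show ?thesis by (simp add: scaleR_conv_of_real)
  qed
  have emb: "((\<lambda>s. (s, c p)) has_derivative (\<lambda>h. (h, 0))) (at r)"
    by (auto intro!: derivative_eq_intros)
  have v: "((\<lambda>s. DG a (s, c p)) has_vector_derivative fderiv (DG a) (r, c p) (1, 0)) (at r)" for a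
  proof -
    have "((\<lambda>s. DG a (s, c p)) has_derivative (\<lambda>h. fderiv (DG a) (r, c p) (h, 0))) (at r)"
      by (rule has_derivative_compose[OF emb dDG])
    then show ?thesis
      unfolding has_vector_derivative_def
      by (rule has_derivative_eq_rhs) (rule ext, subst linear_scale[OF lin, symmetric], simp)
  qed
  define T where "T = {s. (s, p) \<in> V}"
  have T: "open T" unfolding T_def by (rule open_radial_slice[OF assms(1)])
  have inT: "of_real r * (of_real (b * s) * DG (1, 0) (s, c p) + DG (0, u) (s, c p)) =
      of_real r * cone_deriv (s, p) (b, X) g" if "s \<in> T" for s
  proof -
    have sV: "(s, p) \<in> V" using that by (simp add: T_def)
    then have s0: "s > 0" using assms(2) by (auto simp: cone_def)
    have "(s, c p) \<in> ?P"
      using sV D s0 by (intro image_eqI[where x = "(s, p)"]) (auto simp: cchart_def)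
    then show ?thesis
      unfolding u cone_deriv_chart[OF assms(1-3) sV D] using split by (simp add: DG_def G_def)
  qed
  have "((\<lambda>s. of_real r * (of_real (b * s) * DG (1, 0) (s, c p) + DG (0, u) (s, c p))) has_vector_derivative
      of_real r * (of_real (b * r) * fderiv (DG (1, 0)) (r, c p) (1, 0) + of_real b * DG (1, 0) (r, c p)
        + fderiv (DG (0, u)) (r, c p) (1, 0))) (at r)"
    by (rule derivative_eq_intros v | simp)+
  then have "((\<lambda>s. of_real r * cone_deriv (s, p) (b, X) g) has_vector_derivative
      of_real r * (of_real (b * r) * fderiv (DG (1, 0)) (r, c p) (1, 0) + of_real b * DG (1, 0) (r, c p)
        + fderiv (DG (0, u)) (r, c p) (1, 0))) (at r)"
    by (rule has_vector_derivative_transform_within_open[OF _ T _ inT]) (use assms(4) in \<open>simp add: T_def\<close>)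
  moreover have "fderiv (DG (1, 0)) (r, c p) (b * r, u) =
      of_real (b * r) * fderiv (DG (1, 0)) (r, c p) (1, 0) + fderiv (DG (0, u)) (r, c p) (1, 0)"
  proof -
    have "fderiv (DG (1, 0)) (r, c p) (b * r, u) =
        fderiv (DG (1, 0)) (r, c p) ((b * r) *\<^sub>R (1, 0) + (0, u))" by simp
    also have "\<dots> = (b * r) *\<^sub>R fderiv (DG (1, 0)) (r, c p) (1, 0) + fderiv (DG (1, 0)) (r, c p) (0, u)"
      using linear_add[OF lin] linear_scale[OF lin] by metis
    finally show ?thesis using sym[of "(1, 0)" "(0, u)"] by (simp add: scaleR_conv_of_real)
  qed
  ultimately show ?thesis unfolding L by (simp add: algebra_simps)
qed

text \<open>The complex structure \<open>cone_I S (s, p)\<close> is the same for all \<open>s\<close>, so the Cauchy-Riemann equations of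
  \<open>z\<^sup>a\<close> along the ray through \<open>p\<close> can be differentiated in \<open>s\<close>.\<close>
lemma radial_holo_on:
  assumes "holo_coord S U z"
  shows "holo_on (z ` U) (radial (\<lambda>y. z y $ a) \<circ> inv_into U z)"
proof (rule CR_function_holo_on[OF assms _ subset_refl])
  note h = holo_coordD[OF assms]
  let ?g = "\<lambda>y. z y $ a"
  have g: "cone_smooth U ?g" by (rule mfd_smooth_component[OF h(1,5)])
  show "open U" by (rule h(1))
  show "cone_smooth U (radial ?g)" by (rule radial_smooth[OF h(1,2) g])
  fix x v assume x: "x \<in> U" and v: "v \<in> cone_tangent S x"
  obtain r p where rp: "x = (r, p)" by (cases x)
  obtain b X where bX: "v = (b, X)" by (cases v)
  obtain b' X' where bX': "cone_I S x v = (b', X')" by (cases "cone_I S x v")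
  have X: "X \<in> real_tangent (charts S) p" using v by (simp add: bX rp cone_tangent_def)
  have X': "X' \<in> real_tangent (charts S) p"
    using cone_I_tangent[OF v] unfolding bX' by (simp add: rp cone_tangent_def)
  have I: "cone_I S (s, p) (b, X) = (b', X')" for s
    using bX' unfolding bX rp by (simp add: cone_I_def)
  define T where "T = {s. (s, p) \<in> U}"
  have T: "open T" unfolding T_def by (rule open_radial_slice[OF h(1)])
  have rT: "r \<in> T" using x by (simp add: T_def rp)
  have eq: "of_real r * cone_deriv (s, p) (b', X') ?g = \<i> * (of_real r * cone_deriv (s, p) (b, X) ?g)" if "s \<in> T" for s
  proof -
    have "(b, X) \<in> cone_tangent S (s, p)" using X by (simp add: cone_tangent_def)
    from holo_coordD(7)[OF assms _ this] that
    have "coord_diff z (s, p) (b', X') = times_i (coord_diff z (s, p) (b, X))" by (simp add: T_def I)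
    then show ?thesis unfolding coord_diff_def times_i_def vec_eq_iff by simp
  qed
  have d1: "((\<lambda>s. of_real r * cone_deriv (s, p) (b', X') ?g) has_vector_derivative cone_deriv (r, p) (b', X') (radial ?g)) (at r)"
    by (rule cone_deriv_radial[OF h(1,2) g x[unfolded rp] X'])
  have "((\<lambda>s. \<i> * (of_real r * cone_deriv (s, p) (b, X) ?g)) has_vector_derivative \<i> * cone_deriv (r, p) (b, X) (radial ?g)) (at r)"
    by (rule has_vector_derivative_mult_right[OF cone_deriv_radial[OF h(1,2) g x[unfolded rp] X]])
  then have d2: "((\<lambda>s. of_real r * cone_deriv (s, p) (b', X') ?g) has_vector_derivative \<i> * cone_deriv (r, p) (b, X) (radial ?g)) (at r)"
    by (rule has_vector_derivative_transform_within_open[OF _ T rT]) (simp add: eq)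
  show "cone_deriv x (cone_I S x v) (radial ?g) = \<i> * cone_deriv x v (radial ?g)"
    unfolding bX' unfolding rp bX using vector_derivative_at[OF d1] vector_derivative_at[OF d2] by simp
qed

section \<open>The defining function\<close>

text \<open>\<open>\<rho>\<^sub>S\<close> with complex values, as Wirtinger derivatives require.\<close>
definition rho_c :: "real \<Rightarrow> real \<times> 's \<Rightarrow> complex" where
  "rho_c lam x = complex_of_real (rho_S lam x)"

abbreviation "rho_in lam U z \<equiv> rho_c lam \<circ> inv_into U z"

lemma smooth_on_psi_log:
  fixes W :: "(real \<times> 'e::euclidean_space) set"
  assumes "open W" "\<And>y. y \<in> W \<Longrightarrow> fst y > 0"
  shows "smooth_on W (\<lambda>y. complex_of_real (psi lam (ln ((fst y)\<^sup>2))))"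
proof -
  let ?t = "\<lambda>y :: real \<times> 'e. complex_of_real (ln ((fst y)\<^sup>2))"
  have bl: "bounded_linear (\<lambda>y :: real \<times> 'e. complex_of_real (fst y))"
    using bounded_linear_compose[OF bounded_linear_of_real bounded_linear_fst] .
  have d: "(?t has_derivative (\<lambda>v. complex_of_real (2 * fst v) * inverse (complex_of_real (fst y)))) (at y)" if "y \<in> W" for y
  proof -
    have "((\<lambda>y. ln ((fst y)\<^sup>2)) has_derivative (\<lambda>v. 2 * fst v / fst y)) (at y)"
      using assms(2)[OF that] by (auto intro!: derivative_eq_intros simp: power2_eq_square field_simps)
    from bounded_linear.has_derivative[OF bounded_linear_of_real[where 'a = complex] this]
    show ?thesis by (simp add: divide_inverse)
  qed
  have t: "smooth_on W ?t"
  proof (rule smooth_onI[OF assms(1) _ d])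
    show "continuous_on W ?t"
      using d has_derivative_continuous by (blast intro: continuous_at_imp_continuous_on)
    show "smooth_on W (\<lambda>y. complex_of_real (2 * fst v) * inverse (complex_of_real (fst y)))" for v :: "real \<times> 'e"
      by (intro smooth_on_mult smooth_on_const smooth_on_inverse smooth_on_bounded_linear bl assms(1))
        (use assms(2) in fastforce)
  qed
  show ?thesis
  proof (cases "lam = 0")
    case True
    then show ?thesis using t by (simp add: psi_def)
  next
    case False
    have "smooth_on W (\<lambda>y. inverse (of_real lam) * (exp (of_real lam * ?t y) + (-1)))"
      by (intro smooth_on_mult smooth_on_add smooth_on_exp smooth_on_const t assms(1))
    moreover have "complex_of_real (psi lam s) = inverse (of_real lam) * (exp (of_real lam * of_real s) + (-1))" for s
      using False by (simp add: psi_def exp_of_real[symmetric] divide_inverse mult.commute)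
    ultimately show ?thesis by simp
  qed
qed

lemma rho_smooth:
  assumes "open V" "V \<subseteq> cone"
  shows "cone_smooth V (rho_c lam)"
proof (rule cone_smoothI)
  fix D c assume D: "(D, c) \<in> charts S"
  let ?P = "chart_image D c V"
  have o: "open ?P" by (rule cchart_image_open[OF D assms(1)])
  have "smooth_on ?P (\<lambda>y. complex_of_real (psi lam (ln ((fst y)\<^sup>2))))"
    by (rule smooth_on_psi_log[OF o]) (auto simp: cchart_def)
  then show "smooth_on ?P (rho_c lam \<circ> cchart_inv D c)"
  proof (rule smooth_on_eq[OF _ o])
    fix y assume "y \<in> ?P"
    then obtain r p where "(r, p) \<in> V" "p \<in> D" "r > 0" "y = (r, c p)" by (auto simp: cchart_def)
    then show "complex_of_real (psi lam (ln ((fst y)\<^sup>2))) = (rho_c lam \<circ> cchart_inv D c) y"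
      using cchart_inv_cchart[OF D, of "(r, p)"] by (simp add: cchart_def rho_c_def rho_S_def)
  qed
qed

text \<open>These are the equations \<open>\<psi>' = 1 + \<lambda> \<psi>\<close> (with \<open>r\<partial>\<^sub>r log r\<^sup>2 = 2\<close>) and \<open>\<xi> \<rho> = 0\<close>; note that \<open>\<xi> = I(r\<partial>\<^sub>r)\<close>.\<close>
lemma rho_radial:
  assumes "x \<in> cone"
  shows "cone_deriv x (1, \<lambda>f. 0) (rho_c lam) = 2 * (1 + of_real lam * rho_c lam x)"
    and "cone_deriv x (0, reeb S (snd x)) (rho_c lam) = 0"
proof -
  obtain r p where rp: "x = (r, p)" by (cases x)
  have r: "r > 0" using assms by (auto simp: rp cone_def)
  have "((\<lambda>s. psi lam (ln (s\<^sup>2))) has_real_derivative 2 * (1 + lam * psi lam (ln (r\<^sup>2))) / r) (at r)"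
  proof (cases "lam = 0")
    case True
    then show ?thesis
      unfolding psi_def using r by (auto intro!: derivative_eq_intros simp: power2_eq_square field_simps)
  next
    case False
    then show ?thesis
      unfolding psi_def using r by (auto intro!: derivative_eq_intros simp: power2_eq_square field_simps)
  qed
  from has_vector_derivative_of_real[OF this, where 'a = complex]
  have "((\<lambda>s. complex_of_real (psi lam (ln (s\<^sup>2)))) has_vector_derivative complex_of_real (2 * (1 + lam * psi lam (ln (r\<^sup>2))) / r)) (at r)" .
  note v = vector_derivative_at[OF this]
  show "cone_deriv x (1, \<lambda>f. 0) (rho_c lam) = 2 * (1 + of_real lam * rho_c lam x)"
    unfolding cone_deriv_def rp using r v by (simp add: rho_c_def rho_S_def)
  have "reeb S p (\<lambda>q. rho_c lam (r, q)) = 0"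
    using complex_tangent_const[OF atlas, of "reeb S p" p] reeb_tangent[of p]
    by (simp add: rho_c_def rho_S_def real_tangent_def)
  then show "cone_deriv x (0, reeb S (snd x)) (rho_c lam) = 0"
    unfolding cone_deriv_def rp by simp
qed

text \<open>The components of the antiholomorphic part of \<open>r\<partial>\<^sub>r\<close> are \<open>cnj Y\<^sup>a\<close> with \<open>Y\<^sup>a = r\<partial>\<^sub>r z\<^sup>a\<close>, and this part differs from
  \<open>r\<partial>\<^sub>r / 2\<close> by a multiple of \<open>\<xi>\<close>, which annihilates \<open>\<rho>\<close>.\<close>
lemma radial_rho:
  assumes "holo_coord S U z" "w \<in> z ` U"
  shows "(\<Sum>a\<in>UNIV. cnj (radial (\<lambda>y. z y $ a) (inv_into U z w)) * wirt_bar a (rho_in lam U z) w)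
    = 1 + of_real lam * (rho_in lam U z) w"
proof -
  note h = holo_coordD[OF assms(1)]
  obtain x where x: "x \<in> U" "w = z x" using assms(2) by blast
  have inv: "inv_into U z w = x" using inv_into_f_f[OF h(3)] x by simp
  have xc: "x \<in> cone" using h(2) x by blast
  have sm: "cone_smooth U (rho_c lam)" by (rule rho_smooth[OF h(1,2)])
  let ?v = "(1, \<lambda>f. 0)" let ?R = "rho_in lam U z"
  have v: "?v \<in> cone_tangent S x" using zero_tangent by (simp add: cone_tangent_def)
  have d: "?R differentiable (at w)"
    by (rule smooth_on_differentiable[OF smooth_in_coord[OF assms(1) h(1) subset_refl sm] assms(2)])
  have "(\<Sum>a\<in>UNIV. cnj (coord_diff z x ?v $ a) * wirt_bar a ?R w) =
    (fderiv ?R w (coord_diff z x ?v) + \<i> * fderiv ?R w (times_i (coord_diff z x ?v))) / 2"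
    by (rule sum_wirt_direction[OF d])
  also have "fderiv ?R w (coord_diff z x ?v) = 2 * (1 + of_real lam * rho_c lam x)"
    using cone_deriv_coord[OF assms(1) h(1) subset_refl sm x(1) v] rho_radial(1)[OF xc] x(2) by simp
  also have "fderiv ?R w (times_i (coord_diff z x ?v)) = 0"
    using cone_deriv_coord[OF assms(1) h(1) subset_refl sm x(1) cone_I_tangent[OF v]] rho_radial(2)[OF xc]
    unfolding h(7)[OF x(1) v] unfolding cone_I_radial x(2) by simp
  also have "(2 * (1 + of_real lam * rho_c lam x) + \<i> * 0) / 2 = 1 + of_real lam * rho_c lam x"
    by (simp add: field_simps)
  finally have "(\<Sum>a\<in>UNIV. cnj (coord_diff z x ?v $ a) * wirt_bar a ?R w) = 1 + of_real lam * rho_c lam x" .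
  then show ?thesis unfolding coord_diff_def radial_def inv comp_apply vec_lambda_beta .
qed

end

section \<open>Bordered Levi matrices\<close>

lemma sum_UNIV_option:
  "(\<Sum>A\<in>(UNIV :: 'm::finite option set). f A) = f None + (\<Sum>a\<in>UNIV. f (Some a))"
  by (simp add: UNIV_option_conv sum.reindex)

lemma prod_UNIV_option:
  "(\<Prod>A\<in>(UNIV :: 'm::finite option set). f A) = f None * (\<Prod>a\<in>UNIV. f (Some a))"
  by (simp add: UNIV_option_conv prod.reindex)

lemma det_cnj: "det (\<chi> i j. cnj (A $ i $ j)) = cnj (det (A :: complex^'m::finite^'m))"
  by (simp add: det_def)

text \<open>The matrix whose determinant is \<open>- \<J>\<close>.\<close>
definition bordered :: "(complex^'m::finite \<Rightarrow> complex) \<Rightarrow> complex^'m \<Rightarrow> complex^('m option)^('m option)" where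
  "bordered F w = (\<chi> B A. case B of
         None \<Rightarrow> (case A of None \<Rightarrow> F w | Some a \<Rightarrow> wirt a F w)
       | Some b \<Rightarrow> (case A of None \<Rightarrow> wirt_bar b F w | Some a \<Rightarrow> wirt a (wirt_bar b F) w))"

lemma bordered_simps [simp]:
  "bordered F w $ None $ None = F w" "bordered F w $ None $ Some a = wirt a F w"
  "bordered F w $ Some b $ None = wirt_bar b F w" "bordered F w $ Some b $ Some a = wirt a (wirt_bar b F) w"
  by (auto simp: bordered_def)

text \<open>The row index is the variable of differentiation, so the Levi form is multiplied by this matrix
  from the left and by its adjoint from the right.\<close>
definition jac :: "(complex^'m::finite \<Rightarrow> complex^'k::finite) \<Rightarrow> complex^'m \<Rightarrow> complex^'k^'m" where
  "jac \<Phi> w = (\<chi> a c. wirt a (\<lambda>w. \<Phi> w $ c) w)"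

lemma levi_form_cong:
  assumes "open W" "w \<in> W" "\<And>y. y \<in> W \<Longrightarrow> f y = g y"
  shows "wirt a (wirt_bar b f) w = wirt a (wirt_bar b g) w"
  by (rule wirt_cong(1)[OF assms(1,2)]) (rule wirt_cong(2)[OF assms(1) _ assms(3)])

lemma bordered_cong:
  assumes "open W" "w \<in> W" "\<And>y. y \<in> W \<Longrightarrow> f y = g y"
  shows "bordered f w = bordered g w"
  unfolding bordered_def using wirt_cong[OF assms] levi_form_cong[OF assms] assms(3)[OF assms(2)]
  by (simp only:)

text \<open>Bordering the Jacobian with a 1 turns the transformation of the function, its gradients and its Levi
  form into a single congruence.\<close>
lemma det_bordered_compose:
  fixes \<Phi> :: "complex^'m::finite \<Rightarrow> complex^'m"
  assumes "open W" "open V" "\<Phi> ` W \<subseteq> V" "smooth_on V F"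
    and hol: "\<And>D. holo_on W (\<lambda>w. \<Phi> w $ D)" and w: "w \<in> W"
  shows "det (bordered (\<lambda>w. F (\<Phi> w)) w) = of_real ((cmod (det (jac \<Phi> w)))\<^sup>2) * det (bordered F (\<Phi> w))"
proof -
  let ?B = "bordered (\<lambda>w. F (\<Phi> w)) w" and ?B' = "bordered F (\<Phi> w)"
  define K where "K = ((\<chi> A C. case A of None \<Rightarrow> (if C = None then 1 else 0)
    | Some a \<Rightarrow> (case C of None \<Rightarrow> 0 | Some c \<Rightarrow> jac \<Phi> w $ a $ c)) :: complex^('m option)^('m option))"
  have K: "K $ None $ None = 1" "K $ None $ Some c = 0" "K $ Some a $ None = 0" "K $ Some a $ Some c = jac \<Phi> w $ a $ c" for a c
    by (auto simp: K_def)
  have sP: "smooth_on W \<Phi>" by (rule smooth_on_vec[OF assms(1) holo_onD(1)[OF hol]])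
  have \<Phi>w: "\<Phi> w \<in> V" using assms(3) w by blast
  note c1 = wirt_compose[OF smooth_on_differentiable[OF sP w] holo_onD(2)[OF hol w] smooth_on_differentiable[OF assms(4) \<Phi>w]]
  note c2 = levi_form_compose[OF assms]
  have "?B = (\<chi> A C. cnj (K $ A $ C)) ** ?B' ** transpose K"
  proof (rule vec_eq_iff[THEN iffD2, rule_format], rule vec_eq_iff[THEN iffD2, rule_format])
    fix B A
    show "?B $ B $ A = ((\<chi> A C. cnj (K $ A $ C)) ** ?B' ** transpose K) $ B $ A"
    proof (cases B; cases A)
      assume "B = None" "A = None"
      then show ?thesis by (simp add: matrix_matrix_mult_def transpose_def sum_UNIV_option K)
    next
      fix a assume "B = None" "A = Some a"
      then show ?thesis
        by (simp add: matrix_matrix_mult_def transpose_def sum_UNIV_option K c1 jac_def mult.commute)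
    next
      fix b assume "B = Some b" "A = None"
      then show ?thesis
        by (simp add: matrix_matrix_mult_def transpose_def sum_UNIV_option K c1 jac_def)
    next
      fix a b assume "B = Some b" "A = Some a"
      then show ?thesis
        by (simp add: matrix_matrix_mult_def transpose_def sum_UNIV_option K c2 jac_def sum_distrib_left sum_distrib_right mult_ac)
    qed
  qed
  then have "det ?B = cnj (det K) * det ?B' * det K"
    by (simp add: det_mul det_cnj)
  moreover have "det K = det (jac \<Phi> w)"
    by (subst det_option) (simp_all add: K)
  moreover have "cnj d * x * d = of_real ((cmod d)\<^sup>2) * x" for d x
    by (simp only: complex_norm_square mult_ac)
  ultimately show ?thesis by simp
qed

definition base_part :: "complex^('m::finite option) \<Rightarrow> complex^'m" where
  "base_part w = (\<chi> a. w $ Some a)"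

lemma base_part_holo: "open W \<Longrightarrow> holo_on W (\<lambda>w. base_part w $ a)"
  by (simp add: base_part_def holo_on_coord)

lemma base_part_continuous: "continuous_on W base_part"
  unfolding base_part_def by (intro continuous_intros)

lemma open_base_part_vimage:
  "open V \<Longrightarrow> open {w :: complex^('m::finite option). w $ None \<noteq> 0 \<and> base_part w \<in> V}"
proof -
  assume V: "open V"
  have "open (base_part -` V)" using open_vimage[OF V base_part_continuous] .
  moreover have "open {w :: complex^('m option). w $ None \<noteq> 0}"
    by (intro open_Collect_neq continuous_intros)
  ultimately have "open ({w :: complex^('m option). w $ None \<noteq> 0} \<inter> base_part -` V)" by (rule open_Int[rotated])
  moreover have "{w :: complex^('m option). w $ None \<noteq> 0} \<inter> base_part -` V = {w. w $ None \<noteq> 0 \<and> base_part w \<in> V}" by auto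
  ultimately show ?thesis by simp
qed

lemma wirt_base_part:
  fixes f :: "complex^'m::finite \<Rightarrow> complex"
  assumes "f differentiable (at (base_part w))"
  shows "wirt None (\<lambda>w. f (base_part w)) w = 0" "wirt (Some a) (\<lambda>w. f (base_part w)) w = wirt a f (base_part w)"
    "wirt_bar None (\<lambda>w. f (base_part w)) w = 0" "wirt_bar (Some a) (\<lambda>w. f (base_part w)) w = wirt_bar a f (base_part w)"
proof -
  have d: "base_part differentiable (at w)"
    by (rule smooth_on_differentiable[OF smooth_on_vec, of UNIV]) (auto intro: holo_onD(1)[OF base_part_holo])
  have b: "wirt_bar B (\<lambda>w. base_part w $ D) w = 0" for B D
    by (rule holo_onD(2)[OF base_part_holo[of UNIV]]) auto
  have e: "wirt B (\<lambda>w. base_part w $ D) w = (if B = Some D then 1 else 0)" for B :: "'m option" and D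
    by (simp add: base_part_def wirt_coord)
  show "wirt None (\<lambda>w. f (base_part w)) w = 0" "wirt (Some a) (\<lambda>w. f (base_part w)) w = wirt a f (base_part w)"
    "wirt_bar None (\<lambda>w. f (base_part w)) w = 0" "wirt_bar (Some a) (\<lambda>w. f (base_part w)) w = wirt_bar a f (base_part w)"
    unfolding wirt_compose[OF d b assms] e
    by (simp_all add: if_distrib[of "\<lambda>x. x * _"] if_distrib[of cnj] cong: if_cong)
qed

section \<open>Levi forms in fibre coordinates\<close>

text \<open>For \<open>N = n + 2\<close> and the fibre coordinate \<open>\<zeta> = w $ None\<close> this is \<open>\<theta> = log \<bar>z\<^sup>0\<bar>\<^sup>2\<close>, written without choosing
  a root \<open>z\<^sup>0\<close> of \<open>\<zeta>\<close>.\<close>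
definition log_fib :: "nat \<Rightarrow> complex^('m::finite option) \<Rightarrow> complex" where
  "log_fib N w = complex_of_real (ln ((cmod (w $ None))\<^sup>2) / real N)"

lemma log_fib_derivative:
  fixes w :: "complex^('m::finite option)"
  assumes "w $ None \<noteq> 0"
  shows "(log_fib N has_derivative
    (\<lambda>v. v $ None * (inverse (of_nat N) * inverse (w $ None)) + cnj (v $ None) * cnj (inverse (of_nat N) * inverse (w $ None)))) (at w)"
proof -
  let ?q = "\<lambda>w :: complex^('m option). (cmod (w $ None))\<^sup>2"
  have q: "?q w = Re (w $ None) * Re (w $ None) + Im (w $ None) * Im (w $ None)" for w :: "complex^('m option)"
    using cmod_power2[of "w $ None"] by (simp only: power2_eq_square)
  have pos: "?q w > 0" using assms by simp
  have n: "((\<lambda>w. w $ None) has_derivative (\<lambda>v. v $ None)) (at w)"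
    by (rule bounded_linear_imp_has_derivative[OF bounded_linear_vec_nth])
  have re: "((\<lambda>w. Re (w $ None)) has_derivative (\<lambda>v. Re (v $ None))) (at w)"
    and im: "((\<lambda>w. Im (w $ None)) has_derivative (\<lambda>v. Im (v $ None))) (at w)"
    using bounded_linear.has_derivative[OF bounded_linear_Re n] bounded_linear.has_derivative[OF bounded_linear_Im n] by auto
  have "(?q has_derivative (\<lambda>v. 2 * (Re (w $ None) * Re (v $ None) + Im (w $ None) * Im (v $ None)))) (at w)"
    unfolding q
    by (rule has_derivative_eq_rhs[OF has_derivative_add[OF has_derivative_mult[OF re re] has_derivative_mult[OF im im]]])
      (simp add: fun_eq_iff algebra_simps)
  from DERIV_compose_FDERIV[OF DERIV_ln[OF pos] this]
  have "((\<lambda>w. ln (?q w)) has_derivative (\<lambda>v. 2 * (Re (w $ None) * Re (v $ None) + Im (w $ None) * Im (v $ None)) * inverse (?q w))) (at w)" .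
  from bounded_linear.has_derivative[OF bounded_linear_of_real[where 'a = complex] has_derivative_mult_left[OF this, of "inverse (real N)"]]
  have "(log_fib N has_derivative (\<lambda>v. complex_of_real (2 * (Re (w $ None) * Re (v $ None) + Im (w $ None) * Im (v $ None)) * inverse (?q w) * inverse (real N)))) (at w)"
    unfolding log_fib_def[abs_def] divide_inverse .
  then show ?thesis
  proof (rule has_derivative_eq_rhs, intro ext)
    fix v :: "complex^('m option)"
    let ?a = "w $ None" and ?v = "v $ None"
    have "?v * inverse ?a + cnj (?v * inverse ?a) = complex_of_real (2 * Re (?v * inverse ?a))"
      by (rule complex_add_cnj)
    also have "Re (?v * inverse ?a) = (Re ?a * Re ?v + Im ?a * Im ?v) * inverse (?q w)"
      by (simp add: cmod_power2 divide_inverse algebra_simps)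
    finally have "?v * inverse ?a + cnj (?v * inverse ?a) = complex_of_real (2 * ((Re ?a * Re ?v + Im ?a * Im ?v) * inverse (?q w)))" .
    then have "(?v * inverse ?a + cnj (?v * inverse ?a)) * inverse (of_nat N)
      = complex_of_real (2 * (Re ?a * Re ?v + Im ?a * Im ?v) * inverse (?q w) * inverse (real N))"
      by simp
    then show "complex_of_real (2 * (Re ?a * Re ?v + Im ?a * Im ?v) * inverse (?q w) * inverse (real N)) =
        ?v * (inverse (of_nat N) * inverse ?a) + cnj ?v * cnj (inverse (of_nat N) * inverse ?a)"
      by (simp add: algebra_simps)
  qed
qed

lemma log_fib_wirt:
  fixes w :: "complex^('m::finite option)"
  assumes "w $ None \<noteq> 0"
  shows "wirt A (log_fib N) w = (if A = None then inverse (of_nat N) * inverse (w $ None) else 0)"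
    "wirt_bar A (log_fib N) w = (if A = None then cnj (inverse (of_nat N) * inverse (w $ None)) else 0)"
proof -
  let ?P = "\<lambda>A. if A = None then inverse (of_nat N) * inverse (w $ None) else (0::complex)"
  have "(log_fib N has_derivative (\<lambda>v. \<Sum>A\<in>UNIV. v $ A * ?P A + cnj (v $ A) * cnj (?P A))) (at w)"
    by (rule has_derivative_eq_rhs[OF log_fib_derivative[OF assms]]) (simp add: fun_eq_iff sum_UNIV_option)
  from wirt_of_derivative[OF this]
  show "wirt A (log_fib N) w = (if A = None then inverse (of_nat N) * inverse (w $ None) else 0)"
    "wirt_bar A (log_fib N) w = (if A = None then cnj (inverse (of_nat N) * inverse (w $ None)) else 0)"
    by auto
qed

lemma log_fib_smooth:
  fixes W :: "(complex^('m::finite option)) set"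
  assumes "open W" "\<And>w. w \<in> W \<Longrightarrow> w $ None \<noteq> 0"
  shows "smooth_on W (log_fib N)"
proof (rule smooth_onI[OF assms(1) _ log_fib_derivative])
  show "continuous_on W (log_fib N)"
    using log_fib_derivative[OF assms(2)] has_derivative_continuous by (blast intro: continuous_at_imp_continuous_on)
  have i: "smooth_on W (\<lambda>w. inverse (of_nat N) * inverse (w $ None) :: complex)"
    by (intro smooth_on_mult smooth_on_const smooth_on_inverse smooth_on_bounded_linear bounded_linear_vec_nth assms)
  show "smooth_on W (\<lambda>w. v $ None * (inverse (of_nat N) * inverse (w $ None)) + cnj (v $ None) * cnj (inverse (of_nat N) * inverse (w $ None)))"
    for v :: "complex^('m option)"
    by (intro smooth_on_add smooth_on_mult[OF assms(1) smooth_on_const] smooth_on_cnj i assms(1))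
qed (use assms in auto)

text \<open>\<open>\<theta>\<close> is pluriharmonic, so only the second derivative of the outer function contributes.\<close>
lemma levi_form_log_fib:
  fixes w :: "complex^('m::finite option)"
  assumes "w $ None \<noteq> 0"
    and h: "\<And>s. (h has_field_derivative h1 s) (at s)" "\<And>s. (h1 has_field_derivative h2 s) (at s)"
  shows "wirt A (wirt_bar B (\<lambda>w. h (log_fib N w))) w = h2 (log_fib N w) * wirt A (log_fib N) w * wirt_bar B (log_fib N) w"
proof -
  define W where "W = {w :: complex^('m option). w $ None \<noteq> 0}"
  have W: "open W" unfolding W_def by (intro open_Collect_neq continuous_intros)
  have w: "w \<in> W" using assms by (simp add: W_def)
  have s: "smooth_on W (log_fib N)" by (rule log_fib_smooth[OF W]) (simp add: W_def)
  note d = smooth_on_differentiable[OF s]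
  have sb: "smooth_on W (wirt_bar B (log_fib N))" using smooth_on_wirt[OF W s] by blast
  have "wirt A (wirt_bar B (\<lambda>w. h (log_fib N w))) w = wirt A (\<lambda>w. h1 (log_fib N w) * wirt_bar B (log_fib N) w) w"
    by (rule wirt_cong(1)[OF W w]) (rule wirt_field_compose(2)[OF h(1) d])
  also have "\<dots> = wirt A (\<lambda>w. h1 (log_fib N w)) w * wirt_bar B (log_fib N) w + h1 (log_fib N w) * wirt A (wirt_bar B (log_fib N)) w"
  proof (rule wirt_mult(1)[OF _ smooth_on_differentiable[OF sb w]])
    have "(log_fib N has_derivative fderiv (log_fib N) w) (at w)" by (rule smooth_on_has_derivative[OF s w])
    from has_derivative_compose[OF this h(2)[unfolded has_field_derivative_def]]
    show "(\<lambda>w. h1 (log_fib N w)) differentiable (at w)" by (rule differentiableI)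
  qed
  also have "wirt A (\<lambda>w. h1 (log_fib N w)) w = h2 (log_fib N w) * wirt A (log_fib N) w"
    by (rule wirt_field_compose(1)[OF h(2) d[OF w]])
  also have "wirt A (wirt_bar B (log_fib N)) w = 0"
  proof (cases B)
    case None
    have ho: "holo_on W (\<lambda>w. inverse (of_nat N) * inverse (w $ None))"
      by (intro holo_on_mult holo_on_const holo_on_inverse holo_on_coord W) (simp add: W_def)
    have "wirt A (wirt_bar B (log_fib N)) w = wirt A (\<lambda>w. cnj (inverse (of_nat N) * inverse (w $ None))) w"
      by (rule wirt_cong(1)[OF W w]) (simp add: W_def log_fib_wirt None)
    also have "\<dots> = cnj (wirt_bar A (\<lambda>w. inverse (of_nat N) * inverse (w $ None)) w)"
      by (rule wirt_cnj(1)[OF smooth_on_differentiable[OF holo_onD(1)[OF ho] w]])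
    also have "\<dots> = 0" using holo_onD(2)[OF ho w] by simp
    finally show ?thesis .
  next
    case (Some b)
    have "wirt A (wirt_bar B (log_fib N)) w = wirt A (\<lambda>w. 0) w"
      by (rule wirt_cong(1)[OF W w]) (simp add: W_def log_fib_wirt Some)
    then show ?thesis by (simp add: wirt_const)
  qed
  finally show ?thesis by (simp add: algebra_simps)
qed

text \<open>By pluriharmonicity of \<open>\<theta>\<close>, the metric of the potential \<open>e\<^sup>\<theta> R\<close> is, up to the factor \<open>e\<^sup>\<theta>\<close> and a rescaling
  of the frame by \<open>\<partial>\<theta>/\<partial>\<zeta>\<close> in the fibre direction, the bordered matrix of \<open>R\<close>.\<close>
lemma levi_form_cone_potential:
  fixes w :: "complex^('m::finite option)" and N :: nat
  assumes V: "open V" "smooth_on V R" and w: "w $ None \<noteq> 0" "base_part w \<in> V"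
  defines "E \<equiv> \<lambda>A. case A of None \<Rightarrow> inverse (of_nat N) * inverse (w $ None) | Some a \<Rightarrow> (1::complex)"
  shows "wirt A (wirt_bar B (\<lambda>w. exp (log_fib N w) * R (base_part w))) w =
    exp (log_fib N w) * (E A * bordered R (base_part w) $ B $ A * cnj (E B))"
proof -
  define W where "W = {w :: complex^('m option). w $ None \<noteq> 0 \<and> base_part w \<in> V}"
  have W: "open W" unfolding W_def by (rule open_base_part_vimage[OF V(1)])
  have wW: "w \<in> W" using w by (simp add: W_def)
  have n0: "y $ None \<noteq> 0" if "y \<in> W" for y using that by (simp add: W_def)
  have bV: "base_part y \<in> V" if "y \<in> W" for y using that by (simp add: W_def)
  let ?\<theta> = "log_fib N :: complex^('m option) \<Rightarrow> complex"
  let ?e = "\<lambda>w. exp (?\<theta> w)" and ?R = "\<lambda>w :: complex^('m option). R (base_part w)"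
  have s: "smooth_on W ?\<theta>" by (rule log_fib_smooth[OF W n0])
  have se: "smooth_on W ?e" by (rule smooth_on_exp[OF W s])
  have sp: "smooth_on W base_part" by (rule smooth_on_vec[OF W holo_onD(1)[OF base_part_holo[OF W]]])
  have sR: "smooth_on W ?R" by (rule smooth_on_compose[OF W V(1) sp V(2)]) (auto simp: bV)
  note df = smooth_on_differentiable
  have seb: "smooth_on W (wirt_bar B ?e)" and sRb: "smooth_on W (wirt_bar B ?R)"
    using smooth_on_wirt[OF W se] smooth_on_wirt[OF W sR] by auto
  have we: "wirt A ?e y = ?e y * wirt A ?\<theta> y" "wirt_bar A ?e y = ?e y * wirt_bar A ?\<theta> y" if "y \<in> W" for y A
    using wirt_field_compose[OF DERIV_exp df[OF s that]] by auto
  have "wirt A (wirt_bar B (\<lambda>w. ?e w * ?R w)) w = wirt A (\<lambda>w. wirt_bar B ?e w * ?R w + ?e w * wirt_bar B ?R w) w"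
    by (rule wirt_cong(1)[OF W wW]) (rule wirt_mult(2)[OF df[OF se] df[OF sR]])
  also have "\<dots> = wirt A (wirt_bar B ?e) w * ?R w + wirt_bar B ?e w * wirt A ?R w
      + (wirt A ?e w * wirt_bar B ?R w + ?e w * wirt A (wirt_bar B ?R) w)"
    by (simp add: wirt_add(1) wirt_mult(1) df[OF smooth_on_mult[OF W seb sR] wW] df[OF smooth_on_mult[OF W se sRb] wW]
        df[OF seb wW] df[OF sR wW] df[OF se wW] df[OF sRb wW])
  also have "wirt A (wirt_bar B ?e) w = ?e w * wirt A ?\<theta> w * wirt_bar B ?\<theta> w"
    by (rule levi_form_log_fib[OF w(1) DERIV_exp DERIV_exp])
  also have "wirt_bar B ?e w = ?e w * wirt_bar B ?\<theta> w" by (rule we(2)[OF wW])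
  also have "wirt A ?e w = ?e w * wirt A ?\<theta> w" by (rule we(1)[OF wW])
  finally have main: "wirt A (wirt_bar B (\<lambda>w. ?e w * ?R w)) w = ?e w * (wirt A ?\<theta> w * wirt_bar B ?\<theta> w * ?R w
      + wirt_bar B ?\<theta> w * wirt A ?R w + wirt A ?\<theta> w * wirt_bar B ?R w + wirt A (wirt_bar B ?R) w)"
    by (simp add: algebra_simps)
  have dR: "R differentiable (at (base_part y))" if "y \<in> W" for y using df[OF V(2) bV[OF that]] .
  have dRb: "wirt_bar b R differentiable (at (base_part w))" for b
    using df[OF smooth_on_wirt(2)[OF V] bV[OF wW]] .
  have RN: "wirt C (wirt_bar None ?R) w = 0" for C
  proof -
    have "wirt C (wirt_bar None ?R) w = wirt C (\<lambda>w. 0) w"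
      by (rule wirt_cong(1)[OF W wW]) (rule wirt_base_part(3)[OF dR])
    then show ?thesis by (simp add: wirt_const)
  qed
  have RS: "wirt C (wirt_bar (Some b) ?R) w = wirt C (\<lambda>w. wirt_bar b R (base_part w)) w" for C b
    by (rule wirt_cong(1)[OF W wW]) (rule wirt_base_part(4)[OF dR])
  show ?thesis
    unfolding main
  proof (rule arg_cong[where f = "\<lambda>x. ?e w * x"])
    show "wirt A ?\<theta> w * wirt_bar B ?\<theta> w * ?R w
      + wirt_bar B ?\<theta> w * wirt A ?R w + wirt A ?\<theta> w * wirt_bar B ?R w + wirt A (wirt_bar B ?R) w
      = E A * bordered R (base_part w) $ B $ A * cnj (E B)"
      by (cases A; cases B)
        (simp_all add: E_def log_fib_wirt[OF w(1)] RN RS wirt_base_part[OF dR[OF wW]] wirt_base_part[OF dRb])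
  qed
qed

lemma base_part_nth [simp]: "base_part w $ a = w $ Some a"
  by (simp add: base_part_def)

lemma complex_root_exists:
  assumes "n > 0"
  shows "\<exists>z0 :: complex. z0 ^ n = \<zeta>"
proof (cases "\<zeta> = 0")
  case False
  have "exp (Ln \<zeta> / of_nat n) ^ n = exp (of_nat n * (Ln \<zeta> / of_nat n))" by (rule exp_of_nat_mult[symmetric])
  then show ?thesis using assms False by (auto simp: exp_Ln)
qed (use assms in \<open>auto intro: exI[of _ 0]\<close>)

context contact_mfd
begin

section \<open>The canonical bundle in coordinates\<close>

definition bundle_point :: "(real \<times> 's \<Rightarrow> complex^('n option)) \<Rightarrow> complex \<Rightarrow> real \<times> 's \<Rightarrow> ('s, 'n) canonical_elem" where
  "bundle_point z \<zeta> x = (x, \<lambda>v. \<zeta> * vol_form S z x v)"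

text \<open>As \<open>dz\<close> is onto, there are tangent vectors that it maps to the standard basis.\<close>
lemma vol_form_normalized:
  assumes "holo_coord S U z" "x \<in> U"
  obtains v where "vol_form S z x v = 1"
proof -
  have "\<forall>b. \<exists>v. v \<in> cone_tangent S x \<and> coord_diff z x v = axis b 1"
    using coord_diff_surj[OF assms] by metis
  then obtain v where v: "\<And>b. v b \<in> cone_tangent S x" "\<And>b. coord_diff z x (v b) = axis b 1" by metis
  have "(\<chi> b a. cone_deriv x (v b) (\<lambda>y. z y $ a)) = mat 1"
    using v(2) unfolding coord_diff_def vec_eq_iff by (simp add: mat_def axis_def eq_commute)
  then have "vol_form S z x v = 1" using v(1) by (simp add: vol_form_def)
  then show ?thesis by (rule that)
qed

lemma bundle_point_eq_iff:
  assumes "holo_coord S U z" "x \<in> U"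
  shows "bundle_point z \<zeta> x = bundle_point z \<zeta>' x \<longleftrightarrow> \<zeta> = \<zeta>'"
proof
  assume "bundle_point z \<zeta> x = bundle_point z \<zeta>' x"
  then have "(\<lambda>v. \<zeta> * vol_form S z x v) = (\<lambda>v. \<zeta>' * vol_form S z x v)"
    by (simp only: bundle_point_def prod.inject simp_thms)
  then have e: "\<zeta> * vol_form S z x v = \<zeta>' * vol_form S z x v" for v by (rule fun_cong)
  obtain v where "vol_form S z x v = 1" using vol_form_normalized[OF assms] .
  then show "\<zeta> = \<zeta>'" using e[of v] by simp
qed simp

lemma fiber_coord_bundle_point:
  assumes "holo_coord S U z" "x \<in> U"
  shows "fiber_coord S z (bundle_point z \<zeta> x) = \<zeta>"
  unfolding fiber_coord_def
proof (rule the_equality)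
  show "snd (bundle_point z \<zeta> x) = (\<lambda>v. \<zeta> * vol_form S z (fst (bundle_point z \<zeta> x)) v)"
    by (simp add: bundle_point_def)
  fix \<zeta>' assume "snd (bundle_point z \<zeta> x) = (\<lambda>v. \<zeta>' * vol_form S z (fst (bundle_point z \<zeta> x)) v)"
  then have "bundle_point z \<zeta> x = bundle_point z \<zeta>' x" by (simp add: bundle_point_def)
  then show "\<zeta>' = \<zeta>" using bundle_point_eq_iff[OF assms] by simp
qed

text \<open>The holomorphic Jacobian determinant of the change from \<open>z'\<close> to \<open>z\<close>, as a function of \<open>z'\<close>.\<close>
definition trans_jac where
  "trans_jac z U' z' w = det (jac (\<lambda>w. z (inv_into U' z' w)) w)"

lemma vol_form_change:
  assumes h: "holo_coord S U z" and h': "holo_coord S U' z'" and x: "x \<in> U" "x \<in> U'"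
  shows "vol_form S z x v = trans_jac z U' z' (z' x) * vol_form S z' x v"
proof (cases "\<forall>b. v b \<in> cone_tangent S x")
  case True
  let ?V = "U' \<inter> U" and ?\<phi> = "\<lambda>w. z (inv_into U' z' w)"
  note hd = holo_coordD[OF h] and hd' = holo_coordD[OF h']
  have V: "open ?V" "?V \<subseteq> U'" "x \<in> ?V" using hd(1) hd'(1) x by auto
  have hol: "holo_on (z' ` ?V) (\<lambda>w. ?\<phi> w $ a)" for a by (rule transition_holo_on[OF h' h])
  have zx: "z' x \<in> z' ` ?V" using V(3) by blast
  have "cone_deriv x (v b) (\<lambda>y. z y $ a) = (\<Sum>c\<in>UNIV. coord_diff z' x (v b) $ c * jac ?\<phi> (z' x) $ c $ a)" for a b
  proof -
    have sm: "cone_smooth ?V (\<lambda>y. z y $ a)"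
      by (rule mfd_smooth_on_subset[OF mfd_smooth_component[OF hd(1,5)]]) auto
    have "cone_deriv x (v b) (\<lambda>y. z y $ a) =
        fderiv ((\<lambda>y. z y $ a) \<circ> inv_into U' z') (z' x) (coord_diff z' x (v b))"
      using True by (intro cone_deriv_coord[OF h' V(1,2) sm V(3)]) blast
    also have "((\<lambda>y. z y $ a) \<circ> inv_into U' z') = (\<lambda>w. ?\<phi> w $ a)" by auto
    also have "fderiv (\<lambda>w. ?\<phi> w $ a) (z' x) (coord_diff z' x (v b)) =
      (\<Sum>c\<in>UNIV. coord_diff z' x (v b) $ c * wirt c (\<lambda>w. ?\<phi> w $ a) (z' x))"
      unfolding derivative_wirt[OF smooth_on_differentiable[OF holo_onD(1)[OF hol] zx]] holo_onD(2)[OF hol zx] by simp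
    finally show ?thesis by (simp add: jac_def)
  qed
  then have "(\<chi> b a. cone_deriv x (v b) (\<lambda>y. z y $ a)) = (\<chi> b a. cone_deriv x (v b) (\<lambda>y. z' y $ a)) ** jac ?\<phi> (z' x)"
    by (simp add: vec_eq_iff matrix_matrix_mult_def coord_diff_def)
  then show ?thesis using True by (simp add: vol_form_def det_mul trans_jac_def)
qed (simp only: vol_form_def if_False mult_zero_right)

lemma trans_jac_nonzero:
  assumes h: "holo_coord S U z" and h': "holo_coord S U' z'" and x: "x \<in> U" "x \<in> U'"
  shows "trans_jac z U' z' (z' x) \<noteq> 0"
proof -
  obtain v where "vol_form S z x v = 1" using vol_form_normalized[OF h x(1)] .
  then show ?thesis using vol_form_change[OF assms, of v] by auto
qed

lemma bundle_point_change:
  assumes h: "holo_coord S U z" and h': "holo_coord S U' z'" and x: "x \<in> U" "x \<in> U'"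
  shows "bundle_point z' \<zeta> x = bundle_point z (\<zeta> * inverse (trans_jac z U' z' (z' x))) x"
  using vol_form_change[OF assms] trans_jac_nonzero[OF assms] by (simp add: bundle_point_def fun_eq_iff)

section \<open>Flat coordinates and the flat Hermitian metric\<close>

lemma flat_coord_bordered:
  assumes "flat_coord S lam U z" "w \<in> z ` U"
  shows "det (bordered (rho_in lam U z) w) = - 1"
proof -
  obtain x where x: "x \<in> U" "w = z x" using assms(2) by blast
  have R: "(\<lambda>w. complex_of_real (rho_S lam (inv_into U z w))) = rho_in lam U z"
    by (simp add: fun_eq_iff rho_c_def)
  have "J_op U z (rho_S lam) x = - det (bordered (\<lambda>w. complex_of_real (rho_S lam (inv_into U z w))) w)"
    unfolding J_op_def Let_def bordered_def x(2) ..
  then have "J_op U z (rho_S lam) x = - det (bordered (rho_in lam U z) w)"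
    unfolding R .
  then show ?thesis using assms(1) x(1) unfolding flat_coord_def by (simp add: eq_neg_iff_add_eq_0 add.commute)
qed

lemma flat_coord_holo: "flat_coord S lam U z \<Longrightarrow> holo_coord S U z"
  by (simp add: flat_coord_def)

text \<open>Both bordered determinants are \<open>- 1\<close>, and they differ by the square of the modulus of the Jacobian.\<close>
lemma flat_trans_jac:
  assumes f: "flat_coord S lam U z" and f': "flat_coord S lam U' z'" and x: "x \<in> U" "x \<in> U'"
  shows "cmod (trans_jac z U' z' (z' x)) = 1"
proof -
  let ?V = "U' \<inter> U" and ?\<phi> = "\<lambda>w. z (inv_into U' z' w)"
  note h = flat_coord_holo[OF f] and h' = flat_coord_holo[OF f']
  note hd = holo_coordD[OF h] and hd' = holo_coordD[OF h']
  have oV: "open ?V" using hd(1) hd'(1) by blast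
  have o: "open (z' ` ?V)" by (rule holo_coord_open_image[OF h' oV]) blast
  have zx: "z' x \<in> z' ` ?V" using x by blast
  have inv': "inv_into U' z' (z' y) = y" if "y \<in> U'" for y using inv_into_f_f[OF hd'(3) that] .
  have inv: "inv_into U z (z y) = y" if "y \<in> U" for y using inv_into_f_f[OF hd(3) that] .
  let ?R = "rho_in lam U z" and ?R' = "rho_c lam \<circ> inv_into U' z'"
  have sR: "smooth_on (z ` U) ?R" by (rule smooth_in_coord[OF h hd(1) subset_refl rho_smooth[OF hd(1,2)]])
  have im: "?\<phi> ` z' ` ?V \<subseteq> z ` U" using inv' by auto
  have "- 1 = det (bordered ?R' (z' x))" using flat_coord_bordered[OF f'] x by auto
  also have "bordered ?R' (z' x) = bordered (\<lambda>w. ?R (?\<phi> w)) (z' x)"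
    by (rule bordered_cong[OF o zx]) (use inv inv' in auto)
  also have "det \<dots> = of_real ((cmod (det (jac ?\<phi> (z' x))))\<^sup>2) * det (bordered ?R (?\<phi> (z' x)))"
    by (rule det_bordered_compose[OF o hd(4) im sR transition_holo_on[OF h' h] zx])
  also have "det (bordered ?R (?\<phi> (z' x))) = - 1"
    using flat_coord_bordered[OF f] x inv' by auto
  finally have "complex_of_real ((cmod (trans_jac z U' z' (z' x)))\<^sup>2) = of_real 1" by (simp add: trans_jac_def)
  then have "(cmod (trans_jac z U' z' (z' x)))\<^sup>2 = 1" using of_real_eq_iff by blast
  then show ?thesis by (simp add: power2_eq_1_iff)
     (smt (verit) norm_ge_zero)
qed

text \<open>The definition of \<open>h_S\<close> ranges over all flat coordinates; their transition Jacobians have modulus 1, so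
  each of them gives the same value.\<close>
lemma h_S_bundle_point:
  assumes f: "flat_coord S lam U z" and x: "x \<in> U"
  shows "h_S S lam (bundle_point z \<zeta> x) = (cmod \<zeta>)\<^sup>2"
  unfolding h_S_def
proof (rule the_equality)
  note h = flat_coord_holo[OF f]
  obtain z0 where "z0 ^ (CARD('n) + 2) = \<zeta>" using complex_root_exists[of "CARD('n) + 2" \<zeta>] by auto
  then have "z0 ^ (CARD('n) + 2) = fiber_coord S z (bundle_point z \<zeta> x)"
    by (simp only: fiber_coord_bundle_point[OF h x])
  moreover have "(cmod \<zeta>)\<^sup>2 = cmod z0 ^ (2 * (CARD('n) + 2))"
    unfolding \<open>z0 ^ (CARD('n) + 2) = \<zeta>\<close>[symmetric] norm_power
    by (subst mult.commute) (rule power_mult[symmetric])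
  ultimately
  show "\<exists>U z' z0. flat_coord S lam U z' \<and> fst (bundle_point z \<zeta> x) \<in> U \<and>
     z0 ^ (CARD('n) + 2) = fiber_coord S z' (bundle_point z \<zeta> x) \<and> (cmod \<zeta>)\<^sup>2 = cmod z0 ^ (2 * (CARD('n) + 2))"
    using f x unfolding bundle_point_def fst_conv by blast
next
  fix t assume "\<exists>U z' z0. flat_coord S lam U z' \<and> fst (bundle_point z \<zeta> x) \<in> U \<and>
     z0 ^ (CARD('n) + 2) = fiber_coord S z' (bundle_point z \<zeta> x) \<and> t = cmod z0 ^ (2 * (CARD('n) + 2))"
  then obtain U' z' z0 where f': "flat_coord S lam U' z'" and x': "x \<in> U'"
    and z0: "z0 ^ (CARD('n) + 2) = fiber_coord S z' (bundle_point z \<zeta> x)" and t: "t = cmod z0 ^ (2 * (CARD('n) + 2))"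
    by (auto simp: bundle_point_def)
  note h = flat_coord_holo[OF f] and h' = flat_coord_holo[OF f']
  have "bundle_point z \<zeta> x = bundle_point z' (\<zeta> * inverse (trans_jac z' U z (z x))) x"
    by (rule bundle_point_change[OF h' h x' x])
  then have z0': "z0 ^ (CARD('n) + 2) = \<zeta> * inverse (trans_jac z' U z (z x))"
    using z0 fiber_coord_bundle_point[OF h' x'] by simp
  have "t = (cmod (z0 ^ (CARD('n) + 2)))\<^sup>2"
    unfolding t norm_power by (subst mult.commute) (rule power_mult)
  then show "t = (cmod \<zeta>)\<^sup>2"
    unfolding z0' using flat_trans_jac[OF f' f x' x] by (simp add: norm_mult norm_inverse)
qed

section \<open>The ambient metric and its Laplacian\<close>

abbreviation theta :: "complex^('n option option) \<Rightarrow> complex" where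
  "theta \<equiv> log_fib (CARD('n) + 2)"

text \<open>\<open>\<theta>\<close> as a function on the canonical bundle.\<close>
definition log_h :: "real \<Rightarrow> ('s, 'n) canonical_elem \<Rightarrow> complex" where
  "log_h lam k = complex_of_real (ln (h_S S lam k) / real (CARD('n) + 2))"

text \<open>The point of the canonical bundle with fibre coordinate \<open>w $ None\<close> and base coordinates \<open>base_part w\<close>. For
  flat \<open>z\<close> these are the reference coordinates in which all Laplacians are compared.\<close>
definition hat_point :: "(real \<times> 's) set \<Rightarrow> (real \<times> 's \<Rightarrow> complex^('n option)) \<Rightarrow> complex^('n option option) \<Rightarrow> ('s, 'n) canonical_elem" where
  "hat_point U z w = bundle_point z (w $ None) (inv_into U z (base_part w))"

lemma flat_hat:
  assumes f: "flat_coord S lam U z" and w: "w $ None \<noteq> 0" "base_part w \<in> z ` U"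
  shows "log_h lam (hat_point U z w) = theta w"
    "complex_of_real (bold_rho S lam (hat_point U z w)) = exp (theta w) * (rho_in lam U z) (base_part w)"
proof -
  let ?x = "inv_into U z (base_part w)"
  have x: "?x \<in> U" using w(2) by (rule inv_into_into)
  have hS: "h_S S lam (hat_point U z w) = (cmod (w $ None))\<^sup>2"
    unfolding hat_point_def by (rule h_S_bundle_point[OF f x])
  show "log_h lam (hat_point U z w) = theta w"
    unfolding log_h_def log_fib_def hS ..
  have "(cmod (w $ None))\<^sup>2 powr (1 / real (CARD('n) + 2)) = exp (ln ((cmod (w $ None))\<^sup>2) / real (CARD('n) + 2))"
    using w(1) by (simp add: powr_def)
  then show "complex_of_real (bold_rho S lam (hat_point U z w)) = exp (theta w) * (rho_in lam U z) (base_part w)"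
    unfolding bold_rho_def hS log_fib_def
    by (simp add: hat_point_def bundle_point_def rho_c_def exp_of_real[symmetric] mult.commute del: of_nat_add of_nat_Suc)
qed

text \<open>The change from the coordinates of \<open>ambient_point S U' z'\<close> to the reference coordinates. It involves the
  power \<open>(z\<^sup>0)\<^sup>n\<^sup>+\<^sup>2\<close> but no root.\<close>
definition to_hat where
  "to_hat z U' z' w = (\<chi> A. case A of None \<Rightarrow> (w $ None) ^ (CARD('n) + 2) * inverse (trans_jac z U' z' (base_part w))
     | Some a \<Rightarrow> z (inv_into U' z' (base_part w)) $ a)"

lemma ambient_point_hat:
  assumes h: "holo_coord S U z" and h': "holo_coord S U' z'"
    and w: "base_part w \<in> z' ` (U' \<inter> U)"
  shows "ambient_point S U' z' w = hat_point U z (to_hat z U' z' w)"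
proof -
  obtain x where x: "x \<in> U'" "x \<in> U" "base_part w = z' x" using w by blast
  have inv': "inv_into U' z' (base_part w) = x" using x inv_into_f_f[OF holo_coordD(3)[OF h']] by simp
  have inv: "inv_into U z (z x) = x" using x inv_into_f_f[OF holo_coordD(3)[OF h]] by simp
  have bp: "base_part (to_hat z U' z' w) = z x"
    by (simp add: to_hat_def vec_eq_iff inv')
  have "ambient_point S U' z' w = bundle_point z' ((w $ None) ^ (CARD('n) + 2)) x"
    using inv' unfolding ambient_point_def bundle_point_def Let_def base_part_def by simp
  also have "\<dots> = bundle_point z ((w $ None) ^ (CARD('n) + 2) * inverse (trans_jac z U' z' (z' x))) x"
    by (rule bundle_point_change[OF h h' x(2,1)])
  also have "\<dots> = hat_point U z (to_hat z U' z' w)"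
    unfolding hat_point_def bp inv by (simp add: to_hat_def x(3))
  finally show ?thesis .
qed

text \<open>The Jacobian is block triangular, as the base coordinates do not depend on the fibre. Its diagonal
  blocks are \<open>\<partial>\<zeta>/\<partial>z\<^sup>0\<close>, nonzero off the zero section, and the Jacobian of the change of base coordinates.\<close>
lemma to_hat_holo:
  assumes h: "holo_coord S U z" and h': "holo_coord S U' z'"
  defines "W \<equiv> {w. w $ None \<noteq> 0 \<and> base_part w \<in> z' ` (U' \<inter> U)}"
  shows "open W" "w \<in> W \<Longrightarrow> to_hat z U' z' w $ None \<noteq> 0" "w \<in> W \<Longrightarrow> base_part (to_hat z U' z' w) \<in> z ` U"
    "holo_on W (\<lambda>w. to_hat z U' z' w $ A)"
    "w \<in> W \<Longrightarrow> invertible (jac (to_hat z U' z') w)"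
proof -
  let ?V = "U' \<inter> U" and ?\<phi> = "\<lambda>w. z (inv_into U' z' w)" and ?\<delta> = "trans_jac z U' z'"
  note hd = holo_coordD[OF h] and hd' = holo_coordD[OF h']
  have oV: "open ?V" using hd(1) hd'(1) by blast
  have o: "open (z' ` ?V)" by (rule holo_coord_open_image[OF h' oV]) blast
  show W: "open W" unfolding W_def by (rule open_base_part_vimage[OF o])
  have bp: "base_part w \<in> z' ` ?V" if "w \<in> W" for w using that by (simp add: W_def)
  have n0: "w $ None \<noteq> 0" if "w \<in> W" for w using that by (simp add: W_def)
  have d0: "?\<delta> w \<noteq> 0" if "w \<in> z' ` ?V" for w using that trans_jac_nonzero[OF h h'] by auto
  have hol: "holo_on (z' ` ?V) (\<lambda>w. ?\<phi> w $ a)" for a by (rule transition_holo_on[OF h' h])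
  have hd: "holo_on (z' ` ?V) ?\<delta>"
    unfolding trans_jac_def
    by (rule holo_on_det[OF o]) (simp add: jac_def holo_on_wirt[OF o hol])
  have hi: "holo_on (z' ` ?V) (\<lambda>w. inverse (?\<delta> w))"
    by (rule holo_on_inverse[OF o hd d0])
  have comp: "holo_on W (\<lambda>w. F (base_part w))" if "holo_on (z' ` ?V) F" for F
    by (rule holo_on_compose[OF W o _ that base_part_holo[OF W]]) (use bp in blast)
  show N: "to_hat z U' z' w $ None \<noteq> 0" if "w \<in> W"
    using n0[OF that] d0[OF bp[OF that]] by (simp add: to_hat_def)
  show "base_part (to_hat z U' z' w) \<in> z ` U" if "w \<in> W"
  proof -
    have "base_part (to_hat z U' z' w) = ?\<phi> (base_part w)"
      by (simp add: to_hat_def vec_eq_iff)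
    moreover have "inv_into U' z' (base_part w) \<in> U"
      using bp[OF that] inv_into_f_f[OF hd'(3)] by auto
    ultimately show ?thesis by simp
  qed
  have toN: "(\<lambda>w. to_hat z U' z' w $ None) = (\<lambda>w. (w $ None) ^ (CARD('n) + 2) * inverse (?\<delta> (base_part w)))"
    and toS: "(\<lambda>w. to_hat z U' z' w $ Some a) = (\<lambda>w. ?\<phi> (base_part w) $ a)" for a
    by (auto simp: to_hat_def)
  have hp: "holo_on W (\<lambda>w. (w $ None) ^ (CARD('n) + 2))" by (intro holo_on_power holo_on_coord W)
  show hN: "holo_on W (\<lambda>w. to_hat z U' z' w $ A)" for A
  proof (cases A)
    case None
    show ?thesis unfolding None toN by (intro holo_on_mult W comp hi hp)
  next
    case (Some a)
    show ?thesis unfolding Some toS by (intro comp hol)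
  qed
  show "invertible (jac (to_hat z U' z') w)" if w: "w \<in> W"
  proof -
    let ?K = "jac (to_hat z U' z') w"
    have dphi: "(\<lambda>w. ?\<phi> w $ a) differentiable (at (base_part w))" for a
      by (rule smooth_on_differentiable[OF holo_onD(1)[OF hol] bp[OF w]])
    have di: "(\<lambda>w. inverse (?\<delta> w)) differentiable (at (base_part w))"
      by (rule smooth_on_differentiable[OF holo_onD(1)[OF hi] bp[OF w]])
    have "?K $ None $ Some a = 0" for a
      unfolding jac_def by (simp add: toS wirt_base_part(1)[OF dphi])
    then have "det ?K = ?K $ None $ None * det (\<chi> a c. ?K $ Some a $ Some c)" by (rule det_option)
    moreover have "(\<chi> a c. ?K $ Some a $ Some c) = jac ?\<phi> (base_part w)"
      by (simp add: jac_def vec_eq_iff toS wirt_base_part(2)[OF dphi])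
    moreover have "?K $ None $ None = of_nat (CARD('n) + 2) * (w $ None) ^ ((CARD('n) + 2) - 1) * inverse (?\<delta> (base_part w))"
    proof -
      have dc: "(\<lambda>w :: complex^('n option option). w $ None) differentiable (at w)"
        by (rule smooth_on_differentiable[OF holo_onD(1)[OF holo_on_coord[OF W]] w])
      have "((\<lambda>x. x ^ (CARD('n) + 2)) has_field_derivative of_nat (CARD('n) + 2) * (w $ None) ^ ((CARD('n) + 2) - 1)) (at (w $ None))"
        by (rule DERIV_cong[OF DERIV_power[OF DERIV_ident]]) simp
      from wirt_field_compose(1)[OF this dc, of None]
      have p: "wirt None (\<lambda>w. (w $ None) ^ (CARD('n) + 2)) w = of_nat (CARD('n) + 2) * (w $ None) ^ ((CARD('n) + 2) - 1)"
        by (simp add: wirt_coord)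
      show ?thesis
        unfolding jac_def vec_lambda_beta toN
          wirt_mult(1)[OF smooth_on_differentiable[OF holo_onD(1)[OF hp] w] smooth_on_differentiable[OF holo_onD(1)[OF comp[OF hi]] w]]
          wirt_base_part(1)[OF di] p by simp
    qed
    moreover have "(of_nat (CARD('n) + 2) :: complex) \<noteq> 0" unfolding of_nat_eq_0_iff by simp
    ultimately have "det ?K \<noteq> 0"
      using n0[OF w] d0[OF bp[OF w]] by (simp add: trans_jac_def del: of_nat_add of_nat_Suc)
    then show ?thesis by (simp add: invertible_det_nz)
  qed
qed

text \<open>The entry at \<open>None\<close> is \<open>radial_rho\<close>. The other ones result from it by applying \<open>\<partial>\<^sub>a\<close>, which does not act on
  the antiholomorphic functions \<open>cnj Y\<^sup>b\<close>.\<close>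
lemma bordered_radial:
  fixes lam :: real
  assumes h: "holo_coord S U z" and w: "w \<in> z ` U"
  defines "R \<equiv> rho_in lam U z" and "Y \<equiv> \<lambda>b w. radial (\<lambda>y. z y $ b) (inv_into U z w)"
  shows "- of_real lam * bordered R w $ None $ A + (\<Sum>b\<in>UNIV. cnj (Y b w) * bordered R w $ Some b $ A)
    = (if A = None then 1 else 0)"
proof -
  note hd = holo_coordD[OF h]
  have sR: "smooth_on (z ` U) R" unfolding R_def
    by (rule smooth_in_coord[OF h hd(1) subset_refl rho_smooth[OF hd(1,2)]])
  have eq: "(\<Sum>b\<in>UNIV. cnj (Y b w) * wirt_bar b R w) = 1 + of_real lam * R w" if "w \<in> z ` U" for w
    using radial_rho[OF h that] by (simp add: R_def Y_def)
  have hY: "holo_on (z ` U) (Y b)" for b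
    using radial_holo_on[OF h, of b] by (simp add: Y_def comp_def)
  show ?thesis
  proof (cases A)
    case None
    then show ?thesis using eq[OF w] by simp
  next
    case (Some a)
    have dY: "(\<lambda>w. cnj (Y b w)) differentiable (at w)" for b
      by (rule smooth_on_differentiable[OF smooth_on_cnj[OF hd(4) holo_onD(1)[OF hY]] w])
    have dR: "wirt_bar b R differentiable (at w)" for b
      by (rule smooth_on_differentiable[OF smooth_on_wirt(2)[OF hd(4) sR] w])
    have wY: "wirt a (\<lambda>w. cnj (Y b w)) w = 0" for b
      using wirt_cnj(1)[OF smooth_on_differentiable[OF holo_onD(1)[OF hY] w]] holo_onD(2)[OF hY w] by simp
    have "(\<Sum>b\<in>UNIV. cnj (Y b w) * wirt a (wirt_bar b R) w) = (\<Sum>b\<in>UNIV. wirt a (\<lambda>w. cnj (Y b w) * wirt_bar b R w) w)"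
      by (simp add: wirt_mult(1)[OF dY dR] wY)
    also have "\<dots> = wirt a (\<lambda>w. \<Sum>b\<in>UNIV. cnj (Y b w) * wirt_bar b R w) w"
      by (rule wirt_sum(1)[symmetric]) (auto intro!: differentiable_mult dY dR)
    also have "\<dots> = wirt a (\<lambda>w. 1 + of_real lam * R w) w"
      by (rule wirt_cong(1)[OF hd(4) w eq])
    also have "\<dots> = of_real lam * wirt a R w"
      by (simp add: wirt_add(1) wirt_mult(1) wirt_const smooth_on_differentiable[OF sR w])
    finally show ?thesis using Some by simp
  qed
qed

text \<open>The ambient metric in the reference coordinates.\<close>
definition hat_metric :: "real \<Rightarrow> (real \<times> 's) set \<Rightarrow> (real \<times> 's \<Rightarrow> complex^('n option)) \<Rightarrow> complex^('n option option)
    \<Rightarrow> complex^('n option option)^('n option option)" where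
  "hat_metric lam U z w = (\<chi> A B. wirt A (wirt_bar B (\<lambda>w. exp (theta w) * (rho_in lam U z) (base_part w))) w)"

text \<open>Rescaling the fibre component of \<open>(- \<lambda>, cnj Y)\<close> gives a vector that the metric maps to a multiple of the
  first basis vector; its first component is therefore the wanted entry of the inverse. The product
  with the derivatives of \<open>\<theta>\<close> is the combination that occurs in the Laplacian.\<close>
lemma hat_metric_inverse:
  assumes f: "flat_coord S lam U z" and w: "w $ None \<noteq> 0" "base_part w \<in> z ` U"
  shows "invertible (hat_metric lam U z w)"
    "matrix_inv (hat_metric lam U z w) $ None $ None * (wirt None (theta) w * wirt_bar None (theta) w)
      = - of_real lam * exp (- theta w)"
proof -
  note h = flat_coord_holo[OF f]
  note hd = holo_coordD[OF h]
  let ?G = "hat_metric lam U z w" and ?R = "rho_in lam U z" and ?e = "exp (theta w)"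
  let ?b = "base_part w"
  define \<tau> where "\<tau> = inverse (of_nat (CARD('n) + 2)) * inverse (w $ None)"
  define E where "E = (\<lambda>A :: 'n option option. case A of None \<Rightarrow> \<tau> | Some a \<Rightarrow> 1)"
  have E: "E None = \<tau>" "E (Some a) = 1" for a by (auto simp: E_def)
  have t0: "\<tau> \<noteq> 0" using w(1) by (simp add: \<tau>_def del: of_nat_add of_nat_Suc)
  have sR: "smooth_on (z ` U) ?R"
    by (rule smooth_in_coord[OF h hd(1) subset_refl rho_smooth[OF hd(1,2)]])
  have G: "?G $ A $ B = ?e * (E A * bordered ?R ?b $ B $ A * cnj (E B))" for A B
    unfolding hat_metric_def E_def \<tau>_def vec_lambda_beta
    by (rule levi_form_cone_potential[OF hd(4) sR w])
  define DA where "DA = (\<chi> A B. if A = B then ?e * E A else 0)"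
  define DB where "DB = (\<chi> A B. if A = B then cnj (E A) else 0)"
  have "?G = DA ** transpose (bordered ?R ?b) ** DB"
    by (simp add: vec_eq_iff G matrix_matrix_mult_def DA_def DB_def transpose_def if_distrib[of "\<lambda>x. x * _"]
        if_distrib[of "\<lambda>x. _ * x"] cong: if_cong)
  moreover have "det DA \<noteq> 0" "det DB \<noteq> 0"
    using t0 by (auto simp: DA_def DB_def det_diagonal prod_UNIV_option E)
  moreover have "det (bordered ?R ?b) \<noteq> 0" using flat_coord_bordered[OF f w(2)] by simp
  ultimately have "det ?G \<noteq> 0" by (simp add: det_mul)
  then show inv: "invertible ?G" by (simp add: invertible_det_nz)
  \<comment> \<open>the fibre component absorbs the rescaling of the frame by \<open>cnj \<tau>\<close>\<close>
  define u where "u = (\<chi> B. case B of None \<Rightarrow> - of_real lam * inverse (cnj \<tau>)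
     | Some b \<Rightarrow> cnj (radial (\<lambda>y. z y $ b) (inv_into U z ?b)))"
  have "?G *v u = axis None (?e * \<tau>)"
  proof (rule vec_eq_iff[THEN iffD2, rule_format])
    fix A
    have "(?G *v u) $ A = ?e * E A * (- of_real lam * bordered ?R ?b $ None $ A
        + (\<Sum>b\<in>UNIV. cnj (radial (\<lambda>y. z y $ b) (inv_into U z ?b)) * bordered ?R ?b $ Some b $ A))"
      using t0 by (simp add: matrix_vector_mult_def sum_UNIV_option G u_def E sum_distrib_left algebra_simps)
    also have "\<dots> = axis None (?e * \<tau>) $ A"
      unfolding bordered_radial[OF h w(2)] by (simp add: axis_def E)
    finally show "(?G *v u) $ A = axis None (?e * \<tau>) $ A" .
  qed
  then have "matrix_inv ?G *v (?G *v u) = matrix_inv ?G *v axis None (?e * \<tau>)" by simp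
  then have "u = matrix_inv ?G *v axis None (?e * \<tau>)"
    by (simp add: matrix_vector_mul_assoc matrix_inv_works(2)[OF inv])
  then have "u $ None = (matrix_inv ?G *v axis None (?e * \<tau>)) $ None" by simp
  also have "\<dots> = matrix_inv ?G $ None $ None * (?e * \<tau>)"
    by (simp add: matrix_vector_mult_def axis_def if_distrib[of "\<lambda>x. _ * x"] cong: if_cong)
  finally have "- of_real lam * inverse (cnj \<tau>) = matrix_inv ?G $ None $ None * (?e * \<tau>)" by (simp add: u_def)
  then have "matrix_inv ?G $ None $ None * (\<tau> * cnj \<tau>) = - of_real lam * inverse ?e"
    using t0 by (simp add: field_simps)
  then show "matrix_inv ?G $ None $ None * (wirt None (theta) w * wirt_bar None (theta) w)
      = - of_real lam * exp (- theta w)"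
    by (simp only: log_fib_wirt[OF w(1)] \<tau>_def exp_minus simp_thms if_True)
qed

abbreviation "coord_laplacian lam F U z w \<equiv>
  - (\<Sum>A\<in>UNIV. \<Sum>B\<in>UNIV. matrix_inv (ambient_metric S lam U z w) $ B $ A *
       wirt A (wirt_bar B (\<lambda>w. F (ambient_point S U z w))) w)"

text \<open>Both the metric and the Levi form of \<open>F\<close> are pulled back from the reference coordinates by the same
  holomorphic map, where the latter has a single nonzero entry.\<close>
lemma ambient_laplacian_formula:
  assumes f: "flat_coord S lam U z" and h': "holo_coord S U' z'"
    and w: "w $ None \<noteq> 0" "base_part w \<in> z' ` (U' \<inter> U)"
    and d: "\<And>s. (h has_field_derivative h1 s) (at s)" "\<And>s. (h1 has_field_derivative h2 s) (at s)"
    and sh: "smooth_on UNIV h"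
    and F: "\<And>\<zeta> x. \<zeta> \<noteq> 0 \<Longrightarrow> x \<in> U \<Longrightarrow> F (bundle_point z \<zeta> x) = h (log_h lam (bundle_point z \<zeta> x))"
  defines "k \<equiv> ambient_point S U' z' w"
  shows "coord_laplacian lam F U' z' w
     = of_real lam * exp (- log_h lam k) * h2 (log_h lam k)"
proof -
  note h = flat_coord_holo[OF f]
  note hd = holo_coordD[OF h]
  define W where "W = {w :: complex^('n option option). w $ None \<noteq> 0 \<and> base_part w \<in> z' ` (U' \<inter> U)}"
  define O' where "O' = {w :: complex^('n option option). w $ None \<noteq> 0 \<and> base_part w \<in> z ` U}"
  note th = to_hat_holo[OF h h', folded W_def]
  let ?\<Psi> = "to_hat z U' z'"
  have wW: "w \<in> W" using w by (simp add: W_def)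
  have O: "open O'" unfolding O'_def by (rule open_base_part_vimage[OF hd(4)])
  have im: "?\<Psi> ` W \<subseteq> O'" using th(2,3) by (auto simp: O'_def)
  let ?P = "\<lambda>w :: complex^('n option option). exp (theta w) * (rho_in lam U z) (base_part w)"
  let ?H = "\<lambda>w :: complex^('n option option). h (theta w)"
  have sl: "smooth_on O' (theta)" by (rule log_fib_smooth[OF O]) (simp add: O'_def)
  have sR: "smooth_on (z ` U) (rho_in lam U z)"
    by (rule smooth_in_coord[OF h hd(1) subset_refl rho_smooth[OF hd(1,2)]])
  have sb: "smooth_on O' base_part" by (rule smooth_on_vec[OF O holo_onD(1)[OF base_part_holo[OF O]]])
  have sP: "smooth_on O' ?P"
    by (intro smooth_on_mult O smooth_on_exp sl smooth_on_compose[OF O hd(4) sb sR]) (auto simp: O'_def)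
  have sH: "smooth_on O' ?H"
    by (rule smooth_on_compose[OF O open_UNIV sl sh]) simp
  have pt: "ambient_point S U' z' y = hat_point U z (?\<Psi> y)" if "y \<in> W" for y
    by (rule ambient_point_hat[OF h h']) (use that in \<open>simp add: W_def\<close>)
  have hat: "log_h lam (hat_point U z y) = theta y" "complex_of_real (bold_rho S lam (hat_point U z y)) = ?P y"
    if "y \<in> O'" for y
    using flat_hat[OF f] that by (auto simp: O'_def)
  have Fhat: "F (hat_point U z y) = ?H y" if "y \<in> O'" for y
  proof -
    have "F (hat_point U z y) = h (log_h lam (hat_point U z y))"
      unfolding hat_point_def
      by (rule F) (use that inv_into_into[of "base_part y" z U] in \<open>simp_all add: O'_def\<close>)
    then show ?thesis using hat(1)[OF that] by simp
  qed
  have \<Psi>w: "?\<Psi> w \<in> O'" using im wW by blast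
  define K where "K = jac ?\<Psi> w"
  define H where "H = (\<chi> D B. cnj (K $ B $ D))"
  define G where "G = hat_metric lam U z (?\<Psi> w)"
  define L where "L = (\<chi> A B. wirt A (wirt_bar B ?H) (?\<Psi> w))"
  have lf: "wirt A (wirt_bar B (\<lambda>w. f (?\<Psi> w))) w = (K ** (\<chi> C D. wirt C (wirt_bar D f) (?\<Psi> w)) ** H) $ A $ B"
    if "smooth_on O' f" for f A B
    using levi_form_compose[OF th(1) O im that th(4) wW, of A B]
    by (simp add: matrix_matrix_mult_def K_def H_def jac_def sum_distrib_right) (rule sum.swap)
  have g: "ambient_metric S lam U' z' w = K ** G ** H"
  proof (rule vec_eq_iff[THEN iffD2, rule_format], rule vec_eq_iff[THEN iffD2, rule_format])
    fix A B
    have "ambient_metric S lam U' z' w $ A $ B = wirt A (wirt_bar B (\<lambda>w. ?P (?\<Psi> w))) w"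
      unfolding ambient_metric_def vec_lambda_beta
      by (rule levi_form_cong[OF th(1) wW]) (use pt hat(2) im in \<open>simp add: image_subset_iff\<close>)
    also have "\<dots> = (K ** G ** H) $ A $ B"
      unfolding lf[OF sP] G_def hat_metric_def ..
    finally show "ambient_metric S lam U' z' w $ A $ B = (K ** G ** H) $ A $ B" .
  qed
  have Lw: "wirt A (wirt_bar B (\<lambda>w. F (ambient_point S U' z' w))) w = (K ** L ** H) $ A $ B" for A B
  proof -
    have "wirt A (wirt_bar B (\<lambda>w. F (ambient_point S U' z' w))) w = wirt A (wirt_bar B (\<lambda>w. ?H (?\<Psi> w))) w"
      by (rule levi_form_cong[OF th(1) wW]) (use pt Fhat im in \<open>simp add: image_subset_iff\<close>)
    then show ?thesis unfolding lf[OF sH] L_def .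
  qed
  have iK: "invertible K" unfolding K_def by (rule th(5)[OF wW])
  have "H = (\<chi> i j. cnj (transpose K $ i $ j))" by (simp add: H_def transpose_def)
  then have iH: "invertible H" using iK by (simp add: invertible_det_nz det_cnj)
  have iG: "invertible G" unfolding G_def using hat_metric_inverse(1)[OF f] \<Psi>w by (simp add: O'_def)
  have "(\<Sum>A\<in>UNIV. \<Sum>B\<in>UNIV. matrix_inv (ambient_metric S lam U' z' w) $ B $ A *
              wirt A (wirt_bar B (\<lambda>w. F (ambient_point S U' z' w))) w) =
    (\<Sum>A\<in>UNIV. \<Sum>B\<in>UNIV. matrix_inv (K ** G ** H) $ B $ A * (K ** L ** H) $ A $ B)"
    unfolding g Lw ..
  also have "\<dots> = trace (matrix_inv (K ** G ** H) ** (K ** L ** H))"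
    unfolding trace_def matrix_matrix_mult_def[of "matrix_inv (K ** G ** H)"] vec_lambda_beta by (rule sum.swap)
  also have "\<dots> = trace (matrix_inv G ** L)" by (rule trace_congruence[OF iK iG iH])
  also have "\<dots> = matrix_inv G $ None $ None * L $ None $ None"
  proof -
    have N: "?\<Psi> w $ None \<noteq> 0" using \<Psi>w by (simp add: O'_def)
    have "L $ A $ B = 0" if "A \<noteq> None \<or> B \<noteq> None" for A B
      using that unfolding L_def vec_lambda_beta levi_form_log_fib[OF N d] log_fib_wirt[OF N] by auto
    then show ?thesis
      unfolding trace_def matrix_matrix_mult_def vec_lambda_beta by (simp add: sum_UNIV_option)
  qed
  also have "L $ None $ None = h2 (theta (?\<Psi> w)) * (wirt None (theta) (?\<Psi> w) * wirt_bar None (theta) (?\<Psi> w))"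
    unfolding L_def vec_lambda_beta
    by (subst levi_form_log_fib[OF _ d]) (use \<Psi>w in \<open>simp_all add: O'_def mult.assoc\<close>)
  also have "matrix_inv G $ None $ None * \<dots> = h2 (theta (?\<Psi> w)) * (- of_real lam * exp (- theta (?\<Psi> w)))"
    unfolding G_def using hat_metric_inverse(2)[OF f, of "?\<Psi> w"] \<Psi>w by (simp add: O'_def mult_ac)
  finally show ?thesis
    unfolding k_def pt[OF wW] hat(1)[OF \<Psi>w] by simp
qed

text \<open>A coordinate system at \<open>k\<close> exists because \<open>\<zeta>\<close> has a root \<open>z\<^sup>0\<close>, and all of them give the same value.\<close>
lemma ambient_laplacian_log_h:
  assumes f: "flat_coord S lam U z" and x: "x \<in> U" and \<zeta>: "\<zeta> \<noteq> 0"
    and d: "\<And>s. (h has_field_derivative h1 s) (at s)" "\<And>s. (h1 has_field_derivative h2 s) (at s)"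
    and sh: "smooth_on UNIV h"
    and F: "\<And>\<zeta> x. \<zeta> \<noteq> 0 \<Longrightarrow> x \<in> U \<Longrightarrow> F (bundle_point z \<zeta> x) = h (log_h lam (bundle_point z \<zeta> x))"
  defines "k \<equiv> bundle_point z \<zeta> x"
  shows "ambient_laplacian S lam F k = of_real lam * exp (- log_h lam k) * h2 (log_h lam k)"
  unfolding ambient_laplacian_def
proof (rule the_equality)
  note h = flat_coord_holo[OF f]
  obtain z0 where z0: "z0 ^ (CARD('n) + 2) = \<zeta>" using complex_root_exists[of "CARD('n) + 2" \<zeta>] by auto
  define w where "w = (\<chi> A. case A of None \<Rightarrow> z0 | Some a \<Rightarrow> z x $ a)"
  have w0: "w $ None \<noteq> 0" using z0 \<zeta> by (auto simp: w_def)
  have bw: "base_part w = z x" by (simp add: base_part_def w_def vec_eq_iff)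
  have dom: "w \<in> ambient_dom U z" using w0 bw x by (auto simp: ambient_dom_def base_part_def)
  have inv: "inv_into U z (z x) = x" using inv_into_f_f[OF holo_coordD(3)[OF h] x] .
  have pt: "ambient_point S U z w = k"
  proof -
    have "w $ None ^ (CARD('n) + 2) = \<zeta>"
      by (simp only: w_def vec_lambda_beta option.case z0)
    then show ?thesis
      unfolding k_def ambient_point_def bundle_point_def Let_def
      by (simp only: inv bw[unfolded base_part_def])
  qed
  have "of_real lam * exp (- log_h lam k) * h2 (log_h lam k) =
    coord_laplacian lam F U z w"
    using ambient_laplacian_formula[OF f h w0 _ d sh F] bw x pt by simp
  then show "\<exists>U z w. holo_coord S U z \<and> w \<in> ambient_dom U z \<and> ambient_point S U z w = k \<and>
     of_real lam * exp (- log_h lam k) * h2 (log_h lam k) = coord_laplacian lam F U z w"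
    using h dom pt by blast
next
  fix t assume "\<exists>U z w. holo_coord S U z \<and> w \<in> ambient_dom U z \<and> ambient_point S U z w = k \<and>
     t = coord_laplacian lam F U z w"
  then obtain U' z' w where h': "holo_coord S U' z'" and w: "w \<in> ambient_dom U' z'" and pt: "ambient_point S U' z' w = k"
    and t: "t = coord_laplacian lam F U' z' w" by blast
  have w0: "w $ None \<noteq> 0" and bw: "base_part w \<in> z' ` U'" using w by (auto simp: ambient_dom_def base_part_def)
  then obtain y where y: "y \<in> U'" "base_part w = z' y" by blast
  have "inv_into U' z' (base_part w) = y" using inv_into_f_f[OF holo_coordD(3)[OF h'] y(1)] y(2) by simp
  then have "fst (ambient_point S U' z' w) = y" by (simp add: ambient_point_def Let_def base_part_def)
  then have "y = x" using pt by (simp add: k_def bundle_point_def)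
  then have "base_part w \<in> z' ` (U' \<inter> U)" using y x by blast
  from ambient_laplacian_formula[OF f h' w0 this d sh F] show "t = of_real lam * exp (- log_h lam k) * h2 (log_h lam k)"
    unfolding t pt .
qed

section \<open>The Q-prime curvature\<close>

lemma iterated_laplacian:
  assumes f: "flat_coord S lam U z" and x: "x \<in> U" and \<zeta>: "\<zeta> \<noteq> 0"
  defines "F0 \<equiv> \<lambda>k. complex_of_real ((ln (h_S S lam k))\<^sup>2)"
  shows "(ambient_laplacian S lam ^^ Suc m) F0 (bundle_point z \<zeta> x) =
    2 * of_nat (CARD('n) + 2) ^ 2 * of_real lam ^ Suc m * (fact m)\<^sup>2 * exp (- of_nat (Suc m) * log_h lam (bundle_point z \<zeta> x))"
  using x \<zeta>
proof (induction m arbitrary: x \<zeta>)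
  case 0
  let ?h = "\<lambda>s :: complex. of_nat (CARD('n) + 2) ^ 2 * (s * s)"
  have d: "(?h has_field_derivative of_nat (CARD('n) + 2) ^ 2 * (2 * s)) (at s)"
     "((\<lambda>s. of_nat (CARD('n) + 2) ^ 2 * (2 * s)) has_field_derivative of_nat (CARD('n) + 2) ^ 2 * 2) (at s)" for s :: complex
    by (auto intro!: derivative_eq_intros)
  have s: "smooth_on UNIV ?h"
    by (intro smooth_on_mult smooth_on_const smooth_on_ident open_UNIV)
  have F: "F0 k = ?h (log_h lam k)" for k
    by (simp add: F0_def log_h_def power2_eq_square field_simps del: of_nat_add of_nat_Suc)
  have "ambient_laplacian S lam F0 (bundle_point z \<zeta> x) = of_real lam * exp (- log_h lam (bundle_point z \<zeta> x)) * (of_nat (CARD('n) + 2) ^ 2 * 2)"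
    by (rule ambient_laplacian_log_h[OF f 0 d s F])
  then show ?case by (simp add: mult_ac)
next
  case (Suc m)
  let ?c = "2 * of_nat (CARD('n) + 2) ^ 2 * of_real lam ^ Suc m * (fact m)\<^sup>2 :: complex" and ?k = "of_nat (Suc m) :: complex"
  let ?h = "\<lambda>s. ?c * exp (- ?k * s)"
  have d: "(?h has_field_derivative ?c * (- ?k * exp (- ?k * s))) (at s)"
     "((\<lambda>s. ?c * (- ?k * exp (- ?k * s))) has_field_derivative ?c * (- ?k * (- ?k * exp (- ?k * s)))) (at s)" for s
    by (auto intro!: derivative_eq_intros)
  have s: "smooth_on UNIV ?h"
    by (intro smooth_on_mult smooth_on_exp smooth_on_const smooth_on_ident open_UNIV)
  let ?p = "bundle_point z \<zeta> x"
  have "ambient_laplacian S lam ((ambient_laplacian S lam ^^ Suc m) F0) ?p =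
      of_real lam * exp (- log_h lam ?p) * (?c * (- ?k * (- ?k * exp (- ?k * log_h lam ?p))))"
    by (rule ambient_laplacian_log_h[OF f Suc.prems d s Suc.IH])
  also have "\<dots> = ?c * of_real lam * ?k\<^sup>2 * (exp (- log_h lam ?p) * exp (- ?k * log_h lam ?p))"
    by (simp add: power2_eq_square mult_ac del: of_nat_add of_nat_Suc)
  also have "exp (- log_h lam ?p) * exp (- ?k * log_h lam ?p) = exp (- of_nat (Suc (Suc m)) * log_h lam ?p)"
    unfolding exp_add[symmetric] by (rule arg_cong[where f = exp]) (simp add: algebra_simps)
  also have "?c * of_real lam * ?k\<^sup>2 = 2 * of_nat (CARD('n) + 2) ^ 2 * of_real lam ^ Suc (Suc m) * (fact (Suc m))\<^sup>2"
    by (simp add: power2_eq_square mult_ac del: of_nat_add of_nat_Suc)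
  finally show ?case by simp
qed

text \<open>The factor \<open>h\<^bsup>(n+1)/(n+2)\<^esup> = e\<^bsup>(n+1)\<theta>\<^esup>\<close> cancels the exponential of the last iterate.\<close>
lemma bold_Q_prime_value:
  assumes f: "flat_coord S lam U z" and x: "x \<in> U" and \<zeta>: "\<zeta> \<noteq> 0"
  defines "k \<equiv> bundle_point z \<zeta> x"
  shows "bold_Q_prime S lam k * of_real (h_S S lam k powr (real (CARD('n) + 1) / real (CARD('n) + 2)))
    = of_real (2 * (fact CARD('n))\<^sup>2 * lam ^ (CARD('n) + 1))"
proof -
  have pos: "h_S S lam k > 0" using h_S_bundle_point[OF f x] \<zeta> by (simp add: k_def)
  have e: "exp (of_nat (Suc CARD('n)) * log_h lam k) = of_real (h_S S lam k powr (real (CARD('n) + 1) / real (CARD('n) + 2)))"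
    using pos by (simp add: powr_def log_h_def exp_of_real[symmetric] del: of_nat_add of_nat_Suc)
  have "bold_Q_prime S lam k = 2 * of_real lam ^ Suc CARD('n) * (fact CARD('n))\<^sup>2 * exp (- of_nat (Suc CARD('n)) * log_h lam k)"
    using iterated_laplacian[OF f x \<zeta>, of "CARD('n)"]
    unfolding bold_Q_prime_def k_def by (simp del: of_nat_add of_nat_Suc funpow.simps)
  then show ?thesis
    unfolding e[symmetric] by (simp add: exp_minus del: of_nat_add of_nat_Suc)
qed

lemma canonical_bundle_point:
  assumes h: "holo_coord S U z" and x: "x \<in> U"
  shows "k \<in> canonical_bundle S \<and> fst k = x \<longleftrightarrow> (\<exists>\<zeta>. \<zeta> \<noteq> 0 \<and> k = bundle_point z \<zeta> x)"
proof
  assume "k \<in> canonical_bundle S \<and> fst k = x"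
  then obtain U' z' \<zeta> where h': "holo_coord S U' z'" and x': "x \<in> U'" and "\<zeta> \<noteq> 0" and k: "k = bundle_point z' \<zeta> x"
    unfolding canonical_bundle_def bundle_point_def by auto
  then show "\<exists>\<zeta>. \<zeta> \<noteq> 0 \<and> k = bundle_point z \<zeta> x"
    using bundle_point_change[OF h h' x x'] trans_jac_nonzero[OF h h' x x']
    by (intro exI[of _ "\<zeta> * inverse (trans_jac z U' z' (z' x))"]) auto
next
  assume "\<exists>\<zeta>. \<zeta> \<noteq> 0 \<and> k = bundle_point z \<zeta> x"
  then show "k \<in> canonical_bundle S \<and> fst k = x"
    unfolding canonical_bundle_def bundle_point_def using h x by auto
qed

lemma Q_prime_value:
  assumes f: "flat_coord S lam U z" and p: "(1, p) \<in> U"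
  shows "Q_prime S lam p = of_real (2 * (fact CARD('n))\<^sup>2 * lam ^ (CARD('n) + 1))"
proof -
  note iff = canonical_bundle_point[OF flat_coord_holo[OF f] p]
  show ?thesis
    unfolding Q_prime_def
  proof (rule the_equality)
    have "bundle_point z 1 (1, p) \<in> canonical_bundle S \<and> fst (bundle_point z 1 (1, p)) = (1, p)"
      using iff by (metis one_neq_zero)
    then show "\<exists>k\<in>canonical_bundle S. fst k = (1, p) \<and> of_real (2 * (fact CARD('n))\<^sup>2 * lam ^ (CARD('n) + 1)) =
        bold_Q_prime S lam k * of_real (h_S S lam k powr (real (CARD('n) + 1) / real (CARD('n) + 2)))"
      using bold_Q_prime_value[OF f p, of 1] by (intro bexI[of _ "bundle_point z 1 (1, p)"]) auto
  next
    fix q assume "\<exists>k\<in>canonical_bundle S. fst k = (1, p) \<and>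
        q = bold_Q_prime S lam k * of_real (h_S S lam k powr (real (CARD('n) + 1) / real (CARD('n) + 2)))"
    then obtain k where "k \<in> canonical_bundle S \<and> fst k = (1, p)"
      and q: "q = bold_Q_prime S lam k * of_real (h_S S lam k powr (real (CARD('n) + 1) / real (CARD('n) + 2)))" by blast
    then obtain \<zeta> where "\<zeta> \<noteq> 0" "k = bundle_point z \<zeta> (1, p)" using iff by blast
    then show "q = of_real (2 * (fact CARD('n))\<^sup>2 * lam ^ (CARD('n) + 1))"
      using q bold_Q_prime_value[OF f p] by simp
  qed
qed

end

theorem theorem1p3:
  fixes S :: "('s::{t2_space, second_countable_topology}, 'n::finite) contact_data"
    and lam :: real
  assumes "sasakian_eta_einstein S lam"
    and "flat_coord S lam U z" and "(1, p) \<in> U"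
  shows "Q_prime S lam p = of_real (2 * (fact CARD('n))\<^sup>2 * lam ^ (CARD('n) + 1))"
proof -
  interpret contact_mfd S
    by unfold_locales (use assms(1) in \<open>simp add: sasakian_eta_einstein_def sasakian_def\<close>)
  show ?thesis by (rule Q_prime_value[OF assms(2,3)])
qed

end
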